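(* Let $V$ be a finite-dimensional real vector space with a linear action of a finite group $G$, and let $$\xi=\sum_\alpha\xi_\alpha\in\Gamma\Big(\bigoplus_{\alpha\in G}\wedge^{k-l(\alpha)}TV^\alpha\otimes\wedge^{l(\alpha)}N^\alpha\Big)^G,\qquad \eta=\sum_\beta\eta_\beta\in\Gamma\Big(\bigoplus_{\beta\in G}\wedge^{l-l(\beta)}TV^\beta\otimes\wedge^{l(\beta)}N^\beta\Big)^G .$$ If $\alpha,\beta\in G$ satisfy $V^\alpha\cap V^\beta=V^{\alpha\beta}$, then the contribution of $\xi_\alpha$ and $\eta_\beta$ to the $\alpha\beta$ component of $L(T(\xi)\circ T(\eta))$ equals $$pr^{\alpha\beta}\big((\xi_\alpha\circ\eta_\beta)|_{V^{\alpha\beta}}\big),$$ where $\circ$ in this formula is the standard pre-Lie product of multivector fields on $V$.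
   Context: Setting. $A=\mathrm{Poly}(V)$ is the algebra of polynomial functions; $G$ acts effectively on $V$ and on $A$ by $(gf)(x)=f(g^{-1}x)$; $A\rtimes G$ is spanned by $aU_g$ with $(aU_g)(bU_h)=a\,g(b)U_{gh}$. Scalars are extended to $\mathbb C$ when needed for eigen-coordinates. $A_g$ is $A$ with bimodule structure $a\cdot\xi\cdot b=a\xi g(b)$. $C^k(A,M)=\mathrm{Hom}(A^{\otimes k},M)$. $G$ acts on $C^\bullet(A,A\rtimes G)$ by $(h\Psi)(f_1,\dots,f_k)=U_h\Psi(h^{-1}f_1,\dots,h^{-1}f_k)U_{h^{-1}}$. For an algebra $B$, the pre-Lie product on $C^\bullet(B,B)$ is $\phi\circ\psi(a_1,\dots,a_{k+l-1})=\sum_{i=1}^k(-1)^{(i-1)(l-1)}\phi(a_1,\dots,a_{i-1},\psi(a_i,\dots,a_{i+l-1}),a_{i+l},\dots,a_{k+l-1})$ for $\phi\in C^k$, $\psi\in C^l$. For $g\in G$, $V^g$ is the fixed subspace, $N^g$ the sum of the nontrivial irreducible subrepresentations of $\langle g\rangle$ in $V$, $V=V^g\oplus N^g$, $l(g)=\dim N^g$. Sections $\Gamma$ have polynomial coefficients on $V^g$ and are regarded as multivector fields on $V$ by extending them constantly along $N^g$; $G$ acts by $(h\xi)_{hgh^{-1}}=h_*\xi_g$. Multivectors act on functions by $(v_1\wedge\cdots\wedge v_k)(f_1,\dots,f_k)=\frac1{k!}\sum_{\sigma\in S_k}(-1)^\sigma\prod_jv_{\sigma(j)}(f_j)$. The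 map $L=L_3L_2L_1$. $L_1(\Psi)$ is the $G$-average of the restriction of $\Psi\in C^k(A\rtimes G,A\rtimes G)$ to $A^{\otimes k}$. $L_2=\sum_gL_2^g$, where for $\Psi\in C^k(A,A_g)$, $p\in V$, $L_2^g(\Psi)(p)=\sum_{i_1,\dots,i_k}\frac1{k!}\sum_{\sigma\in S_k}(-1)^\sigma\Psi(x^{i_{\sigma(1)}}-x^{i_{\sigma(1)}}(p),\dots,x^{i_{\sigma(k)}}-x^{i_{\sigma(k)}}(p))(p)\,\frac{\partial}{\partial x^{i_1}}\wedge\cdots\wedge\frac{\partial}{\partial x^{i_k}}$, with $x^i$ linear coordinates on $V$. $L_3=\sum_gL_3^g$, $L_3^g(X)=pr^g(X|_{V^g})$, with $pr^g:\wedge^\bullet TV|_{V^g}\to\wedge^{\bullet-l(g)}TV^g\otimes\wedge^{l(g)}N^g$ the projection. Twisted cocycle. For each $g$ choose linear coordinates $x$ on $V^g$ and coordinates $y^1,\dots,y^{l}$ ($l=l(g)$) on $N^g$ that are eigenfunctions of $g$; put $\tilde y^i=g(y^i)$. For $\sigma\in S_l$ let $z^j_\sigma$ be obtained from $(y^1,\dots,y^l)$ by replacing $y^{\sigma(1)},\dots,y^{\sigma(j)}$ by $\tilde y^{\sigma(1)},\dots,\tilde y^{\sigma(j)}$. Define $\Omega_g\in C^l(A,A_g)$ by $\Omega_g(f_1,\dots,f_l)(x,y)=\frac1{l!}\sum_{\sigma\in S_l}(-1)^\sigma\prod_{j=1}^l\big(f_j(x,z_\sigma^{j-1})-f_j(x,z_\sigma^j)\big)\big/\prod_{j=1}^l(y^j-\tilde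 y^j)$, and $\Lambda_g=\frac{\partial}{\partial y^1}\wedge\cdots\wedge\frac{\partial}{\partial y^l}$. The map $T=T_2T_1$. For $\xi_g=X_g\otimes\Lambda_g$, $T_1^g(\xi_g)(f_1,\dots,f_k)=X_g(f_1,\dots,f_{k-l(g)})\,\Omega_g(f_{k-l(g)+1},\dots,f_k)$; $T_1(\xi)$ is the $G$-average of $\sum_gT_1^g(\xi_g)U_g$; $T_2(\Phi)(a_1U_{g_1},\dots,a_kU_{g_k})=\Phi(a_1,g_1(a_2),\dots,g_1\cdots g_{k-1}(a_k))U_{g_1\cdots g_k}$. Contribution. Write $T_1(\xi)=\sum_\alpha\xi^T_\alpha U_\alpha$ and $T_1(\eta)=\sum_\beta\eta_\beta^TU_\beta$. Put $P_{\alpha,\beta}(f_1,\dots,f_{k+l-1})=\sum_{s=1}^k(-1)^{(s-1)(l-1)}\xi^T_\alpha\big(f_1,\dots,f_{s-1},\eta^T_\beta(f_s,\dots,f_{s+l-1}),\beta(f_{s+l}),\dots,\beta(f_{k+l-1})\big)$, an element of $C^{k+l-1}(A,A_{\alpha\beta})$; then $L_1(T(\xi)\circ T(\eta))=\sum_{\alpha,\beta}P_{\alpha,\beta}U_{\alpha\beta}$. The contribution of $\xi_\alpha,\eta_\beta$ to the $\alpha\beta$ component of $L(T(\xi)\circ T(\eta))$ is $L_3^{\alpha\beta}L_2^{\alpha\beta}(P_{\alpha,\beta})$. Standard pre-Lie product. For multivector fields $\xi$ (degree $k$), $\eta$ (degree $l$) on $V$: $\xi\circ\eta=\sum_{i_1,\dots,i_{k+l-1}}\sum_{s=1}^k(-1)^{(s-1)(l-1)}\xi\big(x^{i_1},\dots,x^{i_{s-1}},\eta(x^{i_s},\dots,x^{i_{s+l-1}}),x^{i_{s+l}},\dots,x^{i_{k+l-1}}\big)\frac{\partial}{\partial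 x^{i_1}}\wedge\cdots\wedge\frac{\partial}{\partial x^{i_{k+l-1}}}$. *)

theory Defs
  imports
    "HOL-Analysis.Analysis"
    "HOL-Algebra.Group_Action"
    "HOL-Algebra.Generated_Groups"
    "HOL-Combinatorics.Permutations"
begin

section \<open>Complexification and polynomial functions\<close>

text \<open>
  The pair \<open>(a, b)\<close> stands for \<open>a + \<i>b\<close>, so the complexification of \<open>V = 'v\<close> is \<open>'v \<times> 'v\<close> and the
  complexification of a real subspace \<open>W\<close> is \<open>W \<times> W\<close>.  All functions and multivector fields live on
  the complexification; \<open>V\<close> is the set of points \<open>(a, 0)\<close>, on which a polynomial is determined.
\<close>

type_synonym 'v cx = "'v \<times> 'v"
type_synonym 'v cfun = "'v cx \<Rightarrow> complex"

definition cscale :: "complex \<Rightarrow> 'v::real_vector cx \<Rightarrow> 'v cx" where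
  "cscale c z = (Re c *\<^sub>R fst z - Im c *\<^sub>R snd z, Im c *\<^sub>R fst z + Re c *\<^sub>R snd z)"

lemma vector_space_cscale: "vector_space (cscale :: complex \<Rightarrow> 'v::real_vector cx \<Rightarrow> 'v cx)"
  by unfold_locales (auto simp: cscale_def algebra_simps)

definition cxmap :: "('v \<Rightarrow> 'v) \<Rightarrow> 'v cx \<Rightarrow> 'v cx" where
  "cxmap f = map_prod f f"

definition cxset :: "'v set \<Rightarrow> 'v cx set" where
  "cxset W = W \<times> W"

definition covectors :: "'v::real_vector cfun set" where
  "covectors = {\<phi>. Vector_Spaces.linear cscale (*) \<phi>}"

text \<open>\<open>Poly\<close> is the algebra \<open>A\<close>, with complex scalars.\<close>

inductive_set Poly :: "'v::real_vector cfun set" where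
  const: "(\<lambda>_. c) \<in> Poly"
| covec: "\<phi> \<in> covectors \<Longrightarrow> \<phi> \<in> Poly"
| add: "f \<in> Poly \<Longrightarrow> h \<in> Poly \<Longrightarrow> (\<lambda>p. f p + h p) \<in> Poly"
| mult: "f \<in> Poly \<Longrightarrow> h \<in> Poly \<Longrightarrow> (\<lambda>p. f p * h p) \<in> Poly"

definition differential :: "'v::real_vector cfun \<Rightarrow> 'v cx \<Rightarrow> 'v cfun" where
  "differential f p = (\<lambda>v. deriv (\<lambda>t. f (p + cscale t v)) 0)"

text \<open>For a basis \<open>B\<close> of \<open>V\<close> and \<open>b \<in> B\<close>: the linear coordinate \<open>x\<^sup>b\<close> and the vector
  \<open>\<partial>/\<partial>x\<^sup>b\<close>.\<close>

definition coord :: "'v::real_vector set \<Rightarrow> 'v \<Rightarrow> 'v cfun" where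
  "coord B b z = Complex (representation B (fst z) b) (representation B (snd z) b)"

definition coord_vec :: "'v::real_vector \<Rightarrow> 'v cx" where
  "coord_vec b = (b, 0)"


section \<open>The action and the decomposition of the representation space\<close>

definition fixed_space :: "('g \<Rightarrow> 'v \<Rightarrow> 'v) \<Rightarrow> 'g \<Rightarrow> 'v set" where
  "fixed_space \<rho> g = {v. \<rho> g v = v}"

definition cyclic_subrep ::
  "('g, 'm) monoid_scheme \<Rightarrow> ('g \<Rightarrow> 'v::real_vector \<Rightarrow> 'v) \<Rightarrow> 'g \<Rightarrow> 'v set \<Rightarrow> bool" where
  "cyclic_subrep G \<rho> g W \<longleftrightarrow> subspace W \<and> (\<forall>h\<in>generate G {g}. \<rho> h ` W \<subseteq> W)"

definition irreducible_subrep ::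
  "('g, 'm) monoid_scheme \<Rightarrow> ('g \<Rightarrow> 'v::real_vector \<Rightarrow> 'v) \<Rightarrow> 'g \<Rightarrow> 'v set \<Rightarrow> bool" where
  "irreducible_subrep G \<rho> g W \<longleftrightarrow>
     cyclic_subrep G \<rho> g W \<and> W \<noteq> {0} \<and>
     (\<forall>U. cyclic_subrep G \<rho> g U \<and> U \<subseteq> W \<longrightarrow> U = {0} \<or> U = W)"

definition normal_space ::
  "('g, 'm) monoid_scheme \<Rightarrow> ('g \<Rightarrow> 'v::real_vector \<Rightarrow> 'v) \<Rightarrow> 'g \<Rightarrow> 'v set" where
  "normal_space G \<rho> g =
     span (\<Union>{W. irreducible_subrep G \<rho> g W \<and> (\<exists>h\<in>generate G {g}. \<exists>w\<in>W. \<rho> h w \<noteq> w)})"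

definition codimension ::
  "('g, 'm) monoid_scheme \<Rightarrow> ('g \<Rightarrow> 'v::real_vector \<Rightarrow> 'v) \<Rightarrow> 'g \<Rightarrow> nat" where
  "codimension G \<rho> g = dim (normal_space G \<rho> g)"

definition proj_normal ::
  "('g, 'm) monoid_scheme \<Rightarrow> ('g \<Rightarrow> 'v::real_vector \<Rightarrow> 'v) \<Rightarrow> 'g \<Rightarrow> 'v cx \<Rightarrow> 'v cx" where
  "proj_normal G \<rho> g z =
     (THE n. n \<in> cxset (normal_space G \<rho> g) \<and> z - n \<in> cxset (fixed_space \<rho> g))"

definition proj_fixed ::
  "('g, 'm) monoid_scheme \<Rightarrow> ('g \<Rightarrow> 'v::real_vector \<Rightarrow> 'v) \<Rightarrow> 'g \<Rightarrow> 'v cx \<Rightarrow> 'v cx" where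
  "proj_fixed G \<rho> g z = z - proj_normal G \<rho> g z"

definition act ::
  "('g, 'm) monoid_scheme \<Rightarrow> ('g \<Rightarrow> 'v \<Rightarrow> 'v) \<Rightarrow> 'g \<Rightarrow> 'v cfun \<Rightarrow> 'v cfun" where
  "act G \<rho> g f = (\<lambda>p. f (cxmap (\<rho> (inv\<^bsub>G\<^esub> g)) p))"


section \<open>Multivector fields\<close>

text \<open>
  An element of \<open>\<And>\<^sup>k V\<close> (complexified) is modelled by its values on \<open>k\<close> covectors, with the
  normalisation \<open>(v\<^sub>1 \<and> \<dots> \<and> v\<^sub>k)(\<phi>\<^sub>1, \<dots>, \<phi>\<^sub>k) = 1/k! \<Sum>\<^sub>\<sigma> (-1)\<^sup>\<sigma> \<Prod>\<^sub>j \<phi>\<^sub>j(v\<^bsub>\<sigma>(j)\<^esub>)\<close>.  To make equality of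
  multivectors equality of functions, the value is \<open>0\<close> on lists of the wrong length and on lists
  not consisting of covectors.  Indices start from \<open>0\<close>.
\<close>

type_synonym 'v mvec = "'v cfun list \<Rightarrow> complex"
type_synonym 'v mfield = "'v cx \<Rightarrow> 'v mvec"

definition wedge_vecs :: "'v::real_vector cx list \<Rightarrow> 'v mvec" where
  "wedge_vecs vs \<phi>s =
     (if length \<phi>s = length vs \<and> set \<phi>s \<subseteq> covectors
      then 1 / fact (length vs) *
        (\<Sum>\<sigma> | \<sigma> permutes {..<length vs}.
           of_int (sign \<sigma>) * (\<Prod>j<length vs. (\<phi>s ! j) (vs ! \<sigma> j)))
      else 0)"

text \<open>In this normalisation the exterior product is the full antisymmetrisation of the tensor
  product.\<close>

definition wedge :: "nat \<Rightarrow> nat \<Rightarrow> 'v mvec \<Rightarrow> 'v mvec \<Rightarrow> 'v mvec" where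
  "wedge a b X Y \<phi>s =
     (if length \<phi>s = a + b
      then 1 / fact (a + b) *
        (\<Sum>\<sigma> | \<sigma> permutes {..<a + b}.
           of_int (sign \<sigma>) * X (take a (permute_list \<sigma> \<phi>s)) * Y (drop a (permute_list \<sigma> \<phi>s)))
      else 0)"

definition mf_apply :: "'v::real_vector mfield \<Rightarrow> 'v cfun list \<Rightarrow> 'v cfun" where
  "mf_apply X fs = (\<lambda>p. X p (map (\<lambda>f. differential f p) fs))"

text \<open>
  \<open>sections G \<rho> g n k\<close> is the space of sections of \<open>\<And>\<^bsup>k-n\<^esup> TV\<^sup>g \<otimes> \<And>\<^sup>n N\<^sup>g\<close> inside \<open>\<And>\<^sup>k TV\<close> with
  polynomial coefficients on \<open>V\<^sup>g\<close>, extended constantly along \<open>N\<^sup>g\<close>; it is zero if \<open>k < n\<close>.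
\<close>

inductive_set sections ::
  "('g, 'm) monoid_scheme \<Rightarrow> ('g \<Rightarrow> 'v::real_vector \<Rightarrow> 'v) \<Rightarrow> 'g \<Rightarrow> nat \<Rightarrow> nat \<Rightarrow> 'v mfield set"
  for G :: "('g, 'm) monoid_scheme" and \<rho> :: "'g \<Rightarrow> 'v::real_vector \<Rightarrow> 'v" and g :: 'g
    and n k :: nat where
  zero: "(\<lambda>_ _. 0) \<in> sections G \<rho> g n k"
| add: "\<lbrakk>X \<in> sections G \<rho> g n k;
         a \<in> Poly; \<forall>p. \<forall>w\<in>cxset (normal_space G \<rho> g). a (p + w) = a p;
         set vs \<subseteq> cxset (fixed_space \<rho> g); set ws \<subseteq> cxset (normal_space G \<rho> g);
         length ws = n; length vs + length ws = k\<rbrakk>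
        \<Longrightarrow> (\<lambda>p \<phi>s. X p \<phi>s + a p * wedge_vecs (vs @ ws) \<phi>s) \<in> sections G \<rho> g n k"

definition pushforward ::
  "('g, 'm) monoid_scheme \<Rightarrow> ('g \<Rightarrow> 'v \<Rightarrow> 'v) \<Rightarrow> 'g \<Rightarrow> 'v mfield \<Rightarrow> 'v mfield" where
  "pushforward G \<rho> h X =
     (\<lambda>p \<phi>s. X (cxmap (\<rho> (inv\<^bsub>G\<^esub> h)) p) (map (\<lambda>\<phi>. \<phi> \<circ> cxmap (\<rho> h)) \<phi>s))"

text \<open>\<open>\<Gamma>(\<Oplus>\<^sub>g \<And>\<^bsup>k-l(g)\<^esup> TV\<^sup>g \<otimes> \<And>\<^bsup>l(g)\<^esup> N\<^sup>g)\<^sup>G\<close>, as families indexed by \<open>g\<close>.\<close>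

definition invariant_sections ::
  "('g, 'm) monoid_scheme \<Rightarrow> ('g \<Rightarrow> 'v::real_vector \<Rightarrow> 'v) \<Rightarrow> nat \<Rightarrow> ('g \<Rightarrow> 'v mfield) set" where
  "invariant_sections G \<rho> k =
     {\<xi>. (\<forall>g\<in>carrier G. \<xi> g \<in> sections G \<rho> g (codimension G \<rho> g) k) \<and>
         (\<forall>g\<in>carrier G. \<forall>h\<in>carrier G.
            \<xi> (h \<otimes>\<^bsub>G\<^esub> g \<otimes>\<^bsub>G\<^esub> inv\<^bsub>G\<^esub> h) = pushforward G \<rho> h (\<xi> g))}"

text \<open>
  The projection onto \<open>\<And>\<^bsup>m-l(g)\<^esup> V\<^sup>g \<otimes> \<And>\<^bsup>l(g)\<^esup> N\<^sup>g\<close>: split every argument \<open>\<phi>\<close> as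
  \<open>\<phi> \<circ> proj_fixed + \<phi> \<circ> proj_normal\<close>, expand, and keep the terms with exactly \<open>l(g)\<close> arguments of the
  second kind.
\<close>

definition pr ::
  "('g, 'm) monoid_scheme \<Rightarrow> ('g \<Rightarrow> 'v::real_vector \<Rightarrow> 'v) \<Rightarrow> 'g \<Rightarrow> 'v mvec \<Rightarrow> 'v mvec" where
  "pr G \<rho> g \<omega> \<phi>s =
     (if set \<phi>s \<subseteq> covectors
      then \<Sum>S | S \<subseteq> {..<length \<phi>s} \<and> card S = codimension G \<rho> g.
        \<omega> (map (\<lambda>i. (\<phi>s ! i) \<circ> (if i \<in> S then proj_normal G \<rho> g else proj_fixed G \<rho> g))
               [0..<length \<phi>s])
      else 0)"

text \<open>The standard pre-Lie product of fields of degrees \<open>k\<close> and \<open>l\<close>.  The sign exponent is an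
  integer since \<open>l = 0\<close> is allowed.\<close>

definition prelie ::
  "'v::real_vector set \<Rightarrow> nat \<Rightarrow> nat \<Rightarrow> 'v mfield \<Rightarrow> 'v mfield \<Rightarrow> 'v mfield" where
  "prelie B k l \<xi> \<eta> = (\<lambda>p \<phi>s.
     \<Sum>bs | set bs \<subseteq> B \<and> length bs = k + l - 1.
       (\<Sum>s\<in>{1..k}. (-1) powi ((int s - 1) * (int l - 1)) *
          mf_apply \<xi> (take (s - 1) (map (coord B) bs) @
                       [mf_apply \<eta> (take l (drop (s - 1) (map (coord B) bs)))] @
                       drop (s - 1 + l) (map (coord B) bs)) p)
       * wedge_vecs (map coord_vec bs) \<phi>s)"


section \<open>The crossed product\<close>

text \<open>\<open>\<Sum>\<^sub>g a\<^sub>g U\<^sub>g\<close> is represented by its coefficient family \<open>g \<mapsto> a\<^sub>g\<close>.  A \<open>k\<close>-cochain is a function of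
  the list of its \<open>k\<close> arguments.\<close>

type_synonym ('g, 'v) crossed = "'g \<Rightarrow> 'v cfun"

definition cp_single :: "'v cfun \<Rightarrow> 'g \<Rightarrow> ('g, 'v) crossed" where
  "cp_single a g = (\<lambda>\<gamma> p. if \<gamma> = g then a p else 0)"

definition cp_mult ::
  "('g, 'm) monoid_scheme \<Rightarrow> ('g \<Rightarrow> 'v \<Rightarrow> 'v) \<Rightarrow> ('g, 'v) crossed \<Rightarrow> ('g, 'v) crossed \<Rightarrow> ('g, 'v) crossed"
  where
  "cp_mult G \<rho> a b = (\<lambda>\<gamma> p.
     \<Sum>g\<in>carrier G. \<Sum>h\<in>carrier G. cp_single (\<lambda>q. a g q * act G \<rho> g (b h) q) (g \<otimes>\<^bsub>G\<^esub> h) \<gamma> p)"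

definition cochain_act ::
  "('g, 'm) monoid_scheme \<Rightarrow> ('g \<Rightarrow> 'v \<Rightarrow> 'v) \<Rightarrow> 'g \<Rightarrow>
   ('v cfun list \<Rightarrow> ('g, 'v) crossed) \<Rightarrow> 'v cfun list \<Rightarrow> ('g, 'v) crossed" where
  "cochain_act G \<rho> h \<Psi> fs =
     cp_mult G \<rho> (cp_mult G \<rho> (cp_single (\<lambda>_. 1) h) (\<Psi> (map (act G \<rho> (inv\<^bsub>G\<^esub> h)) fs)))
       (cp_single (\<lambda>_. 1) (inv\<^bsub>G\<^esub> h))"

definition cochain_average ::
  "('g, 'm) monoid_scheme \<Rightarrow> ('g \<Rightarrow> 'v \<Rightarrow> 'v) \<Rightarrow>
   ('v cfun list \<Rightarrow> ('g, 'v) crossed) \<Rightarrow> 'v cfun list \<Rightarrow> ('g, 'v) crossed" where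
  "cochain_average G \<rho> \<Psi> fs =
     (\<lambda>\<gamma> p. 1 / of_nat (card (carrier G)) * (\<Sum>h\<in>carrier G. cochain_act G \<rho> h \<Psi> fs \<gamma> p))"


section \<open>The twisted cocycle\<close>

text \<open>
  \<open>y 0, \<dots>, y (l(g) - 1)\<close> are linear coordinates on \<open>N\<^sup>g\<close> (extended by zero on \<open>V\<^sup>g\<close>) that are
  eigenfunctions of \<open>g\<close>.  The cocycle does not involve the coordinates on \<open>V\<^sup>g\<close>.
\<close>

definition eigen_coordinates ::
  "('g, 'm) monoid_scheme \<Rightarrow> ('g \<Rightarrow> 'v::real_vector \<Rightarrow> 'v) \<Rightarrow> 'g \<Rightarrow> (nat \<Rightarrow> 'v cfun) \<Rightarrow> bool" where
  "eigen_coordinates G \<rho> g y \<longleftrightarrow>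
     (\<forall>i<codimension G \<rho> g. y i \<in> covectors \<and>
        (\<forall>z\<in>cxset (fixed_space \<rho> g). y i z = 0) \<and>
        (\<exists>c. \<forall>z. act G \<rho> g (y i) z = c * y i z)) \<and>
     (\<forall>c. \<exists>!z. z \<in> cxset (normal_space G \<rho> g) \<and> (\<forall>i<codimension G \<rho> g. y i z = c i))"

definition normal_vec ::
  "('g, 'm) monoid_scheme \<Rightarrow> ('g \<Rightarrow> 'v::real_vector \<Rightarrow> 'v) \<Rightarrow> 'g \<Rightarrow> (nat \<Rightarrow> 'v cfun) \<Rightarrow> nat \<Rightarrow> 'v cx"
  where
  "normal_vec G \<rho> g y i =
     (THE z. z \<in> cxset (normal_space G \<rho> g) \<and>
        (\<forall>j<codimension G \<rho> g. y j z = (if j = i then 1 else 0)))"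

definition Lambda ::
  "('g, 'm) monoid_scheme \<Rightarrow> ('g \<Rightarrow> 'v::real_vector \<Rightarrow> 'v) \<Rightarrow> 'g \<Rightarrow> (nat \<Rightarrow> 'v cfun) \<Rightarrow> 'v mvec" where
  "Lambda G \<rho> g y = wedge_vecs (map (normal_vec G \<rho> g y) [0..<codimension G \<rho> g])"

text \<open>The point \<open>(x, z\<^sub>\<sigma>\<^sup>j)\<close> attached to \<open>p = (x, y)\<close>.\<close>

definition zpoint ::
  "('g, 'm) monoid_scheme \<Rightarrow> ('g \<Rightarrow> 'v::real_vector \<Rightarrow> 'v) \<Rightarrow> 'g \<Rightarrow> (nat \<Rightarrow> 'v cfun) \<Rightarrow>
   (nat \<Rightarrow> nat) \<Rightarrow> nat \<Rightarrow> 'v cx \<Rightarrow> 'v cx" where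
  "zpoint G \<rho> g y \<sigma> j p =
     proj_fixed G \<rho> g p +
     (\<Sum>i<codimension G \<rho> g.
        cscale (if i \<in> \<sigma> ` {..<j} then act G \<rho> g (y i) p else y i p) (normal_vec G \<rho> g y i))"

text \<open>The quotient is taken in the ring of polynomials, since the denominator has zeros.\<close>

definition Omega ::
  "('g, 'm) monoid_scheme \<Rightarrow> ('g \<Rightarrow> 'v::real_vector \<Rightarrow> 'v) \<Rightarrow> 'g \<Rightarrow> (nat \<Rightarrow> 'v cfun) \<Rightarrow>
   'v cfun list \<Rightarrow> 'v cfun" where
  "Omega G \<rho> g y fs =
     (THE q. q \<in> Poly \<and>
        (\<forall>p. q p * (\<Prod>j<codimension G \<rho> g. y j p - act G \<rho> g (y j) p) =
           1 / fact (codimension G \<rho> g) *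
           (\<Sum>\<sigma> | \<sigma> permutes {..<codimension G \<rho> g}. of_int (sign \<sigma>) *
              (\<Prod>j<codimension G \<rho> g.
                 (fs ! j) (zpoint G \<rho> g y \<sigma> j p) - (fs ! j) (zpoint G \<rho> g y \<sigma> (Suc j) p)))))"


section \<open>The maps T and L\<close>

text \<open>The factor \<open>X\<^sub>g\<close> in \<open>\<xi>\<^sub>g = X\<^sub>g \<otimes> \<Lambda>\<^sub>g\<close>.\<close>

definition tangent_part ::
  "('g, 'm) monoid_scheme \<Rightarrow> ('g \<Rightarrow> 'v::real_vector \<Rightarrow> 'v) \<Rightarrow> 'g \<Rightarrow> (nat \<Rightarrow> 'v cfun) \<Rightarrow> nat \<Rightarrow>
   'v mfield \<Rightarrow> 'v mfield" where
  "tangent_part G \<rho> g y k \<xi>g =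
     (THE X. X \<in> sections G \<rho> g 0 (k - codimension G \<rho> g) \<and>
        (\<forall>p. \<xi>g p = wedge (k - codimension G \<rho> g) (codimension G \<rho> g) (X p) (Lambda G \<rho> g y)))"

definition T1_component ::
  "('g, 'm) monoid_scheme \<Rightarrow> ('g \<Rightarrow> 'v::real_vector \<Rightarrow> 'v) \<Rightarrow> 'g \<Rightarrow> (nat \<Rightarrow> 'v cfun) \<Rightarrow> nat \<Rightarrow>
   'v mfield \<Rightarrow> 'v cfun list \<Rightarrow> 'v cfun" where
  "T1_component G \<rho> g y k \<xi>g fs =
     (\<lambda>p. mf_apply (tangent_part G \<rho> g y k \<xi>g) (take (k - codimension G \<rho> g) fs) p *
          Omega G \<rho> g y (drop (k - codimension G \<rho> g) fs) p)"

definition T1 ::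
  "('g, 'm) monoid_scheme \<Rightarrow> ('g \<Rightarrow> 'v::real_vector \<Rightarrow> 'v) \<Rightarrow> ('g \<Rightarrow> nat \<Rightarrow> 'v cfun) \<Rightarrow> nat \<Rightarrow>
   ('g \<Rightarrow> 'v mfield) \<Rightarrow> 'v cfun list \<Rightarrow> ('g, 'v) crossed" where
  "T1 G \<rho> y k \<xi> =
     cochain_average G \<rho>
       (\<lambda>fs \<gamma> p. \<Sum>g\<in>carrier G. cp_single (T1_component G \<rho> g (y g) k (\<xi> g) fs) g \<gamma> p)"

definition L2 ::
  "'v::real_vector set \<Rightarrow> nat \<Rightarrow> ('v cfun list \<Rightarrow> 'v cfun) \<Rightarrow> 'v mfield" where
  "L2 B k \<Psi> = (\<lambda>p \<phi>s.
     \<Sum>bs | set bs \<subseteq> B \<and> length bs = k.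
       1 / fact k *
       (\<Sum>\<sigma> | \<sigma> permutes {..<k}. of_int (sign \<sigma>) *
          \<Psi> (map (\<lambda>b q. coord B b q - coord B b p) (permute_list \<sigma> bs)) p)
       * wedge_vecs (map coord_vec bs) \<phi>s)"

definition L3 ::
  "('g, 'm) monoid_scheme \<Rightarrow> ('g \<Rightarrow> 'v::real_vector \<Rightarrow> 'v) \<Rightarrow> 'g \<Rightarrow> 'v mfield \<Rightarrow> 'v mfield" where
  "L3 G \<rho> g X = (\<lambda>p\<in>cxset (fixed_space \<rho> g). pr G \<rho> g (X p))"

text \<open>The summand \<open>P\<^bsub>\<alpha>,\<beta>\<^esub>\<close> of \<open>L\<^sub>1(T(\<xi>) \<circ> T(\<eta>)) = \<Sum> P\<^bsub>\<alpha>,\<beta>\<^esub> U\<^bsub>\<alpha>\<beta>\<^esub>\<close> for \<open>\<xi>\<close> of degree \<open>k\<close> and \<open>\<eta>\<close> of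
  degree \<open>l\<close>.\<close>

definition P_cochain ::
  "('g, 'm) monoid_scheme \<Rightarrow> ('g \<Rightarrow> 'v::real_vector \<Rightarrow> 'v) \<Rightarrow> ('g \<Rightarrow> nat \<Rightarrow> 'v cfun) \<Rightarrow> nat \<Rightarrow> nat \<Rightarrow>
   ('g \<Rightarrow> 'v mfield) \<Rightarrow> ('g \<Rightarrow> 'v mfield) \<Rightarrow> 'g \<Rightarrow> 'g \<Rightarrow> 'v cfun list \<Rightarrow> 'v cfun" where
  "P_cochain G \<rho> y k l \<xi> \<eta> \<alpha> \<beta> fs = (\<lambda>p.
     \<Sum>s\<in>{1..k}. (-1) powi ((int s - 1) * (int l - 1)) *
       T1 G \<rho> y k \<xi>
         (take (s - 1) fs @ [T1 G \<rho> y l \<eta> (take l (drop (s - 1) fs)) \<beta>] @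
          map (act G \<rho> \<beta>) (drop (s - 1 + l) fs)) \<alpha> p)"

definition contribution ::
  "('g, 'm) monoid_scheme \<Rightarrow> ('g \<Rightarrow> 'v::real_vector \<Rightarrow> 'v) \<Rightarrow> 'v set \<Rightarrow> ('g \<Rightarrow> nat \<Rightarrow> 'v cfun) \<Rightarrow>
   nat \<Rightarrow> nat \<Rightarrow> ('g \<Rightarrow> 'v mfield) \<Rightarrow> ('g \<Rightarrow> 'v mfield) \<Rightarrow> 'g \<Rightarrow> 'g \<Rightarrow> 'v mfield" where
  "contribution G \<rho> B y k l \<xi> \<eta> \<alpha> \<beta> =
     L3 G \<rho> (\<alpha> \<otimes>\<^bsub>G\<^esub> \<beta>) (L2 B (k + l - 1) (P_cochain G \<rho> y k l \<xi> \<eta> \<alpha> \<beta>))"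

end

theory Submission
  imports Defs "Jordan_Normal_Form.Determinant"
begin

text \<open>
  Let \<open>p\<close> be a point of \<open>V\<^sup>\<alpha>\<^sup>\<beta> = V\<^sup>\<alpha> \<inter> V\<^sup>\<beta>\<close>.  Both sides are projections of multivectors at \<open>p\<close>, and these
  multivectors are already equal before the projection, at every point of \<open>V\<^sup>\<alpha>\<close>.  Three observations
  carry the proof.

  First, the cochain \<open>X\<^sub>g \<otimes> \<Omega>\<^sub>g\<close> behaves at the relevant places like the tensor \<open>X\<^sub>g \<otimes> \<Lambda>\<^sub>g\<close> applied to
  differentials.  At a point of \<open>V\<^sup>g\<close> the difference quotients in \<open>\<Omega>\<^sub>g\<close> become derivatives
  (\<open>Omega_on_fixed_space\<close>), and on affine functions they are constant (\<open>Omega_affine\<close>).  The outer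
  cochain is evaluated at \<open>p\<close> and the inner one on affine functions, so \<open>P\<^sub>\<alpha>\<^sub>,\<^sub>\<beta>\<close> becomes an expression in
  tensors.  Averaging over the group replaces the tensor by a mean of transported tensors; since the
  family of sections is invariant, all of them antisymmetrise to the given multivector
  (\<open>Alt_averaged_tensor\<close>).

  Second, in \<open>P\<^sub>\<alpha>\<^sub>,\<^sub>\<beta>\<close> the arguments that follow the inserted value of \<open>\<eta>\<close> are twisted by \<open>\<beta>\<close>, so that the
  corresponding vectors of \<open>\<xi>\<close> are moved by \<open>\<beta>\<^sup>-\<^sup>1\<close>.  Now \<open>\<beta>\<^sup>-\<^sup>1 v - v\<close> lies in \<open>N\<^sup>\<beta>\<close>, and the tensor of \<open>\<eta>\<close>
  contains a basis of \<open>N\<^sup>\<beta>\<close> among its factors.  Antisymmetrisation, which is part of \<open>L\<^sub>2\<close>, therefore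
  removes the twist (\<open>Alt_untwist\<close>).

  Third, after antisymmetrisation a pre-Lie sum depends on the outer and on the inner tensor only
  through their own antisymmetrisations (\<open>Alt_insertion_sum_Alt\<close>, \<open>Alt_insert_differential_Alt\<close>); the
  signs of the pre-Lie product are exactly those that make this true.  So the tensors may be replaced
  by \<open>\<xi>\<^sub>\<alpha>\<close> and \<open>\<eta>\<^sub>\<beta>\<close>, and the result is the standard pre-Lie product.

  To make sense of the maps involved, \<open>V = V\<^sup>g \<oplus> N\<^sup>g\<close> is obtained from complete reducibility, and the
  factor \<open>X\<^sub>g\<close> of a section is shown to exist and to be unique (\<open>tangent_part\<close>).
\<close>

section \<open>Alternating sums over permutations\<close>

text \<open>
  Cochains and multivectors are functions of lists, so antisymmetrisation is expressed on lists;
  the factor \<open>1/n!\<close> is left out.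
\<close>

definition Alt :: "('a list \<Rightarrow> complex) \<Rightarrow> 'a list \<Rightarrow> complex" where
  "Alt F xs = (\<Sum>\<sigma> | \<sigma> permutes {..<length xs}. of_int (sign \<sigma>) * F (permute_list \<sigma> xs))"

lemma Alt_cong:
  assumes "\<And>ys. length ys = length xs \<Longrightarrow> set ys = set xs \<Longrightarrow> F ys = F' ys"
  shows "Alt F xs = Alt F' xs"
  unfolding Alt_def using assms by (intro sum.cong) auto

lemma Alt_add: "Alt (\<lambda>xs. F xs + F' xs) xs = Alt F xs + Alt F' xs"
  by (simp add: Alt_def algebra_simps sum.distrib)

lemma Alt_mult: "Alt (\<lambda>xs. c * F xs) xs = c * Alt F xs"
  by (simp add: Alt_def sum_distrib_left mult_ac)

lemma Alt_zero: "Alt (\<lambda>xs. 0) xs = 0"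
  by (simp add: Alt_def)

lemma Alt_sum: "Alt (\<lambda>xs. \<Sum>i\<in>I. F i xs) xs = (\<Sum>i\<in>I. Alt (F i) xs)"
  unfolding Alt_def sum_distrib_left by (rule sum.swap)

lemma Alt_sum_list: "Alt (\<lambda>xs. \<Sum>i\<leftarrow>is. F i xs) xs = (\<Sum>i\<leftarrow>is. Alt (F i) xs)"
  by (induction "is") (simp_all add: Alt_zero Alt_add)

lemma sign_cancel: "of_int (sign \<sigma>) * (of_int (sign \<sigma>) * c) = (c :: complex)"
  by (cases \<sigma> rule: sign_cases) simp_all

text \<open>
  Right translation by \<open>\<tau>\<close> is a bijection of the symmetric group that multiplies signs by
  \<open>sign \<tau>\<close>.
\<close>

lemma Alt_permute:
  assumes "\<tau> permutes {..<length xs}"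
  shows "Alt (\<lambda>ys. F (permute_list \<tau> ys)) xs = of_int (sign \<tau>) * Alt F xs"
proof -
  have p: "permutation \<sigma>" if "\<sigma> permutes {..<length xs}" for \<sigma> :: "nat \<Rightarrow> nat"
    using that permutation_permutes by blast
  have "Alt F xs = (\<Sum>\<sigma> | \<sigma> permutes {..<length xs}. of_int (sign (\<sigma> \<circ> \<tau>)) * F (permute_list (\<sigma> \<circ> \<tau>) xs))"
    unfolding Alt_def by (rule sum_permutations_compose_right[OF assms])
  also have "\<dots> = of_int (sign \<tau>) * Alt (\<lambda>ys. F (permute_list \<tau> ys)) xs"
    unfolding Alt_def sum_distrib_left
    by (rule sum.cong) (auto simp: sign_compose p assms permute_list_compose)
  finally show ?thesis
    by (simp add: sign_cancel)
qed

text \<open>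
  Translation by the transposition both fixes and negates the sum.
\<close>

lemma Alt_eq_0_if_symmetric:
  assumes "a < length xs" "b < length xs" "a \<noteq> b"
    and "\<And>ys. length ys = length xs \<Longrightarrow> F (permute_list (Transposition.transpose a b) ys) = F ys"
  shows "Alt F xs = 0"
proof -
  have "Alt F xs = Alt (\<lambda>ys. F (permute_list (Transposition.transpose a b) ys)) xs"
    by (rule Alt_cong) (simp add: assms)
  also have "\<dots> = - Alt F xs"
    using assms(1-3) by (subst Alt_permute) (auto intro: permutes_swap_id simp: sign_swap_id)
  finally show ?thesis by simp
qed

text \<open>
  Adjacent transpositions generate the symmetric group: \<open>(a b) = (b-1 b) (a b-1) (b-1 b)\<close>, by
  induction on \<open>b - a\<close>. On lists an adjacent transposition only exchanges two neighbours, which is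
  easy to follow through \<open>take\<close> and \<open>drop\<close>; this is what makes the induction useful below.
\<close>

lemma permutes_adjacent_induct [consumes 1, case_names id adjacent]:
  fixes n :: nat
  assumes "\<sigma> permutes {..<n}" and "P id"
    and step: "\<And>i \<tau>. Suc i < n \<Longrightarrow> \<tau> permutes {..<n} \<Longrightarrow> P \<tau> \<Longrightarrow> P (Transposition.transpose i (Suc i) \<circ> \<tau>)"
  shows "P \<sigma>"
proof -
  have t: "P (Transposition.transpose a b \<circ> \<tau>)" if "a < b" "b < n" "\<tau> permutes {..<n}" "P \<tau>" for a b \<tau>
    using that
  proof (induction "b - a" arbitrary: b \<tau>)
    case 0
    then show ?case by simp
  next
    case (Suc d)
    show ?case
    proof (cases "b = Suc a")
      case True
      then show ?thesis using step Suc.prems by simp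
    next
      case False
      define c where "c = b - 1"
      have b: "b = Suc c" and c: "a < c" "c < n" "Suc c < n" "d = c - a"
        using False Suc by (auto simp: c_def)
      have perm: "Transposition.transpose i j permutes {..<n}" if "i < n" "j < n" for i j
        using that by (auto intro: permutes_swap_id)
      have "P (Transposition.transpose c b \<circ> \<tau>)" "Transposition.transpose c b \<circ> \<tau> permutes {..<n}"
        using step[of c \<tau>] Suc.prems c b perm by (auto intro: permutes_compose)
      with Suc.hyps(1)[of c "Transposition.transpose c b \<circ> \<tau>"] c perm[of a c]
      have "P (Transposition.transpose a c \<circ> (Transposition.transpose c b \<circ> \<tau>))" "Transposition.transpose a c \<circ> (Transposition.transpose c b \<circ> \<tau>) permutes {..<n}"
        by (auto intro: permutes_compose)
      from step[OF c(3) this(2,1)]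
      have "P (Transposition.transpose c b \<circ> (Transposition.transpose a c \<circ> (Transposition.transpose c b \<circ> \<tau>)))" by (simp add: b)
      also have "Transposition.transpose c b \<circ> (Transposition.transpose a c \<circ> (Transposition.transpose c b \<circ> \<tau>)) = Transposition.transpose a b \<circ> \<tau>"
        using Suc.prems(1) c b by (auto simp: fun_eq_iff Transposition.transpose_def)
      finally show ?thesis .
    qed
  qed
  show ?thesis
    using assms(1) finite_lessThan
  proof (induction rule: permutes_induct)
    case id
    show ?case by fact
  next
    case (swap a b p)
    then show ?case
      using t[of a b p] t[of b a p] Transposition.transpose_commute[of a b]
      by (cases a b rule: linorder_cases) (simp_all del: o_apply)
  qed
qed

lemma permute_list_adjacent:
  assumes "length us = i"
  shows "permute_list (Transposition.transpose i (Suc i)) (us @ [a, b] @ vs) = us @ [b, a] @ vs"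
proof (rule nth_equalityI)
  fix j assume "j < length (permute_list (Transposition.transpose i (Suc i)) (us @ [a, b] @ vs))"
  then have j: "j < length us + 2 + length vs" by simp
  then have n: "permute_list (Transposition.transpose i (Suc i)) (us @ [a, b] @ vs) ! j =
      (us @ [a, b] @ vs) ! Transposition.transpose i (Suc i) j"
    by (simp add: permute_list_def del: upt_Suc)
  consider "j < i" | "j = i" | "j = Suc i" | "Suc i < j" by linarith
  then show "permute_list (Transposition.transpose i (Suc i)) (us @ [a, b] @ vs) ! j = (us @ [b, a] @ vs) ! j"
    unfolding n
  proof cases
    case 4
    then have "Transposition.transpose i (Suc i) j = j" by (simp add: Transposition.transpose_def)
    then show "(us @ [a, b] @ vs) ! Transposition.transpose i (Suc i) j = (us @ [b, a] @ vs) ! j"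
      using 4 assms by (simp add: nth_append nth_Cons')
  qed (use assms in \<open>simp_all add: nth_append Transposition.transpose_def\<close>)
qed simp

lemma Alt_adjacent:
  assumes "Suc i < length xs"
  shows "Alt (\<lambda>ys. F (permute_list (Transposition.transpose i (Suc i)) ys)) xs = - Alt F xs"
  using assms by (subst Alt_permute) (auto intro: permutes_swap_id simp: sign_swap_id)

lemma split_list_at:
  assumes "i + l + j = length xs"
  obtains us ws vs where "xs = us @ ws @ vs" "length us = i" "length ws = l" "length vs = j"
proof
  show "xs = take i xs @ take l (drop i xs) @ drop (i + l) xs"
    by (metis append_take_drop_id drop_drop add.commute)
qed (use assms in auto)

text \<open>
  A permutation of a contiguous block is a permutation of the whole list with the same sign. Both
  facts come from the adjacent case, where the block transposition is again an adjacent
  transposition of the list.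
\<close>

lemma Alt_block_permute:
  assumes "\<tau> permutes {..<l}" "i + l \<le> length xs"
  shows "Alt (\<lambda>ys. F (take i ys @ permute_list \<tau> (take l (drop i ys)) @ drop (i + l) ys)) xs
           = of_int (sign \<tau>) * Alt F xs"
  using assms(1)
proof (induction rule: permutes_adjacent_induct)
  case id
  have "take i ys @ take l (drop i ys) @ drop (i + l) ys = ys" for ys :: "'a list"
    by (metis append_take_drop_id drop_drop add.commute)
  then show ?case by simp
next
  case (adjacent j \<tau>)
  let ?t = "Transposition.transpose j (Suc j)" and ?u = "Transposition.transpose (i + j) (Suc (i + j))"
  let ?G = "\<lambda>ys. F (take i ys @ permute_list \<tau> (take l (drop i ys)) @ drop (i + l) ys)"
  have "take i ys @ permute_list (?t \<circ> \<tau>) (take l (drop i ys)) @ drop (i + l) ys =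
        take i (permute_list ?u ys) @ permute_list \<tau> (take l (drop i (permute_list ?u ys))) @ drop (i + l) (permute_list ?u ys)"
    if len: "length ys = length xs" for ys
  proof -
    have "i + j + 2 + (length xs - (i + j + 2)) = length ys"
      using adjacent assms(2) len by simp
    then obtain us ab vs where ys: "ys = us @ ab @ vs" "length us = i + j" "length ab = 2"
      by (blast elim: split_list_at)
    from ys(3) obtain a b where ab: "ab = [a, b]"
      by (auto simp: numeral_2_eq_2 length_Suc_conv)
    obtain vs1 vs2 where vs: "vs = vs1 @ vs2" "length vs1 = l - (j + 2)"
    proof
      show "vs = take (l - (j + 2)) vs @ drop (l - (j + 2)) vs" by simp
      show "length (take (l - (j + 2)) vs) = l - (j + 2)"
        using ys ab len assms(2) by simp
    qed
    obtain us1 us2 where us: "us = us1 @ us2" "length us1 = i" "length us2 = j"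
    proof
      show "us = take i us @ drop i us" by simp
    qed (use ys in auto)
    have l: "l = j + 2 + length vs1" using adjacent(1) vs by simp
    have "permute_list (?t \<circ> \<tau>) (us2 @ [a, b] @ vs1) = permute_list \<tau> (us2 @ [b, a] @ vs1)"
      using permute_list_compose[of \<tau> "us2 @ [a, b] @ vs1" ?t] adjacent(2) l us
      by (simp add: permute_list_adjacent[of us2 j a b vs1, simplified])
    moreover have "permute_list ?u ys = us1 @ (us2 @ [b, a] @ vs1) @ vs2"
      using permute_list_adjacent[of us "i + j" a b vs] ys ab us vs by simp
    moreover have "ys = us1 @ (us2 @ [a, b] @ vs1) @ vs2" using ys ab us vs by simp
    moreover have "length (us2 @ [a, b] @ vs1) = l" "length (us2 @ [b, a] @ vs1) = l"
      using us vs l by auto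
    ultimately show ?thesis using us(2) by (simp del: append_assoc)
  qed
  then have "Alt (\<lambda>ys. F (take i ys @ permute_list (?t \<circ> \<tau>) (take l (drop i ys)) @ drop (i + l) ys)) xs =
    Alt (\<lambda>ys. ?G (permute_list ?u ys)) xs"
    by (intro Alt_cong arg_cong[of _ _ F]) blast
  also have "\<dots> = - Alt ?G xs"
    using adjacent assms(2) by (intro Alt_adjacent) simp
  also have "\<dots> = of_int (sign (?t \<circ> \<tau>)) * Alt F xs"
  proof -
    have "sign (?t \<circ> \<tau>) = - sign \<tau>"
      using adjacent(2)
      by (subst sign_compose) (auto simp: sign_swap_id permutation_swap_id intro: permutation_permutes[THEN iffD2])
    then show ?thesis using adjacent.IH by simp
  qed
  finally show ?case .
qed

text \<open>
  Antisymmetrising a block first changes nothing but the normalisation: each of the \<open>l!\<close>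
  permutations of the block is absorbed by the outer sum.
\<close>

lemma Alt_block:
  assumes "i + l \<le> length xs"
  shows "Alt (\<lambda>ys. Alt (\<lambda>ws. F (take i ys @ ws @ drop (i + l) ys)) (take l (drop i ys))) xs = fact l * Alt F xs"
proof -
  have "Alt (\<lambda>ys. Alt (\<lambda>ws. F (take i ys @ ws @ drop (i + l) ys)) (take l (drop i ys))) xs =
    Alt (\<lambda>ys. \<Sum>\<tau> | \<tau> permutes {..<l}. of_int (sign \<tau>) *
       F (take i ys @ permute_list \<tau> (take l (drop i ys)) @ drop (i + l) ys)) xs"
    using assms by (intro Alt_cong) (simp add: Alt_def)
  also have "\<dots> = (\<Sum>\<tau> | \<tau> permutes {..<l}. of_int (sign \<tau>) * (of_int (sign \<tau>) * Alt F xs))"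
    unfolding Alt_sum Alt_mult
    by (rule sum.cong[OF refl]) (simp only: mem_Collect_eq Alt_block_permute[OF _ assms, of _ F])
  also have "\<dots> = (\<Sum>\<tau> | \<tau> permutes {..<l}. Alt F xs)"
    by (simp only: sign_cancel)
  also have "\<dots> = of_nat (card {\<tau>. \<tau> permutes {..<l}}) * Alt F xs"
    by (rule sum_constant)
  also have "\<dots> = fact l * Alt F xs"
    using card_permutations[of "{..<l}" l] by simp
  finally show ?thesis .
qed

text \<open>
  The element travels past \<open>l\<close> others by \<open>l\<close> adjacent transpositions.
\<close>

lemma Alt_move_right:
  assumes "i + l < length xs"
  shows "Alt (\<lambda>ys. F (take i ys @ take l (drop (Suc i) ys) @ [ys ! i] @ drop (Suc (i + l)) ys)) xs
           = (- 1) ^ l * Alt F xs"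
  using assms
proof (induction l arbitrary: F)
  case 0
  have "Alt (\<lambda>ys. F (take i ys @ take 0 (drop (Suc i) ys) @ [ys ! i] @ drop (Suc (i + 0)) ys)) xs = Alt F xs"
    using 0 by (intro Alt_cong arg_cong[of _ _ F]) (simp add: id_take_nth_drop[symmetric])
  then show ?case by simp
next
  case (Suc l)
  let ?t = "Transposition.transpose (i + l) (Suc (i + l))"
  have "take i ys @ take (Suc l) (drop (Suc i) ys) @ [ys ! i] @ drop (Suc (i + Suc l)) ys =
     permute_list ?t (take i ys @ take l (drop (Suc i) ys) @ [ys ! i] @ drop (Suc (i + l)) ys)"
    if len: "length ys = length xs" for ys
  proof -
    have "i + (Suc l + 1) + (length xs - (i + l + 2)) = length ys"
      using Suc.prems len by simp
    then obtain us ws vs where ys: "ys = us @ ws @ vs" "length us = i" "length ws = Suc l + 1"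
      by (rule split_list_at)
    from ys(3) obtain a ws' b where ws: "ws = a # ws' @ [b]" "length ws' = l"
      by (metis Suc_eq_plus1 length_Suc_conv length_append_singleton rev_exhaust Suc_inject length_0_conv nat.simps(3))
    show ?thesis
      using permute_list_adjacent[of "us @ ws'" "i + l" a b vs] ys ws by (simp add: nth_append)
  qed
  then have "Alt (\<lambda>ys. F (take i ys @ take (Suc l) (drop (Suc i) ys) @ [ys ! i] @ drop (Suc (i + Suc l)) ys)) xs =
    Alt (\<lambda>ys. F (permute_list ?t (take i ys @ take l (drop (Suc i) ys) @ [ys ! i] @ drop (Suc (i + l)) ys))) xs"
    by (intro Alt_cong arg_cong[of _ _ F]) blast
  also have "\<dots> = (- 1) ^ l * Alt (\<lambda>ys. F (permute_list ?t ys)) xs"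
    using Suc by simp
  also have "\<dots> = (- 1) ^ Suc l * Alt F xs"
    using Suc.prems by (subst Alt_adjacent) auto
  finally show ?case .
qed

text \<open>
  The inverse of the rearrangement in \<open>Alt_move_right\<close>.
\<close>

lemma Alt_move_left:
  assumes "i + l < length xs"
  shows "Alt (\<lambda>ys. F (take i ys @ [ys ! (i + l)] @ take l (drop i ys) @ drop (Suc (i + l)) ys)) xs
           = (- 1) ^ l * Alt F xs"
proof -
  let ?R = "\<lambda>ys. take i ys @ take l (drop (Suc i) ys) @ [ys ! i] @ drop (Suc (i + l)) ys"
  let ?L = "\<lambda>ys. take i ys @ [ys ! (i + l)] @ take l (drop i ys) @ drop (Suc (i + l)) ys"
  have "ys = ?L (?R ys)" if len: "length ys = length xs" for ys
  proof -
    have "i + (1 + l) + (length xs - (i + l + 1)) = length ys"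
      using assms len by simp
    then obtain us ws vs where ys: "ys = us @ ws @ vs" "length us = i" "length ws = 1 + l"
      by (rule split_list_at)
    then obtain a ws' where "ws = a # ws'" "length ws' = l"
      by (metis Suc_eq_plus1_left length_Suc_conv)
    then show ?thesis using ys by (simp add: nth_append)
  qed
  then have "Alt F xs = Alt (\<lambda>ys. F (?L (?R ys))) xs"
    by (intro Alt_cong arg_cong[of _ _ F]) blast
  also have "\<dots> = (- 1) ^ l * Alt (\<lambda>ys. F (?L ys)) xs"
    using Alt_move_right[OF assms, of "\<lambda>ys. F (?L ys)"] .
  finally show ?thesis
    by (simp flip: mult.assoc power_add power_mult_distrib)
qed

section \<open>Inserting a block into an alternating sum\<close>

text \<open>
  The argument list of \<open>\<phi>\<close> in the \<open>s\<close>-th summand of a pre-Lie product \<open>\<phi> \<circ> \<psi>\<close>, where \<open>D\<close> is the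
  value of \<open>\<psi>\<close>.
\<close>

definition insert_block :: "nat \<Rightarrow> ('a list \<Rightarrow> 'a) \<Rightarrow> nat \<Rightarrow> 'a list \<Rightarrow> 'a list" where
  "insert_block l D s xs = take s xs @ [D (take l (drop s xs))] @ drop (s + l) xs"

text \<open>
  The pre-Lie sum, with the sum index starting from 0. The exponent \<open>s * (l + 1)\<close> has the parity
  of \<open>s * (l - 1)\<close> and avoids truncated subtraction when \<open>l = 0\<close>.
\<close>

definition insertion_sum :: "nat \<Rightarrow> nat \<Rightarrow> ('a list \<Rightarrow> 'a) \<Rightarrow> ('a list \<Rightarrow> complex) \<Rightarrow> 'a list \<Rightarrow> complex" where
  "insertion_sum k l D T xs = (\<Sum>s<k. (- 1) ^ (s * (l + 1)) * T (insert_block l D s xs))"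

text \<open>
  Exchanging the neighbours \<open>i\<close> and \<open>i + 1\<close> in the argument list of \<open>T\<close>. If neither is the
  inserted value, two entries of the original list are exchanged, which gives the sign \<open>-1\<close>. If
  one of them is, the inserted value moves one place and a single entry jumps over the block of
  length \<open>l\<close>, which gives \<open>(-1)^l\<close>; together with the sign \<open>(-1)^(l+1)\<close> between consecutive
  summands this is again \<open>-1\<close>. Hence a transposition \<open>t\<close> carries the \<open>s\<close>-th summand to minus the
  \<open>t s\<close>-th one.
\<close>

lemma Alt_insert_block_adjacent:
  fixes T :: "'a list \<Rightarrow> complex"
  assumes len: "length xs + 1 = k + l" and i: "Suc i < k" and s: "s < k"
  defines "t \<equiv> Transposition.transpose i (Suc i)"
  shows "(- 1) ^ (s * (l + 1)) * Alt (\<lambda>xs. T (permute_list t (insert_block l D s xs))) xs =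
    - ((- 1) ^ (t s * (l + 1)) * Alt (\<lambda>xs. T (insert_block l D (t s) xs)) xs)"
proof -
  have sq: "(- 1) ^ l * ((- 1) ^ l * c) = c" for c :: complex
    by (simp flip: mult.assoc power_mult_distrib)
  consider "s < i" | "s = i" | "s = Suc i" | "Suc i < s" by linarith
  then show ?thesis
  proof cases
    case 1
    \<comment> \<open>behind the inserted value, position \<open>i\<close> corresponds to entry \<open>i + l - 1\<close> of the original list\<close>
    define j where "j = i + l - 1"
    have j: "Suc j = i + l" "s + l \<le> j" using 1 by (auto simp: j_def)
    have ts: "t s = s" using 1 by (simp add: t_def Transposition.transpose_def)
    have "permute_list t (insert_block l D s ys) =
        insert_block l D s (permute_list (Transposition.transpose j (Suc j)) ys)"
      if "length ys = length xs" for ys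
    proof -
      have "s + l + (length xs - (s + l)) = length ys"
        using i s that len by simp
      then obtain us ws zs where ys: "ys = us @ ws @ zs" "length us = s" "length ws = l"
          "length zs = length xs - (s + l)"
        by (rule split_list_at)
      have "(j - (s + l)) + 2 + (length zs - (j - (s + l) + 2)) = length zs"
        using i s len j ys(4) by simp
      then obtain as ab vs where zs: "zs = as @ ab @ vs" "length as = j - (s + l)" "length ab = 2"
        by (rule split_list_at)
      from zs(3) obtain a b where ab: "ab = [a, b]"
        by (auto simp: numeral_2_eq_2 length_Suc_conv)
      have "length (us @ [D ws] @ as) = i" using ys zs j by simp
      from permute_list_adjacent[OF this, of a b vs]
      have "permute_list t (insert_block l D s ys) = us @ [D ws] @ as @ [b, a] @ vs"
        using ys zs ab by (simp add: insert_block_def t_def)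
      moreover have "length (us @ ws @ as) = j" using ys zs j by simp
      from permute_list_adjacent[OF this, of a b vs]
      have "permute_list (Transposition.transpose j (Suc j)) ys = us @ ws @ as @ [b, a] @ vs"
        using ys zs ab by simp
      ultimately show ?thesis using ys by (simp add: insert_block_def)
    qed
    then have "Alt (\<lambda>ys. T (permute_list t (insert_block l D s ys))) xs =
        Alt (\<lambda>ys. T (insert_block l D s (permute_list (Transposition.transpose j (Suc j)) ys))) xs"
      by (intro Alt_cong arg_cong[of _ _ T]) blast
    also have "\<dots> = - Alt (\<lambda>ys. T (insert_block l D s ys)) xs"
      by (rule Alt_adjacent) (use i s len j in simp)
    finally show ?thesis by (simp add: ts)
  next
    case 4
    have ts: "t s = s" using 4 by (simp add: t_def Transposition.transpose_def)
    have "permute_list t (insert_block l D s ys) = insert_block l D s (permute_list t ys)"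
      if "length ys = length xs" for ys
    proof -
      have "i + 2 + (length xs - (i + 2)) = length ys"
        using 4 s that len by simp
      then obtain us ab vs where ys: "ys = us @ ab @ vs" "length us = i" "length ab = 2"
          "length vs = length xs - (i + 2)"
        by (rule split_list_at)
      from ys(3) obtain a b where ab: "ab = [a, b]"
        by (auto simp: numeral_2_eq_2 length_Suc_conv)
      obtain r where r: "s = Suc (Suc (i + r))" using 4 less_iff_Suc_add by auto
      show ?thesis
        using permute_list_adjacent[OF ys(2), of a b vs]
          permute_list_adjacent[OF ys(2), of a b "take r vs @ [D (take l (drop r vs))] @ drop (r + l) vs"]
          ys ab r by (simp add: insert_block_def t_def add.assoc)
    qed
    then have "Alt (\<lambda>ys. T (permute_list t (insert_block l D s ys))) xs =
        Alt (\<lambda>ys. T (insert_block l D s (permute_list t ys))) xs"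
      by (intro Alt_cong arg_cong[of _ _ T]) blast
    also have "\<dots> = - Alt (\<lambda>ys. T (insert_block l D s ys)) xs"
      unfolding t_def by (rule Alt_adjacent) (use 4 s len in simp)
    finally show ?thesis by (simp add: ts)
  next
    case 2
    \<comment> \<open>the inserted value moves right and one entry jumps left over the block\<close>
    have ts: "t s = Suc i" using 2 by (simp add: t_def)
    have "permute_list t (insert_block l D s ys) =
        insert_block l D (Suc i) (take i ys @ [ys ! (i + l)] @ take l (drop i ys) @ drop (Suc (i + l)) ys)"
      if "length ys = length xs" for ys
    proof -
      have "i + (l + 1) + (length xs - (i + l + 1)) = length ys"
        using i that len by simp
      then obtain us ws vs where ys: "ys = us @ ws @ vs" "length us = i" "length ws = l + 1"
        by (rule split_list_at)
      then obtain ws' a where ws: "ws = ws' @ [a]" "length ws' = l"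
        by (metis Suc_eq_plus1 append_butlast_last_id length_butlast list.size(3) nat.simps(3) diff_Suc_1)
      show ?thesis
        using permute_list_adjacent[OF ys(2), of "D ws'" a vs] ys ws 2
        by (simp add: insert_block_def t_def nth_append)
    qed
    then have "Alt (\<lambda>ys. T (permute_list t (insert_block l D s ys))) xs =
        Alt (\<lambda>ys. T (insert_block l D (Suc i) (take i ys @ [ys ! (i + l)] @ take l (drop i ys) @ drop (Suc (i + l)) ys))) xs"
      by (intro Alt_cong arg_cong[of _ _ T]) blast
    also have "\<dots> = (- 1) ^ l * Alt (\<lambda>ys. T (insert_block l D (Suc i) ys)) xs"
      by (rule Alt_move_left) (use i len in simp)
    finally show ?thesis
      using sq by (simp add: ts[unfolded 2] 2 power_add)
  next
    case 3
    \<comment> \<open>the inserted value moves left and one entry jumps right over the block\<close>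
    have ts: "t s = i" using 3 by (simp add: t_def)
    have "permute_list t (insert_block l D s ys) =
        insert_block l D i (take i ys @ take l (drop (Suc i) ys) @ [ys ! i] @ drop (Suc (i + l)) ys)"
      if "length ys = length xs" for ys
    proof -
      have "i + (1 + l) + (length xs - (i + l + 1)) = length ys"
        using i that len by simp
      then obtain us ws vs where ys: "ys = us @ ws @ vs" "length us = i" "length ws = 1 + l"
        by (rule split_list_at)
      then obtain a ws' where ws: "ws = a # ws'" "length ws' = l"
        by (metis Suc_eq_plus1_left length_Suc_conv)
      show ?thesis
        using permute_list_adjacent[OF ys(2), of a "D ws'" vs] ys ws 3
        by (simp add: insert_block_def t_def nth_append)
    qed
    then have "Alt (\<lambda>ys. T (permute_list t (insert_block l D s ys))) xs =
        Alt (\<lambda>ys. T (insert_block l D i (take i ys @ take l (drop (Suc i) ys) @ [ys ! i] @ drop (Suc (i + l)) ys))) xs"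
      by (intro Alt_cong arg_cong[of _ _ T]) blast
    also have "\<dots> = (- 1) ^ l * Alt (\<lambda>ys. T (insert_block l D i ys)) xs"
      by (rule Alt_move_right) (use i len in simp)
    finally show ?thesis
      using sq by (simp add: ts[unfolded 3] 3 power_add mult_ac)
  qed
qed

text \<open>
  This is where the signs in the pre-Lie product are used: the antisymmetrised sum is alternating
  in the outer function \<open>T\<close>, although \<open>T\<close> itself sees only one argument that is not an entry of
  the list.
\<close>

lemma Alt_insertion_sum_permute:
  assumes len: "length xs + 1 = k + l" and "\<tau> permutes {..<k}"
  shows "Alt (insertion_sum k l D (\<lambda>zs. T (permute_list \<tau> zs))) xs = of_int (sign \<tau>) * Alt (insertion_sum k l D T) xs"
  using assms(2)
proof (induction rule: permutes_adjacent_induct)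
  case id
  then show ?case by simp
next
  case (adjacent i \<tau>)
  let ?t = "Transposition.transpose i (Suc i)"
  have expand: "Alt (insertion_sum k l D T') xs = (\<Sum>s<k. (- 1) ^ (s * (l + 1)) * Alt (\<lambda>xs. T' (insert_block l D s xs)) xs)" for T'
    unfolding insertion_sum_def[abs_def] Alt_sum Alt_mult ..
  have t: "?t permutes {..<k}"
    using adjacent(1) by (intro permutes_swap_id) auto
  define T' where "T' = (\<lambda>zs. T (permute_list \<tau> zs))"
  have "insertion_sum k l D (\<lambda>zs. T (permute_list (?t \<circ> \<tau>) zs)) ys = insertion_sum k l D (\<lambda>zs. T' (permute_list ?t zs)) ys"
    if "length ys = length xs" for ys
  proof -
    have "length (insert_block l D s ys) = k" if "s < k" for s
      using that \<open>length ys = length xs\<close> len by (simp add: insert_block_def)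
    then show ?thesis
      unfolding insertion_sum_def T'_def using adjacent(2)
      by (intro sum.cong refl) (simp add: permute_list_compose)
  qed
  then have "Alt (insertion_sum k l D (\<lambda>zs. T (permute_list (?t \<circ> \<tau>) zs))) xs
      = Alt (insertion_sum k l D (\<lambda>zs. T' (permute_list ?t zs))) xs"
    by (intro Alt_cong) simp
  also have "\<dots> = (\<Sum>s<k. - ((- 1) ^ (?t s * (l + 1)) * Alt (\<lambda>xs. T' (insert_block l D (?t s) xs)) xs))"
    unfolding expand
    by (intro sum.cong refl Alt_insert_block_adjacent[OF len adjacent(1)]) simp
  also have "\<dots> = - Alt (insertion_sum k l D T') xs"
    unfolding expand sum_negf
    using sum.permute[OF t, of "\<lambda>s. (- 1) ^ (s * (l + 1)) * Alt (\<lambda>xs. T' (insert_block l D s xs)) xs"]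
    by (simp add: o_def)
  also have "\<dots> = of_int (sign (?t \<circ> \<tau>)) * Alt (insertion_sum k l D T) xs"
  proof -
    have "sign (?t \<circ> \<tau>) = - sign \<tau>"
      using adjacent(2)
      by (subst sign_compose) (auto simp: sign_swap_id permutation_swap_id intro: permutation_permutes[THEN iffD2])
    then show ?thesis using adjacent.IH by (simp add: T'_def)
  qed
  finally show ?case .
qed

text \<open>
  Each of the \<open>k!\<close> permutations of the outer arguments contributes the same amount: its sign
  cancels the sign by which the sum changes.
\<close>

lemma Alt_insertion_sum_Alt:
  assumes len: "length xs + 1 = k + l"
  shows "Alt (insertion_sum k l D (Alt T)) xs = fact k * Alt (insertion_sum k l D T) xs"
proof -
  have "insertion_sum k l D (Alt T) ys =
      (\<Sum>\<tau> | \<tau> permutes {..<k}. of_int (sign \<tau>) * insertion_sum k l D (\<lambda>zs. T (permute_list \<tau> zs)) ys)"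
    if "length ys = length xs" for ys
  proof -
    have "length (insert_block l D s ys) = k" if "s < k" for s
      using that \<open>length ys = length xs\<close> len by (simp add: insert_block_def)
    then have "insertion_sum k l D (Alt T) ys = (\<Sum>s<k. \<Sum>\<tau> | \<tau> permutes {..<k}.
        of_int (sign \<tau>) * ((- 1) ^ (s * (l + 1)) * T (permute_list \<tau> (insert_block l D s ys))))"
      unfolding insertion_sum_def Alt_def sum_distrib_left
      by (intro sum.cong refl) (auto simp: mult_ac)
    also have "\<dots> = (\<Sum>\<tau> | \<tau> permutes {..<k}. \<Sum>s<k.
        of_int (sign \<tau>) * ((- 1) ^ (s * (l + 1)) * T (permute_list \<tau> (insert_block l D s ys))))"
      by (rule sum.swap)
    finally show ?thesis
      by (simp add: insertion_sum_def sum_distrib_left)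
  qed
  then have "Alt (insertion_sum k l D (Alt T)) xs =
      Alt (\<lambda>ys. \<Sum>\<tau> | \<tau> permutes {..<k}. of_int (sign \<tau>) * insertion_sum k l D (\<lambda>zs. T (permute_list \<tau> zs)) ys) xs"
    by (intro Alt_cong) blast
  also have "\<dots> = (\<Sum>\<tau> | \<tau> permutes {..<k}. of_int (sign \<tau>) * (of_int (sign \<tau>) * Alt (insertion_sum k l D T) xs))"
    unfolding Alt_sum Alt_mult
    by (intro sum.cong refl arg_cong2[where f = "(*)"] Alt_insertion_sum_permute[OF len]) simp
  also have "\<dots> = (\<Sum>\<tau> | \<tau> permutes {..<k}. Alt (insertion_sum k l D T) xs)"
    by (simp only: sign_cancel)
  also have "\<dots> = fact k * Alt (insertion_sum k l D T) xs"
    using card_permutations[of "{..<k}" k] by simp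
  finally show ?thesis .
qed

section \<open>Pure tensors on the complexification\<close>

text \<open>Points of the complexification are treated as atoms, not as pairs.\<close>

declare split_paired_All [simp del] split_paired_Ex [simp del]

interpretation cx: vector_space "cscale :: complex \<Rightarrow> 'v::real_vector cx \<Rightarrow> 'v cx"
  by (rule vector_space_cscale)

lemma covectors_iff:
  "\<phi> \<in> covectors \<longleftrightarrow> (\<forall>x y. \<phi> (x + y) = \<phi> x + \<phi> y) \<and> (\<forall>c x. \<phi> (cscale c x) = c * \<phi> x)"
proof -
  have "vector_space ((*) :: complex \<Rightarrow> _)" by unfold_locales (auto simp: algebra_simps)
  then show ?thesis
    by (simp add: covectors_def Vector_Spaces.linear_def module_hom_def module_hom_axioms_def
        vector_space_cscale module_iff_vector_space del: split_paired_All)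
qed

lemma covector_add: "\<phi> \<in> covectors \<Longrightarrow> \<phi> (x + y) = \<phi> x + \<phi> y"
  and covector_cscale: "\<phi> \<in> covectors \<Longrightarrow> \<phi> (cscale c x) = c * \<phi> x"
  unfolding covectors_iff by blast+

lemma covector_zero: "\<phi> \<in> covectors \<Longrightarrow> \<phi> 0 = 0"
  using covector_cscale[of \<phi> 0 0] by simp

lemma covector_diff: "\<phi> \<in> covectors \<Longrightarrow> \<phi> (x - y) = \<phi> x - \<phi> y"
  using covector_add[of \<phi> "x - y" y] by simp

lemma covector_sum: "\<phi> \<in> covectors \<Longrightarrow> \<phi> (\<Sum>i\<in>I. f i) = (\<Sum>i\<in>I. \<phi> (f i))"
  by (induction I rule: infinite_finite_induct) (simp_all add: covector_zero covector_add)

text \<open>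
  The value of the pure tensor \<open>v\<^sub>1 \<otimes> \<dots> \<otimes> v\<^sub>n\<close> on a list of \<open>n\<close> covectors.
\<close>

definition tensor_eval :: "('a \<Rightarrow> complex) list \<Rightarrow> 'a list \<Rightarrow> complex" where
  "tensor_eval \<phi>s vs = (\<Prod>(\<phi>, v)\<leftarrow>zip \<phi>s vs. \<phi> v)"

lemma tensor_eval_append: "length \<phi>s = length vs \<Longrightarrow> tensor_eval (\<phi>s @ \<psi>s) (vs @ ws) = tensor_eval \<phi>s vs * tensor_eval \<psi>s ws"
  by (simp add: tensor_eval_def)

lemma tensor_eval_Nil [simp]: "tensor_eval [] [] = 1" and tensor_eval_Cons [simp]: "tensor_eval (\<phi> # \<phi>s) (v # vs) = \<phi> v * tensor_eval \<phi>s vs"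
  by (simp_all add: tensor_eval_def)

lemma tensor_eval_prod: "length \<phi>s = length vs \<Longrightarrow> tensor_eval \<phi>s vs = (\<Prod>j<length vs. (\<phi>s ! j) (vs ! j))"
  by (simp add: tensor_eval_def prod.list_conv_set_nth atLeast0LessThan)

lemma tensor_eval_permute:
  assumes "\<sigma> permutes {..<length vs}" "length \<phi>s = length vs"
  shows "tensor_eval (permute_list \<sigma> \<phi>s) (permute_list \<sigma> vs) = tensor_eval \<phi>s vs"
proof -
  have "mset (zip (permute_list \<sigma> \<phi>s) (permute_list \<sigma> vs)) = mset (zip \<phi>s vs)"
    using assms by (subst permute_list_zip[symmetric, where A = "{..<length vs}"]) auto
  then show ?thesis
    unfolding tensor_eval_def by (metis mset_map prod_mset_prod_list)
qed

lemma tensor_eval_map: "tensor_eval (map (\<lambda>\<phi>. \<phi> \<circ> g) \<phi>s) vs = tensor_eval \<phi>s (map g vs)"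
  by (simp add: tensor_eval_def zip_map1 zip_map2 o_def case_prod_unfold)

lemma Alt_tensor_eval_add:
  assumes "set xs \<subseteq> covectors" "length xs = length us + 1 + length us'"
  shows "Alt (\<lambda>\<phi>s. tensor_eval \<phi>s (us @ [v + w] @ us')) xs =
    Alt (\<lambda>\<phi>s. tensor_eval \<phi>s (us @ [v] @ us')) xs + Alt (\<lambda>\<phi>s. tensor_eval \<phi>s (us @ [w] @ us')) xs"
proof -
  have "tensor_eval \<phi>s (us @ [v + w] @ us') = tensor_eval \<phi>s (us @ [v] @ us') + tensor_eval \<phi>s (us @ [w] @ us')"
    if "length \<phi>s = length xs" "set \<phi>s = set xs" for \<phi>s
  proof -
    have "length us + 1 + length us' = length \<phi>s" using that assms by simp
    then obtain as bs cs where s: "\<phi>s = as @ bs @ cs" "length as = length us" "length bs = 1"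
      by (rule split_list_at)
    then obtain b where b: "bs = [b]" by (auto simp: length_Suc_conv)
    then have "b \<in> covectors" using s that assms by auto
    then show ?thesis using s b by (simp add: tensor_eval_append covector_add algebra_simps)
  qed
  then show ?thesis
    by (subst Alt_add[symmetric], intro Alt_cong)
qed

lemma Alt_tensor_eval_cscale:
  assumes "set xs \<subseteq> covectors" "length xs = length us + 1 + length us'"
  shows "Alt (\<lambda>\<phi>s. tensor_eval \<phi>s (us @ [cscale c v] @ us')) xs = c * Alt (\<lambda>\<phi>s. tensor_eval \<phi>s (us @ [v] @ us')) xs"
proof -
  have "tensor_eval \<phi>s (us @ [cscale c v] @ us') = c * tensor_eval \<phi>s (us @ [v] @ us')"
    if "length \<phi>s = length xs" "set \<phi>s = set xs" for \<phi>s
  proof -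
    have "length us + 1 + length us' = length \<phi>s" using that assms by simp
    then obtain as bs cs where s: "\<phi>s = as @ bs @ cs" "length as = length us" "length bs = 1"
      by (rule split_list_at)
    then obtain b where b: "bs = [b]" by (auto simp: length_Suc_conv)
    then have "b \<in> covectors" using s that assms by auto
    then show ?thesis using s b by (simp add: tensor_eval_append covector_cscale algebra_simps)
  qed
  then show ?thesis
    by (subst Alt_mult[symmetric], intro Alt_cong)
qed

text \<open>
  Exchanging the two arguments that meet the repeated vector does not change the pure tensor.
\<close>

lemma Alt_tensor_eval_repeated:
  assumes "length xs = length vs" "a < length vs" "b < length vs" "a \<noteq> b" "vs ! a = vs ! b"
  shows "Alt (\<lambda>\<phi>s. tensor_eval \<phi>s vs) xs = 0"
proof (rule Alt_eq_0_if_symmetric[of a _ b])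
  fix ys :: "('a \<Rightarrow> complex) list" assume len: "length ys = length xs"
  let ?t = "Transposition.transpose a b"
  have t: "?t permutes {..<length vs}" using assms by (intro permutes_swap_id) auto
  have "permute_list ?t vs = vs"
    using assms t
    by (intro nth_equalityI) (auto simp: permute_list_nth Transposition.transpose_def)
  then show "tensor_eval (permute_list ?t ys) vs = tensor_eval ys vs"
    using tensor_eval_permute[OF t, of ys] len assms by simp
qed (use assms in auto)

text \<open>
  A wedge product vanishes if one factor depends linearly on others: by multilinearity some factor
  occurs twice.
\<close>

lemma Alt_tensor_eval_span:
  assumes "set xs \<subseteq> covectors" "length xs = length us + 1 + length us'" "w \<in> cx.span (set us)"
  shows "Alt (\<lambda>\<phi>s. tensor_eval \<phi>s (us @ [w] @ us')) xs = 0"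
  using assms(3)
proof (induction rule: cx.span_induct_alt)
  case base
  show ?case using Alt_tensor_eval_cscale[OF assms(1,2), of 0 0] by (simp del: append_Cons)
next
  case (step c x y)
  from step(1) obtain i where i: "i < length us" "us ! i = x" by (auto simp: in_set_conv_nth)
  have "Alt (\<lambda>\<phi>s. tensor_eval \<phi>s (us @ [x] @ us')) xs = 0"
    using i assms(2) by (intro Alt_tensor_eval_repeated[of _ _ i "length us"]) (auto simp: nth_append)
  then show ?case
    using step(2) by (simp only: Alt_tensor_eval_add[OF assms(1,2)] Alt_tensor_eval_cscale[OF assms(1,2)]) simp
qed

text \<open>
  The vectors \<open>vs\<close> may be changed one at a time, each by a combination of the factors standing
  before them. In the application \<open>us\<close> contains a basis of \<open>N\<^sup>\<beta>\<close> and \<open>g\<close> is the action of \<open>\<beta>\<^sup>-\<^sup>1\<close>.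
\<close>

lemma Alt_tensor_eval_map_mod_span:
  assumes "set xs \<subseteq> covectors" "length xs = length us + length vs"
    and "\<And>v. v \<in> set vs \<Longrightarrow> g v - v \<in> cx.span (set us)"
  shows "Alt (\<lambda>\<phi>s. tensor_eval \<phi>s (us @ map g vs)) xs = Alt (\<lambda>\<phi>s. tensor_eval \<phi>s (us @ vs)) xs"
  using assms(2,3)
proof (induction vs arbitrary: us)
  case Nil
  then show ?case by simp
next
  case (Cons v vs)
  have "Alt (\<lambda>\<phi>s. tensor_eval \<phi>s (us @ map g (v # vs))) xs = Alt (\<lambda>\<phi>s. tensor_eval \<phi>s (us @ [v + (g v - v)] @ map g vs)) xs"
    by simp
  also have "\<dots> = Alt (\<lambda>\<phi>s. tensor_eval \<phi>s (us @ [v] @ map g vs)) xs"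
    using Cons.prems by (subst Alt_tensor_eval_add) (auto simp: assms(1) Alt_tensor_eval_span simp del: append_Cons)
  also have "\<dots> = Alt (\<lambda>\<phi>s. tensor_eval \<phi>s ((us @ [v]) @ vs)) xs"
    using Cons.prems(1) Cons.prems(2) cx.span_mono[of "set us" "set (us @ [v])"]
    by (subst Cons.IH[symmetric]) auto
  finally show ?case by simp
qed

section \<open>Exterior products of vectors\<close>

lemma wedge_vecs_expand:
  assumes "set \<phi>s \<subseteq> covectors" "length \<phi>s = length vs"
  shows "wedge_vecs vs \<phi>s = (\<Sum>\<sigma> | \<sigma> permutes {..<length vs}.
    of_int (sign \<sigma>) / fact (length vs) * tensor_eval \<phi>s (permute_list \<sigma> vs))"
proof -
  let ?n = "length vs"
  have "(\<Sum>\<sigma> | \<sigma> permutes {..<?n}. of_int (sign \<sigma>) * (\<Prod>j<?n. (\<phi>s ! j) (vs ! \<sigma> j))) =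
     (\<Sum>\<sigma> | \<sigma> permutes {..<?n}. of_int (sign \<sigma>) * tensor_eval \<phi>s (permute_list \<sigma> vs))"
    using assms by (intro sum.cong) (auto simp: tensor_eval_prod permute_list_nth)
  then show ?thesis using assms by (simp add: wedge_vecs_def sum_divide_distrib)
qed

text \<open>
  Permuting the vectors is the same as permuting the covectors by the inverse, so that a wedge
  product is an antisymmetrised pure tensor.
\<close>

lemma wedge_vecs_eq_Alt:
  assumes "set \<phi>s \<subseteq> covectors" "length \<phi>s = length vs"
  shows "wedge_vecs vs \<phi>s = 1 / fact (length vs) * Alt (\<lambda>\<psi>s. tensor_eval \<psi>s vs) \<phi>s"
proof -
  let ?n = "length vs"
  have "wedge_vecs vs \<phi>s =
      1 / fact ?n * (\<Sum>\<sigma> | \<sigma> permutes {..<?n}. of_int (sign \<sigma>) * tensor_eval \<phi>s (permute_list \<sigma> vs))"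
    using wedge_vecs_expand[OF assms] by (simp add: sum_divide_distrib)
  also have "(\<Sum>\<sigma> | \<sigma> permutes {..<?n}. of_int (sign \<sigma>) * tensor_eval \<phi>s (permute_list \<sigma> vs)) =
      (\<Sum>\<sigma> | \<sigma> permutes {..<?n}. of_int (sign (Hilbert_Choice.inv \<sigma>)) * tensor_eval \<phi>s (permute_list (Hilbert_Choice.inv \<sigma>) vs))"
    by (rule sum_permutations_inverse)
  also have "\<dots> = Alt (\<lambda>\<psi>s. tensor_eval \<psi>s vs) \<phi>s"
    unfolding Alt_def assms
  proof (intro sum.cong refl, clarify)
    fix \<sigma> assume \<sigma>: "\<sigma> permutes {..<?n}"
    then have "permutation \<sigma>" by (auto intro: permutation_permutes[THEN iffD2])
    moreover have "permute_list \<sigma> (permute_list (Hilbert_Choice.inv \<sigma>) vs) = vs"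
      using \<sigma> permutes_inv[OF \<sigma>] by (metis permute_list_compose permute_list_id permutes_inv_o(2))
    ultimately show "of_int (sign (Hilbert_Choice.inv \<sigma>)) * tensor_eval \<phi>s (permute_list (Hilbert_Choice.inv \<sigma>) vs) =
        of_int (sign \<sigma>) * tensor_eval (permute_list \<sigma> \<phi>s) vs"
      using tensor_eval_permute[of \<sigma> "permute_list (Hilbert_Choice.inv \<sigma>) vs" \<phi>s] \<sigma> assms by (simp add: sign_inverse)
  qed
  finally show ?thesis .
qed

lemma wedge_vecs_permute:
  assumes "\<sigma> permutes {..<length vs}"
  shows "wedge_vecs (permute_list \<sigma> vs) \<phi>s = of_int (sign \<sigma>) * wedge_vecs vs \<phi>s"
proof (cases "length \<phi>s = length vs \<and> set \<phi>s \<subseteq> covectors")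
  case True
  have "wedge_vecs (permute_list \<sigma> vs) \<phi>s = 1 / fact (length vs) * Alt (\<lambda>\<psi>s. tensor_eval \<psi>s (permute_list \<sigma> vs)) \<phi>s"
    using wedge_vecs_eq_Alt[of \<phi>s "permute_list \<sigma> vs"] True by simp
  also have "Alt (\<lambda>\<psi>s. tensor_eval \<psi>s (permute_list \<sigma> vs)) \<phi>s =
      of_int (sign \<sigma>) * (of_int (sign \<sigma>) * Alt (\<lambda>\<psi>s. tensor_eval \<psi>s (permute_list \<sigma> vs)) \<phi>s)"
    by (simp only: sign_cancel)
  also have "\<dots> = of_int (sign \<sigma>) * Alt (\<lambda>\<psi>s. tensor_eval (permute_list \<sigma> \<psi>s) (permute_list \<sigma> vs)) \<phi>s"
    using assms True Alt_permute[of \<sigma> \<phi>s "\<lambda>\<psi>s. tensor_eval \<psi>s (permute_list \<sigma> vs)"] by simp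
  also have "Alt (\<lambda>\<psi>s. tensor_eval (permute_list \<sigma> \<psi>s) (permute_list \<sigma> vs)) \<phi>s = Alt (\<lambda>\<psi>s. tensor_eval \<psi>s vs) \<phi>s"
    using assms True by (intro Alt_cong) (simp add: tensor_eval_permute)
  finally show ?thesis using True wedge_vecs_eq_Alt[of \<phi>s vs] by simp
qed (auto simp: wedge_vecs_def)

lemma wedge_eq_Alt:
  assumes "length \<phi>s = a + b"
  shows "wedge a b X Y \<phi>s = 1 / fact (a + b) * Alt (\<lambda>\<psi>s. X (take a \<psi>s) * Y (drop a \<psi>s)) \<phi>s"
  using assms by (simp add: wedge_def Alt_def mult.assoc)

text \<open>
  Both factors are antisymmetrised pure tensors, and the outer antisymmetrisation absorbs the two
  inner ones.
\<close>

lemma wedge_wedge_vecs: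
  "wedge (length vs) (length ws) (wedge_vecs vs) (wedge_vecs ws) = wedge_vecs (vs @ ws)"
proof
  fix \<phi>s :: "'a cfun list"
  let ?a = "length vs" and ?b = "length ws"
  show "wedge ?a ?b (wedge_vecs vs) (wedge_vecs ws) \<phi>s = wedge_vecs (vs @ ws) \<phi>s"
  proof (cases "length \<phi>s = ?a + ?b")
    case len: True
    show ?thesis
    proof (cases "set \<phi>s \<subseteq> covectors")
      case True
      let ?V = "\<lambda>\<psi>s. tensor_eval \<psi>s vs" and ?W = "\<lambda>\<psi>s. tensor_eval \<psi>s ws"
      have "wedge_vecs vs (take ?a \<psi>s) * wedge_vecs ws (drop ?a \<psi>s) =
          1 / (fact ?a * fact ?b) * (Alt ?V (take ?a \<psi>s) * Alt ?W (drop ?a \<psi>s))"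
        if "length \<psi>s = length \<phi>s" "set \<psi>s = set \<phi>s" for \<psi>s
        using that True len set_take_subset[of ?a \<psi>s] set_drop_subset[of ?a \<psi>s]
        by (subst wedge_vecs_eq_Alt, force, force, subst wedge_vecs_eq_Alt, force, force) simp
      then have "wedge ?a ?b (wedge_vecs vs) (wedge_vecs ws) \<phi>s = 1 / fact (?a + ?b) *
          (1 / (fact ?a * fact ?b) * Alt (\<lambda>\<psi>s. Alt ?V (take ?a \<psi>s) * Alt ?W (drop ?a \<psi>s)) \<phi>s)"
        unfolding wedge_eq_Alt[OF len]
        by (subst Alt_mult[of "1 / (fact ?a * fact ?b)", symmetric])
          (rule arg_cong2[where f = "(*)", OF refl], rule Alt_cong)
      also have "Alt (\<lambda>\<psi>s. Alt ?V (take ?a \<psi>s) * Alt ?W (drop ?a \<psi>s)) \<phi>s =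
          fact ?a * Alt (\<lambda>\<psi>s. tensor_eval (take ?a \<psi>s) vs * Alt ?W (drop ?a \<psi>s)) \<phi>s"
      proof -
        let ?F = "\<lambda>\<psi>s. tensor_eval (take ?a \<psi>s) vs * Alt ?W (drop ?a \<psi>s)"
        have "Alt ?V (take ?a \<psi>s) * Alt ?W (drop ?a \<psi>s) =
            Alt (\<lambda>zs. ?F (take 0 \<psi>s @ zs @ drop (0 + ?a) \<psi>s)) (take ?a (drop 0 \<psi>s))"
          if "length \<psi>s = length \<phi>s" for \<psi>s
        proof -
          have "Alt (\<lambda>zs. ?F (take 0 \<psi>s @ zs @ drop (0 + ?a) \<psi>s)) (take ?a (drop 0 \<psi>s)) =
              Alt (\<lambda>zs. Alt ?W (drop ?a \<psi>s) * ?V zs) (take ?a \<psi>s)"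
            using that len unfolding drop_0 by (intro Alt_cong) simp
          also have "\<dots> = Alt ?W (drop ?a \<psi>s) * Alt ?V (take ?a \<psi>s)"
            by (rule Alt_mult)
          finally show ?thesis by (simp only: mult.commute)
        qed
        then have "Alt (\<lambda>\<psi>s. Alt ?V (take ?a \<psi>s) * Alt ?W (drop ?a \<psi>s)) \<phi>s =
           Alt (\<lambda>\<psi>s. Alt (\<lambda>zs. ?F (take 0 \<psi>s @ zs @ drop (0 + ?a) \<psi>s)) (take ?a (drop 0 \<psi>s))) \<phi>s"
          by (intro Alt_cong)
        also have "\<dots> = fact ?a * Alt ?F \<phi>s"
          by (rule Alt_block) (use len in simp)
        finally show ?thesis .
      qed
      also have "Alt (\<lambda>\<psi>s. tensor_eval (take ?a \<psi>s) vs * Alt ?W (drop ?a \<psi>s)) \<phi>s =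
          fact ?b * Alt (\<lambda>\<psi>s. tensor_eval \<psi>s (vs @ ws)) \<phi>s"
      proof -
        let ?F = "\<lambda>\<psi>s. tensor_eval \<psi>s (vs @ ws)"
        have "tensor_eval (take ?a \<psi>s) vs * Alt ?W (drop ?a \<psi>s) =
            Alt (\<lambda>zs. ?F (take ?a \<psi>s @ zs @ drop (?a + ?b) \<psi>s)) (take ?b (drop ?a \<psi>s))"
          if "length \<psi>s = length \<phi>s" for \<psi>s
        proof -
          have "Alt (\<lambda>zs. ?F (take ?a \<psi>s @ zs @ drop (?a + ?b) \<psi>s)) (take ?b (drop ?a \<psi>s)) =
              Alt (\<lambda>zs. tensor_eval (take ?a \<psi>s) vs * ?W zs) (drop ?a \<psi>s)"
            using that len by (simp add: tensor_eval_append)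
          then show ?thesis by (simp only: Alt_mult)
        qed
        then have "Alt (\<lambda>\<psi>s. tensor_eval (take ?a \<psi>s) vs * Alt ?W (drop ?a \<psi>s)) \<phi>s =
           Alt (\<lambda>\<psi>s. Alt (\<lambda>zs. ?F (take ?a \<psi>s @ zs @ drop (?a + ?b) \<psi>s)) (take ?b (drop ?a \<psi>s))) \<phi>s"
          by (intro Alt_cong)
        also have "\<dots> = fact ?b * Alt ?F \<phi>s"
          by (rule Alt_block) (use len in simp)
        finally show ?thesis .
      qed
      finally show ?thesis
        using wedge_vecs_eq_Alt[OF True, of "vs @ ws"] len by simp
    next
      case False
      have "wedge_vecs vs (take ?a (permute_list \<sigma> \<phi>s)) * wedge_vecs ws (drop ?a (permute_list \<sigma> \<phi>s)) = 0"
        if "\<sigma> permutes {..<?a + ?b}" for \<sigma>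
      proof -
        have "set (take ?a (permute_list \<sigma> \<phi>s)) \<union> set (drop ?a (permute_list \<sigma> \<phi>s)) = set \<phi>s"
          using that len by (metis append_take_drop_id set_append set_permute_list)
        then show ?thesis using False by (auto simp: wedge_vecs_def)
      qed
      then have "wedge ?a ?b (wedge_vecs vs) (wedge_vecs ws) \<phi>s = 0"
        using len by (auto simp: wedge_def mult.assoc intro!: sum.neutral)
      then show ?thesis using False by (simp add: wedge_vecs_def)
    qed
  qed (simp add: wedge_def wedge_vecs_def)
qed

text \<open>
  In this form a change of basis becomes multiplicativity of the determinant.
\<close>

lemma wedge_vecs_det:
  assumes "length \<phi>s = length vs" "set \<phi>s \<subseteq> covectors"
  shows "wedge_vecs vs \<phi>s = 1 / fact (length vs) *
    det (mat (length vs) (length vs) (\<lambda>(j, i). (\<phi>s ! j) (vs ! i)))"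
proof -
  have "{..<n} = {0..<n}" for n :: nat by auto
  then show ?thesis using assms
    by (auto simp: wedge_vecs_def det_def'[of _ "length vs"] intro!: sum.cong prod.cong)
qed

lemma wedge_vecs_base_change:
  assumes "length us = n" "length vs = n"
    and "\<And>i. i < n \<Longrightarrow> vs ! i = (\<Sum>r<n. cscale (M r i) (us ! r))"
  shows "wedge_vecs vs \<phi>s = det (mat n n (\<lambda>(r, i). M r i)) * wedge_vecs us \<phi>s"
proof (cases "length \<phi>s = n \<and> set \<phi>s \<subseteq> covectors")
  case True
  let ?U = "mat n n (\<lambda>(j, i). (\<phi>s ! j) (us ! i))" and ?V = "mat n n (\<lambda>(j, i). (\<phi>s ! j) (vs ! i))"
    and ?M = "mat n n (\<lambda>(r, i). M r i)"
  have "?V = ?U * ?M"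
  proof (rule eq_matI)
    fix j i assume "j < dim_row (?U * ?M)" "i < dim_col (?U * ?M)"
    then have ji: "j < n" "i < n" by auto
    then have "\<phi>s ! j \<in> covectors" using True by (auto dest: nth_mem)
    then show "?V $$ (j, i) = (?U * ?M) $$ (j, i)"
      using ji by (simp add: assms scalar_prod_def covector_sum covector_cscale mult.commute atLeast0LessThan)
  qed auto
  then have "det ?V = det ?U * det ?M"
    by (simp add: det_mult[of _ n])
  then show ?thesis
    using True assms by (simp add: wedge_vecs_det)
qed (use assms in \<open>auto simp: wedge_vecs_def\<close>)

text \<open>
  Only the permutations that fix the last positions contribute, because \<open>ys\<close> is dual to \<open>es\<close> and
  kills \<open>vs\<close>. In the application this recovers \<open>X\<close> from \<open>X \<and> \<Lambda>\<^sub>g\<close>, which shows that the factor \<open>X\<close>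
  is unique.
\<close>

lemma wedge_vecs_contract_dual:
  assumes len: "length ys = length es" "length \<phi>s = length vs" and cov: "set \<phi>s \<subseteq> covectors" "set ys \<subseteq> covectors"
    and dual: "\<And>i j. i < length es \<Longrightarrow> j < length es \<Longrightarrow> (ys ! j) (es ! i) = (if i = j then 1 else 0)"
    and zero: "\<And>y v. y \<in> set ys \<Longrightarrow> v \<in> set vs \<Longrightarrow> y v = 0"
  shows "wedge_vecs (vs @ es) (\<phi>s @ ys) = fact (length vs) / fact (length vs + length es) * wedge_vecs vs \<phi>s"
proof -
  let ?a = "length vs" and ?b = "length es"
  let ?f = "\<lambda>\<sigma>. of_int (sign \<sigma>) * (\<Prod>j<?a + ?b. ((\<phi>s @ ys) ! j) ((vs @ es) ! \<sigma> j))"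
  have "sum ?f {\<sigma>. \<sigma> permutes {..<?a + ?b}} = sum ?f {\<sigma>. \<sigma> permutes {..<?a}}"
  proof (rule sum.mono_neutral_right)
    show "finite {\<sigma>. \<sigma> permutes {..<?a + ?b}}" by (simp add: finite_permutations)
    show "{\<sigma>. \<sigma> permutes {..<?a}} \<subseteq> {\<sigma>. \<sigma> permutes {..<?a + ?b}}"
      by (auto intro: permutes_subset)
    show "\<forall>\<sigma>\<in>{\<sigma>. \<sigma> permutes {..<?a + ?b}} - {\<sigma>. \<sigma> permutes {..<?a}}. ?f \<sigma> = 0"
    proof
      fix \<sigma> assume "\<sigma> \<in> {\<sigma>. \<sigma> permutes {..<?a + ?b}} - {\<sigma>. \<sigma> permutes {..<?a}}"
      then have \<sigma>: "\<sigma> permutes {..<?a + ?b}" "\<not> \<sigma> permutes {..<?a}" by auto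
      have "\<exists>j. ?a \<le> j \<and> j < ?a + ?b \<and> \<sigma> j \<noteq> j"
      proof (rule ccontr)
        assume *: "\<nexists>j. ?a \<le> j \<and> j < ?a + ?b \<and> \<sigma> j \<noteq> j"
        have "\<sigma> permutes {..<?a}"
          by (rule permutes_superset[OF \<sigma>(1)]) (use * in auto)
        with \<sigma> show False by simp
      qed
      then obtain j where j: "?a \<le> j" "j < ?a + ?b" "\<sigma> j \<noteq> j" by auto
      have sj: "\<sigma> j < ?a + ?b" using \<sigma>(1) j permutes_in_image[OF \<sigma>(1), of j] by auto
      have "((\<phi>s @ ys) ! j) ((vs @ es) ! \<sigma> j) = 0"
      proof (cases "\<sigma> j < ?a")
        case True
        then show ?thesis using j len zero[of "ys ! (j - ?a)" "vs ! \<sigma> j"]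
          by (simp add: nth_append)
      next
        case False
        then show ?thesis using j sj len dual[of "\<sigma> j - ?a" "j - ?a"]
          by (simp add: nth_append)
      qed
      then show "?f \<sigma> = 0" using j by (auto intro!: prod_zero)
    qed
  qed
  also have "\<dots> = (\<Sum>\<sigma> | \<sigma> permutes {..<?a}. of_int (sign \<sigma>) * (\<Prod>j<?a. (\<phi>s ! j) (vs ! \<sigma> j)))"
  proof (intro sum.cong refl arg_cong2[where f = "(*)"], clarify)
    fix \<sigma> assume \<sigma>: "\<sigma> permutes {..<?a}"
    have "{..<?a + ?b} = {..<?a} \<union> {?a..<?a + ?b}" by auto
    then have "(\<Prod>j<?a + ?b. ((\<phi>s @ ys) ! j) ((vs @ es) ! \<sigma> j)) =
      (\<Prod>j<?a. ((\<phi>s @ ys) ! j) ((vs @ es) ! \<sigma> j)) * (\<Prod>j\<in>{?a..<?a + ?b}. ((\<phi>s @ ys) ! j) ((vs @ es) ! \<sigma> j))"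
      by (simp add: prod.union_disjoint ivl_disj_int)
    also have "(\<Prod>j\<in>{?a..<?a + ?b}. ((\<phi>s @ ys) ! j) ((vs @ es) ! \<sigma> j)) = 1"
    proof (rule prod.neutral, clarify)
      fix j assume "j \<in> {?a..<?a + ?b}"
      then show "((\<phi>s @ ys) ! j) ((vs @ es) ! \<sigma> j) = 1"
        using len dual[of "j - ?a" "j - ?a"] permutes_not_in[OF \<sigma>, of j] by (simp add: nth_append less_diff_conv2)
    qed
    also have "(\<Prod>j<?a. ((\<phi>s @ ys) ! j) ((vs @ es) ! \<sigma> j)) = (\<Prod>j<?a. (\<phi>s ! j) (vs ! \<sigma> j))"
      using permutes_in_image[OF \<sigma>] len by (intro prod.cong) (auto simp: nth_append)
    finally show "(\<Prod>j<?a + ?b. ((\<phi>s @ ys) ! j) ((vs @ es) ! \<sigma> j)) = (\<Prod>j<?a. (\<phi>s ! j) (vs ! \<sigma> j))"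
      by simp
  qed
  finally show ?thesis
    using len cov by (simp add: wedge_vecs_def)
qed

section \<open>Polynomial functions and their differentials\<close>

lemma Poly_cmult: "f \<in> Poly \<Longrightarrow> (\<lambda>p. c * f p) \<in> Poly"
  by (rule Poly.mult[OF Poly.const])

lemma Poly_diff: "f \<in> Poly \<Longrightarrow> h \<in> Poly \<Longrightarrow> (\<lambda>p. f p - h p) \<in> Poly"
  using Poly.add[of f "\<lambda>p. -1 * h p"] Poly_cmult[of h "-1"] by simp

lemma Poly_sum: "(\<And>i. i \<in> I \<Longrightarrow> f i \<in> Poly) \<Longrightarrow> (\<lambda>p. \<Sum>i\<in>I. f i p) \<in> Poly"
  by (induction I rule: infinite_finite_induct) (auto intro: Poly.intros)

lemma Poly_prod: "(\<And>i. i \<in> I \<Longrightarrow> f i \<in> Poly) \<Longrightarrow> (\<lambda>p. \<Prod>i\<in>I. f i p) \<in> Poly"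
  by (induction I rule: infinite_finite_induct) (auto intro: Poly.intros)

definition clinear :: "('v::real_vector cx \<Rightarrow> 'v cx) \<Rightarrow> bool" where
  "clinear M \<longleftrightarrow> (\<forall>x y. M (x + y) = M x + M y) \<and> (\<forall>c x. M (cscale c x) = cscale c (M x))"

lemma covector_comp: "\<phi> \<in> covectors \<Longrightarrow> clinear M \<Longrightarrow> \<phi> \<circ> M \<in> covectors"
  unfolding covectors_iff clinear_def by simp

lemma Poly_comp:
  assumes "f \<in> Poly" "clinear M"
  shows "(\<lambda>p. f (M p)) \<in> Poly"
  using assms(1)
proof induction
  case (covec \<phi>)
  from covector_comp[OF this assms(2)] show ?case by (auto simp: o_def intro: Poly.covec)
qed (auto intro: Poly.intros)

lemma differential_comp: "clinear M \<Longrightarrow> differential (\<lambda>p. f (M p)) p = differential f (M p) \<circ> M"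
  by (rule ext) (simp add: differential_def clinear_def)

lemma differentialI:
  assumes "\<And>v. ((\<lambda>t. f (p + cscale t v)) has_field_derivative D v) (at 0)"
  shows "differential f p = D"
  using assms by (auto simp: differential_def intro!: DERIV_imp_deriv)

lemma cscale_0_left [simp]: "cscale 0 v = 0"
  by (rule cx.scale_zero_left)

text \<open>
  The function \<open>deriv\<close> has an arbitrary value where no derivative exists, so existence is
  established along with the value.
\<close>

lemma has_derivative_Poly:
  assumes "f \<in> Poly"
  shows "((\<lambda>t. f (p + cscale t v)) has_field_derivative differential f p v) (at 0)"
proof -
  have "\<exists>D. \<forall>v. ((\<lambda>t. f (p + cscale t v)) has_field_derivative D v) (at 0)"
    using assms
  proof induction
    case (const c)
    show ?case by (rule exI[of _ "\<lambda>_. 0"]) simp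
  next
    case (covec \<phi>)
    have "((\<lambda>t. \<phi> (p + cscale t v)) has_field_derivative \<phi> v) (at 0)" for v
      unfolding covector_add[OF covec] covector_cscale[OF covec] by (auto intro!: derivative_eq_intros)
    then show ?case by blast
  next
    case (add f h)
    then obtain D E where "\<And>v. ((\<lambda>t. f (p + cscale t v)) has_field_derivative D v) (at 0)"
      and "\<And>v. ((\<lambda>t. h (p + cscale t v)) has_field_derivative E v) (at 0)" by blast
    from DERIV_add[OF this] show ?case by (intro exI[of _ "\<lambda>v. D v + E v"] allI)
  next
    case (mult f h)
    then obtain D E where "\<And>v. ((\<lambda>t. f (p + cscale t v)) has_field_derivative D v) (at 0)"
      and "\<And>v. ((\<lambda>t. h (p + cscale t v)) has_field_derivative E v) (at 0)" by blast
    from DERIV_mult[OF this] show ?case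
      by (intro exI[of _ "\<lambda>v. D v * h p + E v * f p"] allI) simp
  qed
  then obtain D where D: "\<And>v. ((\<lambda>t. f (p + cscale t v)) has_field_derivative D v) (at 0)" by blast
  then show ?thesis using differentialI[of f p D] by simp
qed

lemma differential_const [simp]: "differential (\<lambda>_. c) p = (\<lambda>_. 0)"
  by (rule differentialI) simp

lemma differential_covector: 
  assumes "\<phi> \<in> covectors"
  shows "differential \<phi> p = \<phi>"
  by (rule differentialI, unfold covector_add[OF assms] covector_cscale[OF assms])
    (auto intro!: derivative_eq_intros)

lemma differential_add:
  "f \<in> Poly \<Longrightarrow> h \<in> Poly \<Longrightarrow> differential (\<lambda>q. f q + h q) p = (\<lambda>v. differential f p v + differential h p v)"
  by (rule differentialI) (auto intro!: DERIV_add has_derivative_Poly)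

lemma differential_mult:
  "f \<in> Poly \<Longrightarrow> h \<in> Poly \<Longrightarrow>
    differential (\<lambda>q. f q * h q) p = (\<lambda>v. differential f p v * h p + differential h p v * f p)"
  using DERIV_mult[OF has_derivative_Poly has_derivative_Poly, of f h p _ p]
  by (intro differentialI) auto

lemma differential_cmult:
  "f \<in> Poly \<Longrightarrow> differential (\<lambda>q. c * f q) p = (\<lambda>v. c * differential f p v)"
  using differential_mult[OF Poly.const[of c], of f p] by (simp add: mult.commute)

lemma differential_sum:
  "(\<And>i. i \<in> I \<Longrightarrow> f i \<in> Poly) \<Longrightarrow>
    differential (\<lambda>q. \<Sum>i\<in>I. f i q) p = (\<lambda>v. \<Sum>i\<in>I. differential (f i) p v)"
  by (induction I rule: infinite_finite_induct) (auto simp: differential_add Poly_sum)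

lemma differential_affine:
  assumes "\<phi> \<in> covectors"
  shows "differential (\<lambda>q. \<phi> q - c) p = \<phi>"
  using differential_add[OF Poly.covec[OF assms] Poly.const[of "- c"], of p]
  by (simp add: differential_covector[OF assms])

lemma zero_covector: "(\<lambda>_. 0) \<in> covectors"
  by (simp add: covectors_iff)

lemma differential_in_covectors:
  assumes "f \<in> Poly"
  shows "differential f p \<in> covectors"
  using assms
proof induction
  case (const c)
  show ?case by (simp add: zero_covector)
next
  case (covec \<phi>)
  then show ?case by (simp add: differential_covector)
next
  case (add f h)
  then show ?case by (simp add: differential_add covectors_iff algebra_simps)
next
  case (mult f h)
  then show ?case by (simp add: differential_mult covectors_iff algebra_simps)
qed

text \<open>
  Along the direction \<open>v\<close> a polynomial difference is divisible by the displacement, and where the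
  displacement is zero the quotient is the derivative. The induction uses the Leibniz rule for
  differences. Both halves are needed: divisibility makes the cocycle polynomial, and the value of
  the quotient identifies it on the fixed space.
\<close>

lemma divided_difference:
  assumes "f \<in> Poly" and "clinear M" "clinear M'" and "d \<in> Poly"
    and diff: "\<And>p. M p = M' p + cscale (d p) v"
  shows "\<exists>q\<in>Poly. (\<forall>p. f (M p) - f (M' p) = d p * q p) \<and>
    (\<forall>p. M p = M' p \<longrightarrow> q p = differential f (M p) v)"
  using assms(1)
proof induction
  case (const c)
  show ?case by (rule bexI[of _ "\<lambda>_. 0"]) (auto intro: Poly.const)
next
  case (covec \<phi>)
  have "\<phi> (M p) - \<phi> (M' p) = d p * \<phi> v" for p
    unfolding diff[of p] by (simp add: covector_add[OF covec] covector_cscale[OF covec])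
  then show ?case
    by (intro bexI[of _ "\<lambda>_. \<phi> v"]) (simp_all add: differential_covector[OF covec] Poly.const)
next
  case (add f h)
  then obtain q r where q: "q \<in> Poly" "\<forall>p. f (M p) - f (M' p) = d p * q p"
      "\<forall>p. M p = M' p \<longrightarrow> q p = differential f (M p) v"
    and r: "r \<in> Poly" "\<forall>p. h (M p) - h (M' p) = d p * r p"
      "\<forall>p. M p = M' p \<longrightarrow> r p = differential h (M p) v"
    by blast
  show ?case
  proof (intro bexI[of _ "\<lambda>p. q p + r p"] conjI allI impI)
    fix p
    have "f (M p) + h (M p) - (f (M' p) + h (M' p)) = (f (M p) - f (M' p)) + (h (M p) - h (M' p))"
      by (simp add: algebra_simps)
    also have "\<dots> = d p * (q p + r p)"
      unfolding q(2)[rule_format] r(2)[rule_format] by (simp add: algebra_simps)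
    finally show "f (M p) + h (M p) - (f (M' p) + h (M' p)) = d p * (q p + r p)" .
    assume eq: "M p = M' p"
    show "q p + r p = differential (\<lambda>p. f p + h p) (M p) v"
      by (simp add: differential_add[OF add(1,2)] q(3)[rule_format, OF eq] r(3)[rule_format, OF eq])
  next
    show "(\<lambda>p. q p + r p) \<in> Poly" by (intro Poly.add q(1) r(1))
  qed
next
  case (mult f h)
  then obtain q r where q: "q \<in> Poly" "\<forall>p. f (M p) - f (M' p) = d p * q p"
      "\<forall>p. M p = M' p \<longrightarrow> q p = differential f (M p) v"
    and r: "r \<in> Poly" "\<forall>p. h (M p) - h (M' p) = d p * r p"
      "\<forall>p. M p = M' p \<longrightarrow> r p = differential h (M p) v"
    by blast
  show ?case
  proof (intro bexI[of _ "\<lambda>p. q p * h (M p) + f (M' p) * r p"] conjI allI impI)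
    fix p
    have "f (M p) * h (M p) - f (M' p) * h (M' p) =
        (f (M p) - f (M' p)) * h (M p) + f (M' p) * (h (M p) - h (M' p))"
      by (simp add: algebra_simps)
    also have "\<dots> = d p * (q p * h (M p) + f (M' p) * r p)"
      unfolding q(2)[rule_format] r(2)[rule_format] by (simp add: algebra_simps)
    finally show "f (M p) * h (M p) - f (M' p) * h (M' p) = d p * (q p * h (M p) + f (M' p) * r p)" .
    assume eq: "M p = M' p"
    show "q p * h (M p) + f (M' p) * r p = differential (\<lambda>p. f p * h p) (M p) v"
      by (simp add: differential_mult[OF mult(1,2)] q(3)[rule_format, OF eq] r(3)[rule_format, OF eq] eq)
  next
    show "(\<lambda>p. q p * h (M p) + f (M' p) * r p) \<in> Poly"
      by (intro Poly.add Poly.mult q(1) r(1) Poly_comp[OF mult(2) assms(2)] Poly_comp[OF mult(1) assms(3)])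
  qed
qed

text \<open>
  Cancellation of a product of linear forms: near every point \<open>p\<close> the line through \<open>p\<close> in the
  direction \<open>v\<close> leaves all the hyperplanes, so \<open>q\<close> and \<open>r\<close> agree at \<open>p\<close> by continuity.
\<close>

lemma Poly_eq_if_eq_off_hyperplanes:
  assumes "q \<in> Poly" "r \<in> Poly"
    and "finite I" and y: "\<And>i. i \<in> I \<Longrightarrow> y i \<in> covectors" "\<And>i. i \<in> I \<Longrightarrow> y i v \<noteq> 0"
    and eq: "\<And>p. q p * (\<Prod>i\<in>I. y i p) = r p * (\<Prod>i\<in>I. y i p)"
  shows "q = r"
proof
  fix p
  have lim: "((\<lambda>t. f (p + cscale t v)) \<longlongrightarrow> f p) (at 0)" if "f \<in> Poly" for f
    using DERIV_isCont[OF has_derivative_Poly[OF that, of p v]] by (simp add: isCont_def)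
  have "\<forall>\<^sub>F t in at 0. y i (p + cscale t v) \<noteq> 0" if "i \<in> I" for i
  proof -
    have "\<forall>\<^sub>F t in at 0. t \<noteq> - y i p / y i v"
      by (rule eventually_neq_at_within)
    then show ?thesis
    proof (rule eventually_mono)
      fix t assume t: "t \<noteq> - y i p / y i v"
      have "t * y i v \<noteq> - y i p"
      proof
        assume "t * y i v = - y i p"
        with y(2)[OF that] have "t = - y i p / y i v"
          by (rule eq_divide_imp)
        with t show False ..
      qed
      then show "y i (p + cscale t v) \<noteq> 0"
        using y(1)[OF that] eq_neg_iff_add_eq_0[of "t * y i v" "y i p"]
        by (simp add: covector_add covector_cscale add.commute)
    qed
  qed
  then have "\<forall>\<^sub>F t in at 0. \<forall>i\<in>I. y i (p + cscale t v) \<noteq> 0"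
    using \<open>finite I\<close> by (simp add: eventually_ball_finite)
  then have "\<forall>\<^sub>F t in at 0. q (p + cscale t v) = r (p + cscale t v)"
  proof (rule eventually_mono)
    fix t assume "\<forall>i\<in>I. y i (p + cscale t v) \<noteq> 0"
    then have "(\<Prod>i\<in>I. y i (p + cscale t v)) \<noteq> 0" using \<open>finite I\<close> by simp
    then show "q (p + cscale t v) = r (p + cscale t v)" using eq[of "p + cscale t v"] by simp
  qed
  from tendsto_cong[OF this] lim[OF assms(1)]
  have "((\<lambda>t. r (p + cscale t v)) \<longlongrightarrow> q p) (at 0)" by simp
  from tendsto_unique[OF _ this lim[OF assms(2)]] show "q p = r p" by simp
qed

section \<open>Decomposition of the representation space\<close>

lemma clinear_cxmap: "linear f \<Longrightarrow> clinear (cxmap f)"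
  by (auto simp: clinear_def cxmap_def cscale_def linear_add linear_cmul linear_diff)

lemma cxset_subspace:
  assumes "subspace W"
  shows "0 \<in> cxset W" "z \<in> cxset W \<Longrightarrow> w \<in> cxset W \<Longrightarrow> z + w \<in> cxset W"
    "z \<in> cxset W \<Longrightarrow> w \<in> cxset W \<Longrightarrow> z - w \<in> cxset W"
    "z \<in> cxset W \<Longrightarrow> cscale c z \<in> cxset W"
  using assms
  by (auto simp: cxset_def cscale_def subspace_0 subspace_add subspace_diff subspace_scale zero_prod_def)

lemma cxset_sum:
  "subspace W \<Longrightarrow> (\<And>i. i \<in> I \<Longrightarrow> f i \<in> cxset W) \<Longrightarrow> (\<Sum>i\<in>I. f i) \<in> cxset W"
  by (induction I rule: infinite_finite_induct) (auto simp: cxset_subspace)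

locale finite_rep =
  fixes G :: "('g, 'm) monoid_scheme" and \<rho> :: "'g \<Rightarrow> 'v::real_vector \<Rightarrow> 'v" and B :: "'v set"
  assumes basis: "finite_dimensional_vector_space ((*\<^sub>R) :: real \<Rightarrow> 'v \<Rightarrow> 'v) B"
    and action: "group_action G UNIV \<rho>"
    and finite_group: "finite (carrier G)"
    and linear_rho: "g \<in> carrier G \<Longrightarrow> linear (\<rho> g)"
begin

sublocale group G
  using action by (simp add: group_action_def group_hom_def)

lemma rho_mult: "g \<in> carrier G \<Longrightarrow> h \<in> carrier G \<Longrightarrow> \<rho> (g \<otimes>\<^bsub>G\<^esub> h) v = \<rho> g (\<rho> h v)"
  using group_action.composition_rule[OF action, of v g h] by simp

lemma rho_one: "\<rho> \<one>\<^bsub>G\<^esub> v = v"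
  using group_action.id_eq_one[OF action] by (simp add: fun_eq_iff)

lemma rho_inv: "g \<in> carrier G \<Longrightarrow> \<rho> (inv\<^bsub>G\<^esub> g) (\<rho> g v) = v" "g \<in> carrier G \<Longrightarrow> \<rho> g (\<rho> (inv\<^bsub>G\<^esub> g) v) = v"
  by (simp_all add: rho_mult[symmetric] rho_one)

lemma cxmap_rho_one: "cxmap (\<rho> \<one>\<^bsub>G\<^esub>) z = z"
  by (simp add: cxmap_def prod_eq_iff rho_one)

lemma cxmap_rho_mult:
  "g \<in> carrier G \<Longrightarrow> h \<in> carrier G \<Longrightarrow> cxmap (\<rho> (g \<otimes>\<^bsub>G\<^esub> h)) z = cxmap (\<rho> g) (cxmap (\<rho> h) z)"
  by (simp add: cxmap_def prod_eq_iff rho_mult)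

lemma cxmap_rho_inv:
  "g \<in> carrier G \<Longrightarrow> cxmap (\<rho> (inv\<^bsub>G\<^esub> g)) (cxmap (\<rho> g) z) = z"
  "g \<in> carrier G \<Longrightarrow> cxmap (\<rho> g) (cxmap (\<rho> (inv\<^bsub>G\<^esub> g)) z) = z"
  by (simp_all add: cxmap_def prod_eq_iff rho_inv)

lemma clinear_rho: "g \<in> carrier G \<Longrightarrow> clinear (cxmap (\<rho> g))"
  by (simp add: clinear_cxmap linear_rho)

lemma subspace_fixed: "g \<in> carrier G \<Longrightarrow> subspace (fixed_space \<rho> g)"
  using linear_rho[of g]
  by (auto simp: fixed_space_def subspace_def linear_0 linear_add linear_cmul)

lemma subspace_normal: "subspace (normal_space G \<rho> g)"
  by (simp add: normal_space_def)

abbreviation cyc :: "'g \<Rightarrow> 'g set" where "cyc g \<equiv> generate G {g}"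

lemma cyc_subset: "g \<in> carrier G \<Longrightarrow> cyc g \<subseteq> carrier G"
  by (rule generate_incl) simp

lemma finite_cyc: "g \<in> carrier G \<Longrightarrow> finite (cyc g)"
  using cyc_subset finite_group finite_subset by blast

lemma card_cyc: "g \<in> carrier G \<Longrightarrow> real (card (cyc g)) > 0"
  using finite_cyc[of g] generate.one[of G "{g}"] by (auto simp: card_gt_0_iff)

lemma sum_cyc_translate:
  assumes g: "g \<in> carrier G" and k: "k \<in> cyc g"
  shows "(\<Sum>h\<in>cyc g. f (k \<otimes>\<^bsub>G\<^esub> h)) = (\<Sum>h\<in>cyc g. f h)"
proof (rule sum.reindex_bij_witness[of _ "\<lambda>h. inv\<^bsub>G\<^esub> k \<otimes>\<^bsub>G\<^esub> h" "\<lambda>h. k \<otimes>\<^bsub>G\<^esub> h"])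
  have sg: "subgroup (cyc g) G" using g by (intro generate_is_subgroup) simp
  have c: "cyc g \<subseteq> carrier G" by (rule cyc_subset[OF g])
  fix h assume h: "h \<in> cyc g"
  show "inv\<^bsub>G\<^esub> k \<otimes>\<^bsub>G\<^esub> (k \<otimes>\<^bsub>G\<^esub> h) = h" "k \<otimes>\<^bsub>G\<^esub> (inv\<^bsub>G\<^esub> k \<otimes>\<^bsub>G\<^esub> h) = h"
    using subsetD[OF c h] subsetD[OF c k] by (simp_all add: m_assoc[symmetric])
  show "k \<otimes>\<^bsub>G\<^esub> h \<in> cyc g" "inv\<^bsub>G\<^esub> k \<otimes>\<^bsub>G\<^esub> h \<in> cyc g"
    using h k sg by (auto intro: subgroup.m_closed subgroup.m_inv_closed)
qed simp

text \<open>
  The projection onto the fixed space of \<open>g\<close>.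
\<close>

definition avg :: "'g \<Rightarrow> 'v \<Rightarrow> 'v" where
  "avg g v = (1 / real (card (cyc g))) *\<^sub>R (\<Sum>h\<in>cyc g. \<rho> h v)"

lemma linear_avg: "g \<in> carrier G \<Longrightarrow> linear (avg g)"
  unfolding avg_def using cyc_subset linear_rho
  by (intro linear_compose_scale_right linear_compose_sum) auto

lemma rho_avg:
  assumes "g \<in> carrier G" "k \<in> cyc g"
  shows "\<rho> k (avg g v) = avg g v"
proof -
  have k: "k \<in> carrier G" using assms cyc_subset by auto
  have "(\<Sum>h\<in>cyc g. \<rho> k (\<rho> h v)) = (\<Sum>h\<in>cyc g. \<rho> (k \<otimes>\<^bsub>G\<^esub> h) v)"
    using cyc_subset[OF assms(1)] k by (intro sum.cong) (auto simp: rho_mult)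
  also have "\<dots> = (\<Sum>h\<in>cyc g. \<rho> h v)" by (rule sum_cyc_translate[OF assms])
  finally show ?thesis
    unfolding avg_def linear_cmul[OF linear_rho[OF k]] linear_sum[OF linear_rho[OF k]] by simp
qed

lemma fixed_cyc:
  assumes "g \<in> carrier G" "v \<in> fixed_space \<rho> g" "h \<in> cyc g"
  shows "\<rho> h v = v"
  using assms(3)
proof (induction rule: generate.induct)
  case (inv h)
  then show ?case using assms rho_inv[of g v] by (auto simp: fixed_space_def)
next
  case (eng h1 h2)
  then show ?case using cyc_subset[OF assms(1)] by (subst rho_mult) auto
qed (use assms in \<open>auto simp: rho_one fixed_space_def\<close>)

lemma avg_fixed: "g \<in> carrier G \<Longrightarrow> v \<in> fixed_space \<rho> g \<Longrightarrow> avg g v = v"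
  using card_cyc[of g] by (simp add: avg_def fixed_cyc sum_constant_scaleR)

lemma avg_in_fixed: "g \<in> carrier G \<Longrightarrow> avg g v \<in> fixed_space \<rho> g"
  using rho_avg[of g g] by (simp add: fixed_space_def generate.incl)

text \<open>
  Average any linear projection onto \<open>U\<close> over the cyclic group.
\<close>

lemma Maschke_projection:
  assumes g: "g \<in> carrier G" and U: "cyclic_subrep G \<rho> g U"
  shows "\<exists>P. linear P \<and> (\<forall>u\<in>U. P u = u) \<and> range P \<subseteq> U \<and> (\<forall>k\<in>cyc g. \<forall>v. P (\<rho> k v) = \<rho> k (P v))"
proof -
  note c = cyc_subset[OF g]
  have sg: "subgroup (cyc g) G" using g by (intro generate_is_subgroup) simp
  have sU: "subspace U" and inv: "\<And>h u. h \<in> cyc g \<Longrightarrow> u \<in> U \<Longrightarrow> \<rho> h u \<in> U"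
    using U by (auto simp: cyclic_subrep_def)
  obtain Q where Q: "linear Q" "\<And>u. u \<in> U \<Longrightarrow> Q u = u" "range Q \<subseteq> U"
    using real_vector.linear_exists_left_inverse_on[OF linear_ident[where 'a = 'v] sU] by auto
  define P where "P v = (1 / real (card (cyc g))) *\<^sub>R (\<Sum>h\<in>cyc g. \<rho> h (Q (\<rho> (inv\<^bsub>G\<^esub> h) v)))" for v
  have "linear P"
    unfolding P_def using c Q(1) linear_rho
    by (intro linear_compose_scale_right linear_compose_sum ballI)
      (auto intro!: linear_compose[unfolded o_def, of "\<lambda>v. Q (\<rho> _ v)"] linear_compose[unfolded o_def, of _ Q])
  moreover have "P u = u" if "u \<in> U" for u
  proof -
    have "\<rho> h (Q (\<rho> (inv\<^bsub>G\<^esub> h) u)) = u" if "h \<in> cyc g" for h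
      using that \<open>u \<in> U\<close> inv[of "inv\<^bsub>G\<^esub> h" u] subgroup.m_inv_closed[OF sg that] c
      by (simp add: Q rho_inv subset_iff)
    then show ?thesis using card_cyc[OF g] by (simp add: P_def sum_constant_scaleR)
  qed
  moreover have "P v \<in> U" for v
    unfolding P_def using sU Q(3) inv by (intro subspace_scale subspace_sum) auto
  moreover have "P (\<rho> k v) = \<rho> k (P v)" if k: "k \<in> cyc g" for k v
  proof -
    have kc: "k \<in> carrier G" using k c by auto
    have "(\<Sum>h\<in>cyc g. \<rho> h (Q (\<rho> (inv\<^bsub>G\<^esub> h) (\<rho> k v)))) =
        (\<Sum>h\<in>cyc g. \<rho> (k \<otimes>\<^bsub>G\<^esub> h) (Q (\<rho> (inv\<^bsub>G\<^esub> (k \<otimes>\<^bsub>G\<^esub> h)) (\<rho> k v))))"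
      by (rule sum_cyc_translate[OF g k, symmetric])
    also have "\<dots> = (\<Sum>h\<in>cyc g. \<rho> k (\<rho> h (Q (\<rho> (inv\<^bsub>G\<^esub> h) v))))"
      using c kc by (intro sum.cong) (auto simp: rho_mult inv_mult_group rho_inv subset_iff)
    finally show ?thesis
      unfolding P_def linear_cmul[OF linear_rho[OF kc]] linear_sum[OF linear_rho[OF kc]] by simp
  qed
  ultimately show ?thesis by blast
qed

text \<open>
  Complete reducibility, in the form needed here. By induction on the dimension, split off
  invariant complements until irreducible pieces remain; these are nontrivial since they contain
  no fixed vector except zero.
\<close>

lemma subrep_without_fixed_vectors_le_normal:
  assumes g: "g \<in> carrier G" and "cyclic_subrep G \<rho> g W" "W \<inter> fixed_space \<rho> g \<subseteq> {0}"
  shows "W \<subseteq> normal_space G \<rho> g"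
proof -
  interpret fd: finite_dimensional_vector_space "(*\<^sub>R) :: real \<Rightarrow> 'v \<Rightarrow> 'v" B
    by (rule basis)
  have dim_less: "dim U < dim W" if "subspace U" "subspace W" "U \<subset> W" for U W :: "'v set"
  proof -
    have "span U = U" "span W = W"
      using that by (simp_all add: span_eq_iff)
    then show ?thesis
      using that fd.dim_psubset[of U W] unfolding span_raw_def dim_raw_def by simp
  qed
  show ?thesis
    using assms(2,3)
  proof (induction "dim W" arbitrary: W rule: less_induct)
    case less
    have sW: "subspace W" and invW: "\<And>h w. h \<in> cyc g \<Longrightarrow> w \<in> W \<Longrightarrow> \<rho> h w \<in> W"
      using less.prems by (auto simp: cyclic_subrep_def)
    show ?case
    proof (cases "W = {0}")
      case True
      then show ?thesis using subspace_0[OF subspace_normal] by auto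
    next
      case False
      show ?thesis
      proof (cases "irreducible_subrep G \<rho> g W")
        case True
        obtain w where "w \<in> W" "w \<noteq> 0" using False subspace_0[OF sW] by auto
        then have "\<rho> g w \<noteq> w" using less.prems by (auto simp: fixed_space_def)
        then have "\<exists>h\<in>cyc g. \<exists>w\<in>W. \<rho> h w \<noteq> w"
          using \<open>w \<in> W\<close> generate.incl[of g "{g}" G] by auto
        with True show ?thesis
          unfolding normal_space_def by (intro subset_trans[OF _ span_superset] Union_upper) simp
      next
        case nirr: False
        then obtain U where U: "cyclic_subrep G \<rho> g U" "U \<subseteq> W" "U \<noteq> {0}" "U \<noteq> W"
          using False less.prems by (auto simp: irreducible_subrep_def)
        obtain P where P: "linear P" "\<forall>u\<in>U. P u = u" "range P \<subseteq> U"
          "\<forall>k\<in>cyc g. \<forall>v. P (\<rho> k v) = \<rho> k (P v)"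
          using Maschke_projection[OF g U(1)] by blast
        have sU: "subspace U" using U by (simp add: cyclic_subrep_def)
        define U' where "U' = {w \<in> W. P w = 0}"
        have sU': "subspace U'"
          using sW P(1) by (auto simp: U'_def subspace_def linear_0 linear_add linear_cmul)
        have subU': "cyclic_subrep G \<rho> g U'"
          unfolding cyclic_subrep_def
        proof (intro conjI sU' ballI image_subsetI)
          fix h w assume h: "h \<in> cyc g" and "w \<in> U'"
          then have "w \<in> W" "P w = 0" by (auto simp: U'_def)
          moreover have "linear (\<rho> h)" using h cyc_subset[OF g] linear_rho by auto
          ultimately show "\<rho> h w \<in> U'"
            using h invW P(4) by (auto simp: U'_def linear_0)
        qed
        obtain u where u: "u \<in> U" "u \<noteq> 0" using U subspace_0[OF sU] by auto
        have "u \<in> W" "u \<notin> U'" using u P(2) U(2) by (auto simp: U'_def)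
        then have "U' \<subset> W" by (auto simp: U'_def)
        then have "U' \<subseteq> normal_space G \<rho> g"
          using less.hyps[OF dim_less[OF sU' sW] subU'] less.prems by blast
        moreover have "U \<subseteq> normal_space G \<rho> g"
          using less.hyps[OF dim_less[OF sU sW] U(1)] less.prems U by blast
        moreover have "P w \<in> U" "w - P w \<in> U'" if "w \<in> W" for w
        proof -
          show PU: "P w \<in> U" using P(3) by auto
          then show "w - P w \<in> U'"
            using that P(2) U(2) subspace_diff[OF sW, of w "P w"] linear_diff[OF P(1), of w "P w"]
            by (auto simp: U'_def)
        qed
        ultimately have "P w + (w - P w) \<in> normal_space G \<rho> g" if "w \<in> W" for w
          using that by (intro subspace_add[OF subspace_normal]) auto
        then show ?thesis by auto
      qed
    qed
  qed
qed

lemma avg_rho: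
  assumes g: "g \<in> carrier G" and k: "k \<in> cyc g"
  shows "avg g (\<rho> k v) = avg g v"
proof -
  have kc: "k \<in> carrier G" using k cyc_subset[OF g] by auto
  have inj: "inj_on (\<lambda>h. h \<otimes>\<^bsub>G\<^esub> k) (cyc g)"
    using cyc_subset[OF g] kc by (intro inj_onI) (metis right_cancel subsetD)
  have sg: "subgroup (cyc g) G" using g by (intro generate_is_subgroup) simp
  have img: "(\<lambda>h. h \<otimes>\<^bsub>G\<^esub> k) ` cyc g = cyc g"
    using inj finite_cyc[OF g] subgroup.m_closed[OF sg _ k] by (intro endo_inj_surj) auto
  have "(\<Sum>h\<in>cyc g. \<rho> h (\<rho> k v)) = (\<Sum>h\<in>cyc g. \<rho> (h \<otimes>\<^bsub>G\<^esub> k) v)"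
    using cyc_subset[OF g] kc by (intro sum.cong) (auto simp: rho_mult)
  also have "\<dots> = (\<Sum>h\<in>cyc g. \<rho> h v)"
    using sum.reindex[OF inj, of "\<lambda>h. \<rho> h v"] img by (simp add: o_def)
  finally show ?thesis by (simp add: avg_def)
qed

text \<open>
  The kernel of the averaging projection is a subrepresentation without nonzero fixed vectors.
\<close>

lemma avg_zero_in_normal:
  assumes g: "g \<in> carrier G" and w: "avg g w = 0"
  shows "w \<in> normal_space G \<rho> g"
proof -
  note l = linear_avg[OF g]
  have "{w. avg g w = 0} \<subseteq> normal_space G \<rho> g"
  proof (rule subrep_without_fixed_vectors_le_normal[OF g])
    show "cyclic_subrep G \<rho> g {w. avg g w = 0}"
      using l avg_rho[OF g] by (auto simp: cyclic_subrep_def subspace_def linear_0 linear_add linear_cmul)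
    show "{w. avg g w = 0} \<inter> fixed_space \<rho> g \<subseteq> {0}" using avg_fixed[OF g] by force
  qed
  then show ?thesis using w by auto
qed

text \<open>
  A translate and the vector itself have the same average. This containment is the geometric
  reason why the twist by \<open>\<beta>\<close> disappears in the end.
\<close>

lemma rho_diff_in_normal:
  assumes g: "g \<in> carrier G" and k: "k \<in> cyc g"
  shows "\<rho> k v - v \<in> normal_space G \<rho> g"
  by (rule avg_zero_in_normal[OF g]) (simp add: linear_diff[OF linear_avg[OF g]] avg_rho[OF g k])

lemma normal_decomposition:
  assumes g: "g \<in> carrier G"
  shows "v - avg g v \<in> normal_space G \<rho> g"
  by (rule avg_zero_in_normal[OF g]) (simp add: linear_diff[OF linear_avg[OF g]] avg_fixed avg_in_fixed g)

end

section \<open>Eigen-coordinates\<close>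

locale eigen_rep = finite_rep G \<rho> B
  for G :: "('g, 'm) monoid_scheme" and \<rho> :: "'g \<Rightarrow> 'v::real_vector \<Rightarrow> 'v" and B +
  fixes g :: 'g and y :: "nat \<Rightarrow> 'v cfun"
  assumes g: "g \<in> carrier G" and eigen: "eigen_coordinates G \<rho> g y"
begin

abbreviation N :: "'v cx set" where "N \<equiv> cxset (normal_space G \<rho> g)"
abbreviation F :: "'v cx set" where "F \<equiv> cxset (fixed_space \<rho> g)"
abbreviation n :: nat where "n \<equiv> codimension G \<rho> g"
abbreviation e :: "nat \<Rightarrow> 'v cx" where "e \<equiv> normal_vec G \<rho> g y"

lemmas N_closed = cxset_subspace[OF subspace_normal[of g]]
lemmas F_closed = cxset_subspace[OF subspace_fixed[OF g]]

lemma y_covector: "i < n \<Longrightarrow> y i \<in> covectors"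
  and y_fixed: "i < n \<Longrightarrow> z \<in> F \<Longrightarrow> y i z = 0"
  and y_coords: "\<exists>!z. z \<in> N \<and> (\<forall>i<n. y i z = c i)"
  using eigen unfolding eigen_coordinates_def by blast+

lemma y_eq_imp_eq: "z \<in> N \<Longrightarrow> w \<in> N \<Longrightarrow> (\<And>i. i < n \<Longrightarrow> y i z = y i w) \<Longrightarrow> z = w"
  using y_coords[of "\<lambda>i. y i w"] by auto

text \<open>
  The eigen-coordinates vanish on \<open>V\<^sup>g\<close> and separate the points of \<open>N\<^sup>g\<close>.
\<close>

lemma N_inter_F: "z \<in> N \<Longrightarrow> z \<in> F \<Longrightarrow> z = 0"
  by (rule y_eq_imp_eq) (simp_all add: N_closed y_fixed covector_zero y_covector)

lemma e_in_N: "e i \<in> N" and y_e: "j < n \<Longrightarrow> y j (e i) = (if j = i then 1 else 0)"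
proof -
  have "e i \<in> N \<and> (\<forall>j<n. y j (e i) = (if j = i then 1 else 0))"
    unfolding normal_vec_def by (rule theI'[OF y_coords])
  then show "e i \<in> N" "j < n \<Longrightarrow> y j (e i) = (if j = i then 1 else 0)" by auto
qed

lemma N_expand:
  assumes "z \<in> N"
  shows "z = (\<Sum>i<n. cscale (y i z) (e i))"
proof (rule y_eq_imp_eq[OF assms])
  show "(\<Sum>i<n. cscale (y i z) (e i)) \<in> N"
    by (intro cxset_sum subspace_normal N_closed e_in_N)
  fix j assume j: "j < n"
  show "y j z = y j (\<Sum>i<n. cscale (y i z) (e i))"
    using j by (simp add: covector_sum covector_cscale y_covector y_e if_distrib cong: if_cong)
qed

lemma proj_normal_eqI:
  assumes "w \<in> N" "z - w \<in> F"
  shows "proj_normal G \<rho> g z = w"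
  unfolding proj_normal_def
proof (rule the_equality)
  fix w' assume w': "w' \<in> N \<and> z - w' \<in> F"
  have "w' - w \<in> N" by (rule N_closed(3)) (use w' assms in auto)
  have "(z - w) - (z - w') \<in> F" by (rule F_closed(3)) (use w' assms in auto)
  then have "w' - w \<in> F" by (simp add: algebra_simps)
  with N_inter_F[OF \<open>w' - w \<in> N\<close>] show "w' = w" by simp
qed (use assms in simp)

lemma proj_in: "proj_normal G \<rho> g z \<in> N" "proj_fixed G \<rho> g z \<in> F"
proof -
  \<comment> \<open>complexified averaging yields the decomposition\<close>
  define w where "w = z - cxmap (avg g) z"
  have "w \<in> N" using normal_decomposition[OF g] by (simp add: w_def cxmap_def cxset_def mem_Times_iff)
  moreover have "z - w \<in> F" using avg_in_fixed[OF g] by (simp add: w_def cxmap_def cxset_def mem_Times_iff)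
  ultimately show "proj_normal G \<rho> g z \<in> N" "proj_fixed G \<rho> g z \<in> F"
    using proj_normal_eqI[of w z] by (simp_all add: proj_fixed_def)
qed

lemma clinear_proj_fixed: "clinear (proj_fixed G \<rho> g)"
proof -
  have add: "proj_normal G \<rho> g (z + w) = proj_normal G \<rho> g z + proj_normal G \<rho> g w" for z w
  proof (rule proj_normal_eqI)
    have "proj_fixed G \<rho> g z + proj_fixed G \<rho> g w \<in> F" by (intro F_closed proj_in)
    then show "z + w - (proj_normal G \<rho> g z + proj_normal G \<rho> g w) \<in> F"
      by (simp add: proj_fixed_def algebra_simps)
  qed (intro N_closed proj_in)
  have scale: "proj_normal G \<rho> g (cscale c z) = cscale c (proj_normal G \<rho> g z)" for c z
  proof (rule proj_normal_eqI)
    have "cscale c (proj_fixed G \<rho> g z) \<in> F" by (intro F_closed proj_in)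
    then show "cscale c z - cscale c (proj_normal G \<rho> g z) \<in> F"
      by (simp add: proj_fixed_def cx.scale_right_diff_distrib)
  qed (intro N_closed proj_in)
  show ?thesis
    unfolding clinear_def proj_fixed_def by (simp add: add scale cx.scale_right_diff_distrib)
qed

lemma proj_fixed_of_fixed: "p \<in> F \<Longrightarrow> proj_fixed G \<rho> g p = p"
  using proj_normal_eqI[of 0 p] N_closed(1) by (simp add: proj_fixed_def)

lemma rho_inv_diff_in_N: "cxmap (\<rho> (inv\<^bsub>G\<^esub> g)) v - v \<in> N"
  using rho_diff_in_normal[OF g generate.inv[of g "{g}" G]] by (simp add: cxmap_def cxset_def mem_Times_iff)

lemma act_covector: "i < n \<Longrightarrow> act G \<rho> g (y i) \<in> covectors"
  using covector_comp[OF y_covector clinear_rho[of "inv\<^bsub>G\<^esub> g"]] g by (simp add: act_def o_def)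

text \<open>
  No eigenvalue is 1: a coordinate that is invariant under \<open>g\<close> equals its own average, so it is
  determined by its values on \<open>V\<^sup>g\<close>, where it is zero. Hence the denominator of the cocycle is not
  the zero polynomial.
\<close>

lemma y_minus_act_nonzero:
  assumes i: "i < n"
  shows "y i (\<Sum>j<n. e j) - act G \<rho> g (y i) (\<Sum>j<n. e j) \<noteq> 0"
proof -
  obtain c where c: "\<And>z. act G \<rho> g (y i) z = c * y i z"
    using eigen i unfolding eigen_coordinates_def by blast
  have "c \<noteq> 1"
  proof
    assume "c = 1"
    then have "y i (cxmap (\<rho> (inv\<^bsub>G\<^esub> g)) z) = y i z" for z
      using c[of z] by (simp add: act_def)
    note inv = this
    have "y i (cxmap (\<rho> h) z) = y i z" if "h \<in> cyc g" for h z
      using that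
    proof (induction arbitrary: z rule: generate.induct)
      case one
      show ?case by (simp add: cxmap_rho_one)
    next
      case (incl h)
      then show ?case using inv[of "cxmap (\<rho> g) z"] by (simp add: cxmap_rho_inv g)
    next
      case (inv h)
      then show ?case using \<open>\<And>z. y i (cxmap (\<rho> (inv\<^bsub>G\<^esub> g)) z) = y i z\<close> by simp
    next
      case (eng h1 h2)
      have "cxmap (\<rho> (h1 \<otimes>\<^bsub>G\<^esub> h2)) z = cxmap (\<rho> h1) (cxmap (\<rho> h2) z)"
        using eng cyc_subset[OF g] by (intro cxmap_rho_mult) auto
      then show ?case using eng by simp
    qed
    note stable = this
    have "cxmap (avg g) z = cscale (of_real (1 / real (card (cyc g)))) (\<Sum>h\<in>cyc g. cxmap (\<rho> h) z)" for z
      by (simp add: cxmap_def avg_def cscale_def prod_eq_iff fst_sum snd_sum)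
    then have "y i (cxmap (avg g) z) = of_real (1 / real (card (cyc g))) * (\<Sum>h\<in>cyc g. y i z)" for z
      using y_covector[OF i] stable by (simp add: covector_cscale covector_sum)
    then have "y i (cxmap (avg g) z) = y i z" for z
      using card_cyc[OF g] by simp
    moreover have "cxmap (avg g) z \<in> F" for z
      using avg_in_fixed[OF g] by (simp add: cxmap_def cxset_def mem_Times_iff)
    ultimately have "y i (e i) = 0" using y_fixed[OF i, of "cxmap (avg g) (e i)"] by simp
    then show False using y_e[OF i, of i] by simp
  qed
  moreover have "y i (\<Sum>j<n. e j) = 1"
    using i by (simp add: covector_sum y_covector y_e)
  ultimately show ?thesis by (simp add: c)
qed

end

section \<open>The twisted cocycle\<close>

lemma clinear_add_scaled_sum:
  assumes "clinear f" "\<And>i. i \<in> I \<Longrightarrow> \<phi> i \<in> covectors"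
  shows "clinear (\<lambda>p. f p + (\<Sum>i\<in>I. cscale (\<phi> i p) (e i)))"
proof -
  have "(\<Sum>i\<in>I. cscale (\<phi> i (p + q)) (e i)) = (\<Sum>i\<in>I. cscale (\<phi> i p) (e i)) + (\<Sum>i\<in>I. cscale (\<phi> i q) (e i))" for p q
    by (simp add: assms(2) covector_add cx.scale_left_distrib sum.distrib)
  moreover have "(\<Sum>i\<in>I. cscale (\<phi> i (cscale c p)) (e i)) = cscale c (\<Sum>i\<in>I. cscale (\<phi> i p) (e i))" for c p
    by (simp add: assms(2) covector_cscale cx.scale_sum_right)
  ultimately show ?thesis
    using assms(1) by (simp add: clinear_def cx.scale_right_distrib)
qed

context eigen_rep
begin

abbreviation perms :: "(nat \<Rightarrow> nat) set" where "perms \<equiv> {\<sigma>. \<sigma> permutes {..<n}}"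

abbreviation d :: "nat \<Rightarrow> 'v cfun" where "d i \<equiv> (\<lambda>p. y i p - act G \<rho> g (y i) p)"

lemma d_covector: "i < n \<Longrightarrow> d i \<in> covectors"
  using y_covector[of i] act_covector[of i] unfolding covectors_iff by (simp add: algebra_simps)

lemma clinear_zpoint: "clinear (zpoint G \<rho> g y \<sigma> j)"
proof -
  have "clinear (\<lambda>p. proj_fixed G \<rho> g p +
      (\<Sum>i<n. cscale ((if i \<in> \<sigma> ` {..<j} then act G \<rho> g (y i) else y i) p) (e i)))"
    by (rule clinear_add_scaled_sum) (auto intro: clinear_proj_fixed y_covector act_covector)
  then show ?thesis
    by (simp add: zpoint_def[abs_def] if_distrib[of "\<lambda>f. f _"] cong: if_cong)
qed

lemma zpoint_step:
  assumes \<sigma>: "\<sigma> permutes {..<n}" and j: "j < n"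
  shows "zpoint G \<rho> g y \<sigma> j p = zpoint G \<rho> g y \<sigma> (Suc j) p + cscale (d (\<sigma> j) p) (e (\<sigma> j))"
proof -
  let ?c = "\<lambda>j i. if i \<in> \<sigma> ` {..<j} then act G \<rho> g (y i) p else y i p"
  have k: "\<sigma> j < n" using permutes_in_image[OF \<sigma>, of j] j by simp
  have "\<sigma> j \<notin> \<sigma> ` {..<j}"
    using permutes_inj[OF \<sigma>] by (auto simp: inj_eq)
  moreover have "\<sigma> ` {..<Suc j} = insert (\<sigma> j) (\<sigma> ` {..<j})" by (simp add: lessThan_Suc)
  ultimately have c: "?c j (\<sigma> j) = ?c (Suc j) (\<sigma> j) + d (\<sigma> j) p" "\<And>i. i \<noteq> \<sigma> j \<Longrightarrow> ?c j i = ?c (Suc j) i"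
    by auto
  have "(\<Sum>i<n. cscale (?c j i) (e i)) = cscale (?c j (\<sigma> j)) (e (\<sigma> j)) + (\<Sum>i\<in>{..<n} - {\<sigma> j}. cscale (?c j i) (e i))"
    using k by (intro sum.remove) auto
  also have "(\<Sum>i\<in>{..<n} - {\<sigma> j}. cscale (?c j i) (e i)) = (\<Sum>i\<in>{..<n} - {\<sigma> j}. cscale (?c (Suc j) i) (e i))"
    using c(2) by (intro sum.cong) auto
  also have "cscale (?c j (\<sigma> j)) (e (\<sigma> j)) + \<dots> =
     (cscale (?c (Suc j) (\<sigma> j)) (e (\<sigma> j)) + \<dots>) + cscale (d (\<sigma> j) p) (e (\<sigma> j))"
    unfolding c(1) cx.scale_left_distrib by (simp add: algebra_simps)
  also have "cscale (?c (Suc j) (\<sigma> j)) (e (\<sigma> j)) + (\<Sum>i\<in>{..<n} - {\<sigma> j}. cscale (?c (Suc j) i) (e i)) =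
      (\<Sum>i<n. cscale (?c (Suc j) i) (e i))"
    using k by (intro sum.remove[symmetric]) auto
  finally show ?thesis by (simp add: zpoint_def add.assoc)
qed

lemma zpoint_fixed:
  assumes "p \<in> F"
  shows "zpoint G \<rho> g y \<sigma> j p = p"
proof -
  have "act G \<rho> g (y i) p = 0" "y i p = 0" if i: "i < n" for i
  proof -
    show "y i p = 0" by (rule y_fixed[OF i assms])
    moreover obtain c where "\<And>z. act G \<rho> g (y i) z = c * y i z"
      using eigen i unfolding eigen_coordinates_def by blast
    ultimately show "act G \<rho> g (y i) p = 0" by simp
  qed
  then have "(\<Sum>i<n. cscale (if i \<in> \<sigma> ` {..<j} then act G \<rho> g (y i) p else y i p) (e i)) = 0"
    by (intro sum.neutral) auto
  then show ?thesis
    by (simp add: zpoint_def proj_fixed_of_fixed assms)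
qed

text \<open>
  Each permutation contributes every factor of the denominator exactly once, so quotients of the
  individual factors yield the quotient of the sum. Uniqueness of the quotient is cancellation of
  linear forms.
\<close>

lemma Omega_eqI:
  assumes Q: "\<And>\<sigma> j. \<sigma> permutes {..<n} \<Longrightarrow> j < n \<Longrightarrow> Q \<sigma> j \<in> Poly"
    and eq: "\<And>\<sigma> j p. \<sigma> permutes {..<n} \<Longrightarrow> j < n \<Longrightarrow>
       (fs ! j) (zpoint G \<rho> g y \<sigma> j p) - (fs ! j) (zpoint G \<rho> g y \<sigma> (Suc j) p) = d (\<sigma> j) p * Q \<sigma> j p"
  shows "Omega G \<rho> g y fs = (\<lambda>p. 1 / fact n * (\<Sum>\<sigma>\<in>perms. of_int (sign \<sigma>) * (\<Prod>j<n. Q \<sigma> j p)))"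
proof -
  let ?q = "\<lambda>p. 1 / fact n * (\<Sum>\<sigma>\<in>perms. of_int (sign \<sigma>) * (\<Prod>j<n. Q \<sigma> j p))"
  have Poly: "?q \<in> Poly"
    by (intro Poly_cmult Poly_sum Poly_prod Q) auto
  have quot: "?q p * (\<Prod>j<n. d j p) = 1 / fact n * (\<Sum>\<sigma>\<in>perms. of_int (sign \<sigma>) *
      (\<Prod>j<n. (fs ! j) (zpoint G \<rho> g y \<sigma> j p) - (fs ! j) (zpoint G \<rho> g y \<sigma> (Suc j) p)))" for p
  proof -
    have "of_int (sign \<sigma>) * (\<Prod>j<n. Q \<sigma> j p) * (\<Prod>j<n. d j p) = of_int (sign \<sigma>) *
      (\<Prod>j<n. (fs ! j) (zpoint G \<rho> g y \<sigma> j p) - (fs ! j) (zpoint G \<rho> g y \<sigma> (Suc j) p))"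
      if \<sigma>: "\<sigma> permutes {..<n}" for \<sigma>
    proof -
      have "(\<Prod>j<n. d j p) = (\<Prod>j<n. d (\<sigma> j) p)"
        using prod.permute[OF \<sigma>, of "\<lambda>j. d j p"] by (simp add: o_def)
      then have "(\<Prod>j<n. Q \<sigma> j p) * (\<Prod>j<n. d j p) = (\<Prod>j<n. d (\<sigma> j) p * Q \<sigma> j p)"
        by (simp add: prod.distrib mult.commute)
      also have "\<dots> = (\<Prod>j<n. (fs ! j) (zpoint G \<rho> g y \<sigma> j p) - (fs ! j) (zpoint G \<rho> g y \<sigma> (Suc j) p))"
        using eq[OF \<sigma>] by (intro prod.cong) auto
      finally show ?thesis by (simp only: mult.assoc)
    qed
    note * = this
    have "?q p * (\<Prod>j<n. d j p) = 1 / fact n * (\<Sum>\<sigma>\<in>perms. of_int (sign \<sigma>) * (\<Prod>j<n. Q \<sigma> j p) * (\<Prod>j<n. d j p))"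
      by (simp only: mult.assoc sum_distrib_right)
    also have "\<dots> = 1 / fact n * (\<Sum>\<sigma>\<in>perms. of_int (sign \<sigma>) *
      (\<Prod>j<n. (fs ! j) (zpoint G \<rho> g y \<sigma> j p) - (fs ! j) (zpoint G \<rho> g y \<sigma> (Suc j) p)))"
      by (intro arg_cong2[where f = "(*)"] sum.cong refl *) simp
    finally show ?thesis .
  qed
  show ?thesis
    unfolding Omega_def
  proof (rule the_equality)
    show "?q \<in> Poly \<and> (\<forall>p. ?q p * (\<Prod>j<n. d j p) = 1 / fact n * (\<Sum>\<sigma>\<in>perms. of_int (sign \<sigma>) *
      (\<Prod>j<n. (fs ! j) (zpoint G \<rho> g y \<sigma> j p) - (fs ! j) (zpoint G \<rho> g y \<sigma> (Suc j) p))))"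
      using Poly quot by blast
    fix q assume q: "q \<in> Poly \<and> (\<forall>p. q p * (\<Prod>j<n. d j p) = 1 / fact n * (\<Sum>\<sigma>\<in>perms. of_int (sign \<sigma>) *
      (\<Prod>j<n. (fs ! j) (zpoint G \<rho> g y \<sigma> j p) - (fs ! j) (zpoint G \<rho> g y \<sigma> (Suc j) p))))"
    show "q = ?q"
    proof (rule Poly_eq_if_eq_off_hyperplanes[of q ?q "{..<n}" d "\<Sum>j<n. e j"])
      show "q p * (\<Prod>j<n. d j p) = ?q p * (\<Prod>j<n. d j p)" for p
        using q quot[of p] by simp
    qed (use q Poly d_covector y_minus_act_nonzero in auto)
  qed
qed

lemma Lambda_eq:
  assumes "length \<phi>s = n" "set \<phi>s \<subseteq> covectors"
  shows "Lambda G \<rho> g y \<phi>s = 1 / fact n * (\<Sum>\<sigma>\<in>perms. of_int (sign \<sigma>) * (\<Prod>j<n. (\<phi>s ! j) (e (\<sigma> j))))"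
proof -
  have "(\<Prod>j<n. (\<phi>s ! j) (map e [0..<n] ! \<sigma> j)) = (\<Prod>j<n. (\<phi>s ! j) (e (\<sigma> j)))" if "\<sigma> permutes {..<n}" for \<sigma>
    using permutes_in_image[OF that] by (intro prod.cong) auto
  then have "(\<Sum>\<sigma>\<in>perms. of_int (sign \<sigma>) * (\<Prod>j<n. (\<phi>s ! j) (map e [0..<n] ! \<sigma> j))) =
      (\<Sum>\<sigma>\<in>perms. of_int (sign \<sigma>) * (\<Prod>j<n. (\<phi>s ! j) (e (\<sigma> j))))"
    by (intro sum.cong arg_cong2[where f = "(*)"] refl) simp
  then show ?thesis
    using assms by (simp add: Lambda_def wedge_vecs_def)
qed

text \<open>
  On \<open>V\<^sup>g\<close> all the points \<open>(x, z)\<close> coincide with \<open>p\<close>, so every difference quotient is a derivative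
  in a normal direction, and the alternating sum is the value of \<open>\<Lambda>\<^sub>g\<close> on the differentials.
\<close>

lemma Omega_on_fixed_space:
  assumes len: "length fs = n" and fs: "set fs \<subseteq> Poly" and p: "p \<in> F"
  shows "Omega G \<rho> g y fs p = Lambda G \<rho> g y (map (\<lambda>f. differential f p) fs)"
proof -
  let ?z = "zpoint G \<rho> g y"
  define R where "R \<sigma> j q \<longleftrightarrow> q \<in> Poly \<and>
      (\<forall>p. (fs ! j) (?z \<sigma> j p) - (fs ! j) (?z \<sigma> (Suc j) p) = d (\<sigma> j) p * q p) \<and>
      (\<forall>p. ?z \<sigma> j p = ?z \<sigma> (Suc j) p \<longrightarrow> q p = differential (fs ! j) (?z \<sigma> j p) (e (\<sigma> j)))" for \<sigma> j q
  define Q where "Q \<sigma> j = (SOME q. R \<sigma> j q)" for \<sigma> j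
  have R: "R \<sigma> j (Q \<sigma> j)" if "\<sigma> permutes {..<n}" "j < n" for \<sigma> j
  proof -
    have f: "fs ! j \<in> Poly" using that len fs by auto
    have "\<sigma> j < n" using permutes_in_image[OF that(1), of j] that(2) by simp
    then have "d (\<sigma> j) \<in> Poly" by (intro Poly.covec d_covector)
    from divided_difference[OF f clinear_zpoint clinear_zpoint this zpoint_step[OF that]]
    have "\<exists>q. R \<sigma> j q" unfolding R_def by blast
    then show ?thesis unfolding Q_def by (rule someI_ex)
  qed
  then have Q: "\<And>\<sigma> j. \<sigma> permutes {..<n} \<Longrightarrow> j < n \<Longrightarrow> Q \<sigma> j \<in> Poly"
    "\<And>\<sigma> j p. \<sigma> permutes {..<n} \<Longrightarrow> j < n \<Longrightarrow>
       (fs ! j) (?z \<sigma> j p) - (fs ! j) (?z \<sigma> (Suc j) p) = d (\<sigma> j) p * Q \<sigma> j p"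
    "\<And>\<sigma> j p. \<sigma> permutes {..<n} \<Longrightarrow> j < n \<Longrightarrow> ?z \<sigma> j p = ?z \<sigma> (Suc j) p \<Longrightarrow>
       Q \<sigma> j p = differential (fs ! j) (?z \<sigma> j p) (e (\<sigma> j))"
    unfolding R_def by blast+
  have "Omega G \<rho> g y fs p = 1 / fact n * (\<Sum>\<sigma>\<in>perms. of_int (sign \<sigma>) * (\<Prod>j<n. Q \<sigma> j p))"
    by (subst Omega_eqI[of Q fs]) (use Q in auto)
  also have "\<dots> = 1 / fact n * (\<Sum>\<sigma>\<in>perms. of_int (sign \<sigma>) *
      (\<Prod>j<n. (map (\<lambda>f. differential f p) fs ! j) (e (\<sigma> j))))"
    using Q(3)[of _ _ p] len
    by (intro arg_cong2[where f = "(*)"] sum.cong prod.cong refl) (auto simp: zpoint_fixed[OF p])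
  also have "\<dots> = Lambda G \<rho> g y (map (\<lambda>f. differential f p) fs)"
    using len fs by (subst Lambda_eq) (auto intro: differential_in_covectors)
  finally show ?thesis .
qed

text \<open>
  For affine functions the difference quotients are constant, so the formula holds off the fixed
  space too. It is needed there because the inner cochain is differentiated by the outer one.
\<close>

lemma Omega_affine:
  assumes len: "length fs = n" and fs: "\<And>f. f \<in> set fs \<Longrightarrow> \<exists>\<phi>\<in>covectors. \<exists>c. f = (\<lambda>q. \<phi> q - c)"
  shows "Omega G \<rho> g y fs p = Lambda G \<rho> g y (map (\<lambda>f. differential f p) fs)"
proof -
  have aff: "\<exists>\<phi>\<in>covectors. \<exists>c. fs ! j = (\<lambda>q. \<phi> q - c)" if "j < n" for j
    using that len fs by auto
  have "(fs ! j) (zpoint G \<rho> g y \<sigma> j q) - (fs ! j) (zpoint G \<rho> g y \<sigma> (Suc j) q) =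
      d (\<sigma> j) q * differential (fs ! j) p (e (\<sigma> j))"
    if j: "\<sigma> permutes {..<n}" "j < n" for \<sigma> j q
  proof -
    obtain \<phi> c where \<phi>: "\<phi> \<in> covectors" "fs ! j = (\<lambda>q. \<phi> q - c)" using aff[OF j(2)] by blast
    show ?thesis
      unfolding zpoint_step[OF j, of q] \<phi>(2) differential_affine[OF \<phi>(1)]
      by (simp add: covector_add[OF \<phi>(1)] covector_cscale[OF \<phi>(1)])
  qed
  then have "Omega G \<rho> g y fs p = 1 / fact n * (\<Sum>\<sigma>\<in>perms. of_int (sign \<sigma>) * (\<Prod>j<n. differential (fs ! j) p (e (\<sigma> j))))"
    by (subst Omega_eqI[of "\<lambda>\<sigma> j _. differential (fs ! j) p (e (\<sigma> j))" fs]) (auto intro: Poly.const)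
  also have "\<dots> = 1 / fact n * (\<Sum>\<sigma>\<in>perms. of_int (sign \<sigma>) *
      (\<Prod>j<n. (map (\<lambda>f. differential f p) fs ! j) (e (\<sigma> j))))"
    using len by simp
  also have "\<dots> = Lambda G \<rho> g y (map (\<lambda>f. differential f p) fs)"
    using len fs by (subst Lambda_eq) (auto simp: differential_affine dest!: fs)
  finally show ?thesis .
qed

section \<open>The tangential factor of a section\<close>

lemma wedge_add_left: "wedge a b (\<lambda>\<phi>s. X \<phi>s + c * X' \<phi>s) Y \<phi>s = wedge a b X Y \<phi>s + c * wedge a b X' Y \<phi>s"
  by (simp add: wedge_def sum.distrib sum_distrib_left algebra_simps)

lemma sections_eq_0_off_covectors:
  assumes "X \<in> sections G \<rho> g m k" "\<not> (length \<phi>s = k \<and> set \<phi>s \<subseteq> covectors)"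
  shows "X p \<phi>s = 0"
  using assms by induction (auto simp: wedge_vecs_def)

lemma tangent_contract:
  assumes "X \<in> sections G \<rho> g 0 a" and \<phi>s: "length \<phi>s = a" "set \<phi>s \<subseteq> covectors"
  shows "wedge a n (X p) (Lambda G \<rho> g y) (\<phi>s @ map y [0..<n]) = fact a / fact (a + n) * X p \<phi>s"
  using assms(1)
proof induction
  case zero
  show ?case by (simp add: wedge_def)
next
  case (add X c vs ws)
  have ws: "ws = []" and vs: "length vs = a" using add.hyps by auto
  have "wedge a n (wedge_vecs vs) (Lambda G \<rho> g y) (\<phi>s @ map y [0..<n]) =
      wedge_vecs (vs @ map e [0..<n]) (\<phi>s @ map y [0..<n])"
    using wedge_wedge_vecs[of vs "map e [0..<n]"] vs by (simp add: Lambda_def)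
  also have "\<dots> = fact a / fact (a + n) * wedge_vecs vs \<phi>s"
  proof -
    have "w \<in> F" if "w \<in> set vs" for w using add.hyps(4) that by blast
    then have "\<psi> v = 0" if "\<psi> \<in> set (map y [0..<n])" "v \<in> set vs" for \<psi> v
    proof -
      from that(1) obtain i where "i < n" "\<psi> = y i" by auto
      with y_fixed[of i v] \<open>v \<in> set vs \<Longrightarrow> v \<in> F\<close> that(2) show ?thesis by simp
    qed
    moreover have "(map y [0..<n] ! j) (map e [0..<n] ! i) = (if i = j then 1 else 0)" if "i < n" "j < n" for i j
      using that by (auto simp: y_e)
    moreover have "set (map y [0..<n]) \<subseteq> covectors" using y_covector by auto
    ultimately show ?thesis
      using wedge_vecs_contract_dual[of "map y [0..<n]" "map e [0..<n]" \<phi>s vs] \<phi>s vs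
      by (simp only: length_map length_upt diff_zero)
  qed
  finally show ?case
    using add.IH by (simp add: wedge_add_left ws add_divide_distrib distrib_left mult.left_commute)
qed

lemma sum_lessThan_plus: "(\<Sum>r<a + b. f r) = (\<Sum>r<a. f r) + (\<Sum>r<b. f (a + r) :: 'z :: comm_monoid_add)"
  for a b :: nat
  by (induction b) (simp_all add: ac_simps)

text \<open>
  The normal factors of a section are \<open>n\<close> vectors in the \<open>n\<close>-dimensional space \<open>N\<^sup>g\<close>, so their
  wedge product is a multiple of \<open>\<Lambda>\<^sub>g\<close>. The matrix \<open>M\<close> is the identity on the tangential factors
  and expresses the normal ones in the basis dual to the eigen-coordinates.
\<close>

lemma tangent_part_exists:
  assumes "\<xi>g \<in> sections G \<rho> g n k"
  shows "\<exists>X\<in>sections G \<rho> g 0 (k - n). \<forall>p. \<xi>g p = wedge (k - n) n (X p) (Lambda G \<rho> g y)"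
  using assms
proof induction
  case zero
  show ?case by (rule bexI[OF _ sections.zero]) (simp add: wedge_def fun_eq_iff)
next
  case (add Y c vs ws)
  from add.IH obtain X where X: "X \<in> sections G \<rho> g 0 (k - n)" "\<forall>p. Y p = wedge (k - n) n (X p) (Lambda G \<rho> g y)"
    by blast
  have len: "length vs = k - n" "length ws = n" "k = length vs + n" using add.hyps(6,7) by simp_all
  let ?es = "map e [0..<n]"
  \<comment> \<open>column \<open>i\<close> holds the coordinates of the \<open>i\<close>-th vector\<close>
  define M where "M r i = (if i < length vs then (if r = i then 1 else 0)
     else if r < length vs then 0 else y (r - length vs) (ws ! (i - length vs)))" for r i
  define D where "D = det (mat k k (\<lambda>(r, i). M r i))"
  have "(vs @ ws) ! i = (\<Sum>r<k. cscale (M r i) ((vs @ ?es) ! r))" if i: "i < k" for i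
  proof (cases "i < length vs")
    case True
    then have "cscale (M r i) ((vs @ ?es) ! r) = (if r = i then (vs @ ?es) ! r else 0)" for r
      by (simp add: M_def)
    then show ?thesis using True i by (simp add: nth_append)
  next
    case False
    then obtain j where j: "i = length vs + j" "j < n" using i len(3)
      by (intro that[of "i - length vs"]) simp_all
    have "ws ! j \<in> N" using subsetD[OF add.hyps(5) nth_mem[of j ws]] j(2) len(2) by simp
    have "(\<Sum>r<k. cscale (M r i) ((vs @ ?es) ! r)) =
        (\<Sum>r<length vs. cscale (M r i) ((vs @ ?es) ! r)) + (\<Sum>r<n. cscale (M (length vs + r) i) ((vs @ ?es) ! (length vs + r)))"
      unfolding len(3) by (rule sum_lessThan_plus)
    also have "\<dots> = (\<Sum>r<n. cscale (y r (ws ! j)) (e r))"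
      using False j by (simp add: M_def)
    also have "\<dots> = ws ! j" using N_expand[OF \<open>ws ! j \<in> N\<close>] by simp
    finally show ?thesis using j by simp
  qed
  then have wv: "wedge_vecs (vs @ ws) \<phi>s = D * wedge_vecs (vs @ ?es) \<phi>s" for \<phi>s
    unfolding D_def by (intro wedge_vecs_base_change) (use len(2,3) in auto)
  show ?case
  proof (intro bexI[of _ "\<lambda>p \<phi>s. X p \<phi>s + (D * c p) * wedge_vecs (vs @ []) \<phi>s"] allI)
    fix p
    show "(\<lambda>\<phi>s. Y p \<phi>s + c p * wedge_vecs (vs @ ws) \<phi>s) =
      wedge (k - n) n (\<lambda>\<phi>s. X p \<phi>s + (D * c p) * wedge_vecs (vs @ []) \<phi>s) (Lambda G \<rho> g y)"
    proof
      fix \<phi>s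
      have "wedge (k - n) n (wedge_vecs vs) (Lambda G \<rho> g y) = wedge_vecs (vs @ ?es)"
        using wedge_wedge_vecs[of vs ?es] len(1) by (simp add: Lambda_def)
      then show "Y p \<phi>s + c p * wedge_vecs (vs @ ws) \<phi>s =
        wedge (k - n) n (\<lambda>\<phi>s. X p \<phi>s + (D * c p) * wedge_vecs (vs @ []) \<phi>s) (Lambda G \<rho> g y) \<phi>s"
        unfolding wedge_add_left wv X(2)[rule_format] append_Nil2 by (simp only: mult_ac)
    qed
  next
    show "(\<lambda>p \<phi>s. X p \<phi>s + (D * c p) * wedge_vecs (vs @ []) \<phi>s) \<in> sections G \<rho> g 0 (k - n)"
    proof (rule sections.add[OF X(1)])
      show "(\<lambda>p. D * c p) \<in> Poly" by (rule Poly_cmult[OF add.hyps(2)])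
      show "\<forall>p. \<forall>w\<in>N. D * c (p + w) = D * c p" using add.hyps(3) by simp
    qed (use add.hyps(4) len(1) in auto)
  qed
qed

lemma tangent_part:
  assumes "\<xi>g \<in> sections G \<rho> g n k"
  shows "tangent_part G \<rho> g y k \<xi>g \<in> sections G \<rho> g 0 (k - n)"
    and "\<xi>g p = wedge (k - n) n (tangent_part G \<rho> g y k \<xi>g p) (Lambda G \<rho> g y)"
proof -
  let ?P = "\<lambda>X. X \<in> sections G \<rho> g 0 (k - n) \<and> (\<forall>p. \<xi>g p = wedge (k - n) n (X p) (Lambda G \<rho> g y))"
  obtain X where X: "?P X" using tangent_part_exists[OF assms] by blast
  have "X' = X" if X': "?P X'" for X'
  proof (intro ext)
    fix p \<phi>s
    show "X' p \<phi>s = X p \<phi>s"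
    proof (cases "length \<phi>s = k - n \<and> set \<phi>s \<subseteq> covectors")
      case True
      have "wedge (k - n) n (X p) (Lambda G \<rho> g y) = wedge (k - n) n (X' p) (Lambda G \<rho> g y)"
        using conjunct2[OF X, rule_format, of p] conjunct2[OF X', rule_format, of p] by simp
      then have "fact (k - n) / fact (k - n + n) * X p \<phi>s = fact (k - n) / fact (k - n + n) * X' p \<phi>s"
        using tangent_contract[of X "k - n" \<phi>s p] tangent_contract[of X' "k - n" \<phi>s p] X X' True by simp
      then show ?thesis by (simp del: of_nat_fact)
    next
      case False
      then show ?thesis using X X'
        by (simp add: sections_eq_0_off_covectors[of X 0 "k - n"] sections_eq_0_off_covectors[of X' 0 "k - n"])
    qed
  qed
  with X have "?P (tangent_part G \<rho> g y k \<xi>g)"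
    unfolding tangent_part_def by (intro theI[of ?P X])
  then show "tangent_part G \<rho> g y k \<xi>g \<in> sections G \<rho> g 0 (k - n)"
    and "\<xi>g p = wedge (k - n) n (tangent_part G \<rho> g y k \<xi>g p) (Lambda G \<rho> g y)" by auto
qed

end

section \<open>Polynomial tensor fields\<close>

text \<open>
  A polynomial field of \<open>k\<close>-tensors, not necessarily alternating, written as a finite sum of pure
  tensors with polynomial coefficients; \<open>rs\<close> is the list of coefficients and vectors. The
  predicate \<open>K\<close> records a property of the vectors of every summand. Values on other lists than \<open>k\<close>
  covectors are left open.
\<close>

definition pure_sum :: "('v::real_vector cx list \<Rightarrow> bool) \<Rightarrow> nat \<Rightarrow> ('v cfun \<times> 'v cx list) list \<Rightarrow> 'v mfield \<Rightarrow> bool" where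
  "pure_sum K k rs T \<longleftrightarrow>
     (\<forall>(a, vs)\<in>set rs. a \<in> Poly \<and> length vs = k \<and> K vs) \<and>
     (\<forall>p \<phi>s. set \<phi>s \<subseteq> covectors \<longrightarrow> length \<phi>s = k \<longrightarrow> T p \<phi>s = (\<Sum>(a, vs)\<leftarrow>rs. a p * tensor_eval \<phi>s vs))"

lemma pure_sumD:
  assumes "pure_sum K k rs T"
  shows "(a, vs) \<in> set rs \<Longrightarrow> a \<in> Poly" "(a, vs) \<in> set rs \<Longrightarrow> length vs = k" "(a, vs) \<in> set rs \<Longrightarrow> K vs"
    "set \<phi>s \<subseteq> covectors \<Longrightarrow> length \<phi>s = k \<Longrightarrow> T p \<phi>s = (\<Sum>(a, vs)\<leftarrow>rs. a p * tensor_eval \<phi>s vs)"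
  using assms unfolding pure_sum_def by blast+

definition tensor_field :: "('v::real_vector cx list \<Rightarrow> bool) \<Rightarrow> nat \<Rightarrow> 'v mfield \<Rightarrow> bool" where
  "tensor_field K k T \<longleftrightarrow> (\<exists>rs. pure_sum K k rs T)"

lemma tensor_field_cong:
  assumes "tensor_field K k T"
    and "\<And>p \<phi>s. set \<phi>s \<subseteq> covectors \<Longrightarrow> length \<phi>s = k \<Longrightarrow> T' p \<phi>s = T p \<phi>s"
  shows "tensor_field K k T'"
  using assms unfolding tensor_field_def pure_sum_def by fastforce

lemma tensor_field_zero: "tensor_field K k (\<lambda>p \<phi>s. 0)"
  unfolding tensor_field_def pure_sum_def by (rule exI[of _ "[]"]) simp

lemma tensor_field_pure:
  assumes "a \<in> Poly" "length vs = k" "K vs"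
  shows "tensor_field K k (\<lambda>p \<phi>s. a p * tensor_eval \<phi>s vs)"
  unfolding tensor_field_def pure_sum_def by (rule exI[of _ "[(a, vs)]"]) (use assms in simp)

lemma tensor_field_add:
  assumes "tensor_field K k T" "tensor_field K k T'"
  shows "tensor_field K k (\<lambda>p \<phi>s. T p \<phi>s + T' p \<phi>s)"
proof -
  from assms obtain rs rs' where "pure_sum K k rs T" "pure_sum K k rs' T'"
    unfolding tensor_field_def by blast
  then have "pure_sum K k (rs @ rs') (\<lambda>p \<phi>s. T p \<phi>s + T' p \<phi>s)"
    unfolding pure_sum_def by auto
  then show ?thesis unfolding tensor_field_def by blast
qed

lemma tensor_field_sum:
  assumes "\<And>i. i \<in> I \<Longrightarrow> tensor_field K k (T i)"
  shows "tensor_field K k (\<lambda>p \<phi>s. \<Sum>i\<in>I. T i p \<phi>s)"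
  using assms by (induction I rule: infinite_finite_induct) (simp_all add: tensor_field_zero tensor_field_add)

lemma tensor_field_cmult:
  assumes "tensor_field K k T"
  shows "tensor_field K k (\<lambda>p \<phi>s. c * T p \<phi>s)"
proof -
  from assms obtain rs where rs: "pure_sum K k rs T" unfolding tensor_field_def by blast
  have "pure_sum K k (map (\<lambda>(a, vs). (\<lambda>p. c * a p, vs)) rs) (\<lambda>p \<phi>s. c * T p \<phi>s)"
    unfolding pure_sum_def
  proof (intro conjI allI impI)
    show "\<forall>(a, vs)\<in>set (map (\<lambda>(a, vs). (\<lambda>p. c * a p, vs)) rs). a \<in> Poly \<and> length vs = k \<and> K vs"
      using pure_sumD[OF rs] by (auto intro: Poly_cmult)
    fix p and \<phi>s :: "'a cfun list" assume "set \<phi>s \<subseteq> covectors" "length \<phi>s = k"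
    then have "T p \<phi>s = (\<Sum>(a, vs)\<leftarrow>rs. a p * tensor_eval \<phi>s vs)" by (rule pure_sumD(4)[OF rs])
    then show "c * T p \<phi>s = (\<Sum>(a, vs)\<leftarrow>map (\<lambda>(a, vs). (\<lambda>p. c * a p, vs)) rs. a p * tensor_eval \<phi>s vs)"
      by (simp add: sum_list_const_mult[symmetric] case_prod_unfold o_def mult.assoc)
  qed
  then show ?thesis unfolding tensor_field_def by blast
qed

lemma tensor_field_pullback:
  assumes "tensor_field K k T" "clinear M" "clinear M'" and K: "\<And>vs. K vs \<Longrightarrow> K' (map M' vs)"
  shows "tensor_field K' k (\<lambda>p \<phi>s. T (M p) (map (\<lambda>\<phi>. \<phi> \<circ> M') \<phi>s))"
proof -
  from assms obtain rs where rs: "pure_sum K k rs T" unfolding tensor_field_def by blast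
  have "pure_sum K' k (map (\<lambda>(a, vs). (\<lambda>p. a (M p), map M' vs)) rs) (\<lambda>p \<phi>s. T (M p) (map (\<lambda>\<phi>. \<phi> \<circ> M') \<phi>s))"
    unfolding pure_sum_def
  proof (intro conjI allI impI)
    show "\<forall>(a, vs)\<in>set (map (\<lambda>(a, vs). (\<lambda>p. a (M p), map M' vs)) rs). a \<in> Poly \<and> length vs = k \<and> K' vs"
      using pure_sumD[OF rs] K by (auto intro: Poly_comp[OF _ assms(2)])
    fix p and \<phi>s :: "'a cfun list" assume "set \<phi>s \<subseteq> covectors" "length \<phi>s = k"
    then have "T (M p) (map (\<lambda>\<phi>. \<phi> \<circ> M') \<phi>s) = (\<Sum>(a, vs)\<leftarrow>rs. a (M p) * tensor_eval (map (\<lambda>\<phi>. \<phi> \<circ> M') \<phi>s) vs)"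
      by (intro pure_sumD(4)[OF rs]) (auto intro: covector_comp[OF _ assms(3)])
    then show "T (M p) (map (\<lambda>\<phi>. \<phi> \<circ> M') \<phi>s) =
        (\<Sum>(a, vs)\<leftarrow>map (\<lambda>(a, vs). (\<lambda>p. a (M p), map M' vs)) rs. a p * tensor_eval \<phi>s vs)"
      by (simp add: case_prod_unfold o_def tensor_eval_map[unfolded o_def])
  qed
  then show ?thesis unfolding tensor_field_def by blast
qed

lemma Poly_sum_list: "(\<And>x. x \<in> set xs \<Longrightarrow> f x \<in> Poly) \<Longrightarrow> (\<lambda>p. \<Sum>x\<leftarrow>xs. f x p) \<in> Poly"
  by (induction xs) (auto intro: Poly.intros)

lemma differential_sum_list:
  "(\<And>x. x \<in> set xs \<Longrightarrow> f x \<in> Poly) \<Longrightarrow>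
    differential (\<lambda>q. \<Sum>x\<leftarrow>xs. f x q) p = (\<lambda>v. \<Sum>x\<leftarrow>xs. differential (f x) p v)"
  by (induction xs) (auto simp: differential_add Poly_sum_list)

lemma tensor_field_Poly:
  assumes "tensor_field K k T" "set \<phi>s \<subseteq> covectors" "length \<phi>s = k"
  shows "(\<lambda>p. T p \<phi>s) \<in> Poly"
proof -
  from assms obtain rs where rs: "pure_sum K k rs T" unfolding tensor_field_def by blast
  have "(\<lambda>p. T p \<phi>s) = (\<lambda>p. \<Sum>x\<leftarrow>rs. (case x of (a, vs) \<Rightarrow> \<lambda>p. a p * tensor_eval \<phi>s vs) p)"
    using pure_sumD(4)[OF rs assms(2,3)] by (simp add: case_prod_unfold)
  also have "\<dots> \<in> Poly"
    using pure_sumD(1)[OF rs] by (intro Poly_sum_list) (auto intro!: Poly.mult Poly.const)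
  finally show ?thesis .
qed

lemma pure_sum_differential:
  assumes rs: "pure_sum K k rs T" and \<phi>s: "set \<phi>s \<subseteq> covectors" "length \<phi>s = k"
  shows "differential (\<lambda>q. T q \<phi>s) p v = (\<Sum>(a, vs)\<leftarrow>rs. differential a p v * tensor_eval \<phi>s vs)"
proof -
  let ?f = "\<lambda>x. case x of (a, vs) \<Rightarrow> \<lambda>p. tensor_eval \<phi>s vs * a p"
  have "differential (\<lambda>q. T q \<phi>s) p v = differential (\<lambda>q. \<Sum>x\<leftarrow>rs. ?f x q) p v"
    using pure_sumD(4)[OF rs \<phi>s] by (simp add: case_prod_unfold mult.commute)
  also have "\<dots> = (\<Sum>x\<leftarrow>rs. differential (?f x) p v)"
    using pure_sumD(1)[OF rs] by (subst differential_sum_list) (auto intro!: Poly_cmult)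
  also have "\<dots> = (\<Sum>(a, vs)\<leftarrow>rs. tensor_eval \<phi>s vs * differential a p v)"
    using pure_sumD(1)[OF rs]
    by (intro arg_cong[of _ _ sum_list] map_cong refl) (auto simp: differential_cmult)
  finally show ?thesis by (simp only: mult.commute)
qed

lemma split_at_nth: "s < length vs \<Longrightarrow> vs = take s vs @ [vs ! s] @ drop (Suc s) vs"
  by (simp add: id_take_nth_drop[symmetric])

lemma tensor_field_slot_linear:
  assumes "tensor_field K k T" and "length us + 1 + length us' = k"
    and cov: "set us \<subseteq> covectors" "set us' \<subseteq> covectors" "\<And>i. i \<in> I \<Longrightarrow> \<phi> i \<in> covectors"
  shows "T p (us @ [\<lambda>v. \<Sum>i\<in>I. c i * \<phi> i v] @ us') = (\<Sum>i\<in>I. c i * T p (us @ [\<phi> i] @ us'))"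
proof -
  from assms obtain rs where rs: "pure_sum K k rs T" unfolding tensor_field_def by blast
  have comb: "(\<lambda>v. \<Sum>i\<in>I. c i * \<phi> i v) \<in> covectors"
    using cov(3) unfolding covectors_iff
    by (simp add: sum.distrib algebra_simps sum_distrib_left)
  let ?s = "length us"
  have tensor_eval: "tensor_eval (us @ [\<psi>] @ us') vs = tensor_eval us (take ?s vs) * \<psi> (vs ! ?s) * tensor_eval us' (drop (Suc ?s) vs)"
    if "length vs = k" for \<psi> vs
  proof -
    have "vs = take ?s vs @ [vs ! ?s] @ drop (Suc ?s) vs" using that assms(2) by (intro split_at_nth) simp
    then have "tensor_eval (us @ [\<psi>] @ us') vs = tensor_eval (us @ [\<psi>] @ us') (take ?s vs @ [vs ! ?s] @ drop (Suc ?s) vs)"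
      by simp
    then show ?thesis using that assms(2) by (simp add: tensor_eval_append)
  qed
  have "T p (us @ [\<lambda>v. \<Sum>i\<in>I. c i * \<phi> i v] @ us') =
      (\<Sum>(a, vs)\<leftarrow>rs. a p * tensor_eval (us @ [\<lambda>v. \<Sum>i\<in>I. c i * \<phi> i v] @ us') vs)"
    by (rule pure_sumD(4)[OF rs]) (use cov comb assms(2) in auto)
  also have "\<dots> = (\<Sum>(a, vs)\<leftarrow>rs. \<Sum>i\<in>I. c i * (a p * tensor_eval (us @ [\<phi> i] @ us') vs))"
    using pure_sumD(2)[OF rs]
    by (intro arg_cong[of _ _ sum_list] map_cong refl)
      (auto simp: tensor_eval sum_distrib_left sum_distrib_right mult_ac simp del: append_Cons)
  also have "\<dots> = (\<Sum>i\<in>I. c i * (\<Sum>(a, vs)\<leftarrow>rs. a p * tensor_eval (us @ [\<phi> i] @ us') vs))"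
    by (induction rs) (auto simp: sum.distrib distrib_left)
  also have "\<dots> = (\<Sum>i\<in>I. c i * T p (us @ [\<phi> i] @ us'))"
    by (intro sum.cong arg_cong2[where f = "(*)"] refl pure_sumD(4)[OF rs, symmetric]) (use cov assms(2) in auto)
  finally show ?thesis .
qed

section \<open>Removing the twist\<close>

text \<open>
  Expanding both tensors into pure tensors. The differential of the inner value acts on the
  coefficients \<open>b\<close> only, and the vectors \<open>ws\<close> of the inner tensor take the place of the vector
  \<open>vs ! s\<close>.
\<close>

lemma Alt_insert_twisted:
  assumes rs: "pure_sum K k rs T" and rs': "pure_sum K' l rs' H" and M: "clinear M"
    and len: "length xs + 1 = k + l" and cov: "set xs \<subseteq> covectors" and s: "s < k"
  shows "Alt (\<lambda>ys. T p (take s ys @ [differential (\<lambda>q. H q (take l (drop s ys))) p] @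
             map (\<lambda>\<phi>. \<phi> \<circ> M) (drop (s + l) ys))) xs =
    (\<Sum>(a, vs)\<leftarrow>rs. \<Sum>(b, ws)\<leftarrow>rs'. a p * differential b p (vs ! s) *
       Alt (\<lambda>ys. tensor_eval ys ((take s vs @ ws) @ map M (drop (Suc s) vs))) xs)"
proof -
  have "T p (take s ys @ [differential (\<lambda>q. H q (take l (drop s ys))) p] @ map (\<lambda>\<phi>. \<phi> \<circ> M) (drop (s + l) ys)) =
    (\<Sum>(a, vs)\<leftarrow>rs. \<Sum>(b, ws)\<leftarrow>rs'. a p * differential b p (vs ! s) * tensor_eval ys ((take s vs @ ws) @ map M (drop (Suc s) vs)))"
    if ys: "length ys = length xs" "set ys = set xs" for ys
  proof -
    have "s + l + (k - Suc s) = length ys" using ys len s by simp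
    then obtain us blk us' where dec: "ys = us @ blk @ us'" "length us = s" "length blk = l" "length us' = k - Suc s"
      by (rule split_list_at)
    have c: "set us \<subseteq> covectors" "set blk \<subseteq> covectors" "set us' \<subseteq> covectors" using dec ys cov by auto
    define D where "D = differential (\<lambda>q. H q blk) p"
    have "(\<lambda>q. H q blk) \<in> Poly"
      using rs' c dec by (intro tensor_field_Poly[of K' l]) (auto simp: tensor_field_def)
    then have D: "D \<in> covectors" unfolding D_def by (rule differential_in_covectors)
    have "T p (us @ [D] @ map (\<lambda>\<phi>. \<phi> \<circ> M) us') =
        (\<Sum>(a, vs)\<leftarrow>rs. a p * tensor_eval (us @ [D] @ map (\<lambda>\<phi>. \<phi> \<circ> M) us') vs)"
      by (rule pure_sumD(4)[OF rs]) (use c D dec s in \<open>auto intro: covector_comp[OF _ M]\<close>)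
    also have "\<dots> = (\<Sum>(a, vs)\<leftarrow>rs. \<Sum>(b, ws)\<leftarrow>rs'. a p * differential b p (vs ! s) * tensor_eval ys ((take s vs @ ws) @ map M (drop (Suc s) vs)))"
    proof (intro arg_cong[of _ _ sum_list] map_cong refl, clarify)
      fix a vs assume "(a, vs) \<in> set rs"
      then have lv: "length vs = k" by (rule pure_sumD(2)[OF rs])
      have "tensor_eval (us @ [D] @ map (\<lambda>\<phi>. \<phi> \<circ> M) us') (take s vs @ [vs ! s] @ drop (Suc s) vs) =
          tensor_eval us (take s vs) * (D (vs ! s) * tensor_eval us' (map M (drop (Suc s) vs)))"
        using dec lv s by (simp add: tensor_eval_append tensor_eval_map)
      also have "take s vs @ [vs ! s] @ drop (Suc s) vs = vs"
        using split_at_nth[of s vs] lv s by simp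
      also have "D (vs ! s) = (\<Sum>(b, ws)\<leftarrow>rs'. differential b p (vs ! s) * tensor_eval blk ws)"
        unfolding D_def by (rule pure_sum_differential[OF rs' c(2) dec(3)])
      finally have E: "tensor_eval (us @ [D] @ map (\<lambda>\<phi>. \<phi> \<circ> M) us') vs = tensor_eval us (take s vs) *
          ((\<Sum>(b, ws)\<leftarrow>rs'. differential b p (vs ! s) * tensor_eval blk ws) * tensor_eval us' (map M (drop (Suc s) vs)))" .
      have "a p * tensor_eval (us @ [D] @ map (\<lambda>\<phi>. \<phi> \<circ> M) us') vs =
          (\<Sum>(b, ws)\<leftarrow>rs'. a p * differential b p (vs ! s) * (tensor_eval us (take s vs) * tensor_eval blk ws * tensor_eval us' (map M (drop (Suc s) vs))))"
        unfolding E
        by (simp add: sum_list_const_mult[symmetric] sum_list_mult_const[symmetric] case_prod_unfold mult_ac)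
      also have "\<dots> = (\<Sum>(b, ws)\<leftarrow>rs'. a p * differential b p (vs ! s) * tensor_eval ys ((take s vs @ ws) @ map M (drop (Suc s) vs)))"
        using pure_sumD(2)[OF rs'] dec lv s
        by (intro arg_cong[of _ _ sum_list] map_cong refl) (auto simp: tensor_eval_append mult_ac)
      finally show "a p * tensor_eval (us @ [D] @ map (\<lambda>\<phi>. \<phi> \<circ> M) us') vs = \<dots>" .
    qed
    finally show ?thesis using dec by (simp add: D_def)
  qed
  then have "Alt (\<lambda>ys. T p (take s ys @ [differential (\<lambda>q. H q (take l (drop s ys))) p] @
             map (\<lambda>\<phi>. \<phi> \<circ> M) (drop (s + l) ys))) xs =
    Alt (\<lambda>ys. \<Sum>(a, vs)\<leftarrow>rs. \<Sum>(b, ws)\<leftarrow>rs'. a p * differential b p (vs ! s) * tensor_eval ys ((take s vs @ ws) @ map M (drop (Suc s) vs))) xs"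
    by (rule Alt_cong)
  also have "\<dots> = (\<Sum>(a, vs)\<leftarrow>rs. \<Sum>(b, ws)\<leftarrow>rs'. a p * differential b p (vs ! s) *
       Alt (\<lambda>ys. tensor_eval ys ((take s vs @ ws) @ map M (drop (Suc s) vs))) xs)"
    unfolding case_prod_unfold Alt_sum_list Alt_mult ..
  finally show ?thesis .
qed

text \<open>
  Each pure summand has the vectors \<open>ws\<close> before the vectors moved by \<open>M\<close>, and \<open>M\<close> is the identity
  modulo their span; so its antisymmetrisation is not affected by \<open>M\<close>.
\<close>

lemma Alt_untwist:
  assumes T: "tensor_field K k T" and H: "tensor_field K' l H" and M: "clinear M"
    and K': "\<And>ws v. K' ws \<Longrightarrow> M v - v \<in> cx.span (set ws)"
    and len: "length xs + 1 = k + l" and cov: "set xs \<subseteq> covectors" and s: "s < k"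
  shows "Alt (\<lambda>ys. T p (take s ys @ [differential (\<lambda>q. H q (take l (drop s ys))) p] @
             map (\<lambda>\<phi>. \<phi> \<circ> M) (drop (s + l) ys))) xs =
    Alt (\<lambda>ys. T p (insert_block l (\<lambda>blk. differential (\<lambda>q. H q blk) p) s ys)) xs"
proof -
  from T H obtain rs rs' where rs: "pure_sum K k rs T" and rs': "pure_sum K' l rs' H"
    unfolding tensor_field_def by blast
  have id: "clinear (\<lambda>v. v)" by (simp add: clinear_def)
  have "(\<lambda>\<phi>. \<phi> \<circ> (\<lambda>v. v)) = (\<lambda>\<phi>. \<phi> :: 'a cfun)" by (simp add: o_def)
  note untwisted = Alt_insert_twisted[OF rs rs' id len cov s, of p, unfolded this list.map_ident]
  have "Alt (\<lambda>ys. tensor_eval ys ((take s vs @ ws) @ map M (drop (Suc s) vs))) xs =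
      Alt (\<lambda>ys. tensor_eval ys ((take s vs @ ws) @ drop (Suc s) vs)) xs"
    if "(a, vs) \<in> set rs" "(b, ws) \<in> set rs'" for a vs b ws
  proof (rule Alt_tensor_eval_map_mod_span[OF cov])
    show "length xs = length (take s vs @ ws) + length (drop (Suc s) vs)"
      using pure_sumD(2)[OF rs that(1)] pure_sumD(2)[OF rs' that(2)] len s by simp
    show "M v - v \<in> cx.span (set (take s vs @ ws))" for v
      using K'[OF pure_sumD(3)[OF rs' that(2)], of v] cx.span_mono[of "set ws" "set (take s vs @ ws)"] by auto
  qed
  then show ?thesis
    unfolding insert_block_def Alt_insert_twisted[OF rs rs' M len cov s] untwisted
    by (auto intro!: arg_cong[of _ _ sum_list] map_cong)
qed

section \<open>The cochain T1 as a tensor field\<close>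

text \<open>
  The tensor product \<open>X\<^sub>g \<otimes> \<Lambda>\<^sub>g\<close>, without antisymmetrisation.
\<close>

definition T1_tensor ::
  "('g, 'm) monoid_scheme \<Rightarrow> ('g \<Rightarrow> 'v::real_vector \<Rightarrow> 'v) \<Rightarrow> 'g \<Rightarrow> (nat \<Rightarrow> 'v cfun) \<Rightarrow> nat \<Rightarrow> 'v mfield \<Rightarrow> 'v mfield"
  where
  "T1_tensor G \<rho> g y k \<xi>g p \<phi>s =
     tangent_part G \<rho> g y k \<xi>g p (take (k - codimension G \<rho> g) \<phi>s) *
     Lambda G \<rho> g y (drop (k - codimension G \<rho> g) \<phi>s)"

context eigen_rep
begin

text \<open>
  If \<open>k < l(g)\<close> the only section is zero. The truncated difference \<open>k - l(g)\<close> is then 0, and the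
  tangential factor is a function, which has to be shown to be zero as well.
\<close>

lemma section_low_degree_zero:
  assumes "\<xi>g \<in> sections G \<rho> g n k" "k < n"
  shows "\<xi>g p \<phi>s = 0" "tangent_part G \<rho> g y k \<xi>g p \<phi>s = 0"
proof -
  have zero: "\<xi>g q \<psi>s = 0" for q \<psi>s
    using assms by induction auto
  show "\<xi>g p \<phi>s = 0" by (rule zero)
  note tp = tangent_part[OF assms(1)]
  show "tangent_part G \<rho> g y k \<xi>g p \<phi>s = 0"
  proof (cases "length \<phi>s = 0 \<and> set \<phi>s \<subseteq> covectors")
    case True
    have "tangent_part G \<rho> g y k \<xi>g \<in> sections G \<rho> g 0 0"
      using tp(1) assms(2) by simp
    from tangent_contract[OF this, of \<phi>s p] True
    have "wedge 0 n (tangent_part G \<rho> g y k \<xi>g p) (Lambda G \<rho> g y) (\<phi>s @ map y [0..<n]) =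
        fact 0 / fact (0 + n) * tangent_part G \<rho> g y k \<xi>g p \<phi>s" by simp
    moreover have "wedge 0 n (tangent_part G \<rho> g y k \<xi>g p) (Lambda G \<rho> g y) (\<phi>s @ map y [0..<n]) = 0"
      using tp(2)[of p] zero[of p] assms(2) by (simp add: fun_eq_iff)
    ultimately show ?thesis by simp
  next
    case False
    then show ?thesis
      using sections_eq_0_off_covectors[OF tp(1), of \<phi>s p] assms(2) by simp
  qed
qed

lemma T1_component_on_fixed_space:
  assumes "\<xi>g \<in> sections G \<rho> g n k" "length fs = k" "set fs \<subseteq> Poly" "p \<in> F"
  shows "T1_component G \<rho> g y k \<xi>g fs p = T1_tensor G \<rho> g y k \<xi>g p (map (\<lambda>f. differential f p) fs)"
proof (cases "k < n")
  case True
  then show ?thesis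
    by (simp add: T1_component_def T1_tensor_def mf_apply_def section_low_degree_zero(2)[OF assms(1)])
next
  case False
  have "Omega G \<rho> g y (drop (k - n) fs) p = Lambda G \<rho> g y (map (\<lambda>f. differential f p) (drop (k - n) fs))"
    by (rule Omega_on_fixed_space) (use False assms set_drop_subset[of "k - n" fs] in auto)
  then show ?thesis
    by (simp add: T1_component_def T1_tensor_def mf_apply_def take_map drop_map)
qed

lemma T1_component_affine:
  assumes "\<xi>g \<in> sections G \<rho> g n k" "length fs = k"
    and "\<And>f. f \<in> set fs \<Longrightarrow> \<exists>\<phi>\<in>covectors. \<exists>c. f = (\<lambda>q. \<phi> q - c)"
  shows "T1_component G \<rho> g y k \<xi>g fs p = T1_tensor G \<rho> g y k \<xi>g p (map (\<lambda>f. differential f p) fs)"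
proof (cases "k < n")
  case True
  then show ?thesis
    by (simp add: T1_component_def T1_tensor_def mf_apply_def section_low_degree_zero(2)[OF assms(1)])
next
  case False
  have "Omega G \<rho> g y (drop (k - n) fs) p = Lambda G \<rho> g y (map (\<lambda>f. differential f p) (drop (k - n) fs))"
    using False assms(2) by (intro Omega_affine assms(3) in_set_dropD[of _ "k - n" fs]) simp_all
  then show ?thesis
    by (simp add: T1_component_def T1_tensor_def mf_apply_def take_map drop_map)
qed

lemma Alt_T1_tensor:
  assumes "\<xi>g \<in> sections G \<rho> g n k" "length \<phi>s = k"
  shows "Alt (T1_tensor G \<rho> g y k \<xi>g p) \<phi>s = fact k * \<xi>g p \<phi>s"
proof (cases "k < n")
  case True
  then have "T1_tensor G \<rho> g y k \<xi>g p = (\<lambda>_. 0)"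
    by (simp add: fun_eq_iff T1_tensor_def section_low_degree_zero(2)[OF assms(1)])
  then show ?thesis using True by (simp add: Alt_zero section_low_degree_zero(1)[OF assms(1)])
next
  case False
  have "\<xi>g p \<phi>s = wedge (k - n) n (tangent_part G \<rho> g y k \<xi>g p) (Lambda G \<rho> g y) \<phi>s"
    by (simp flip: tangent_part(2)[OF assms(1)])
  also have "\<dots> = 1 / fact k * Alt (T1_tensor G \<rho> g y k \<xi>g p) \<phi>s"
    using False assms(2) by (simp add: wedge_eq_Alt T1_tensor_def[abs_def])
  finally show ?thesis by simp
qed

text \<open>
  After expansion the last \<open>n\<close> vectors of every pure summand are a permutation of the basis \<open>e\<close> of
  \<open>N\<^sup>g\<close>. This is the property that is used to remove the twist.
\<close>

lemma tangent_tensor_Lambda: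
  assumes "X \<in> sections G \<rho> g 0 a"
  shows "tensor_field (\<lambda>vs. e ` {..<n} \<subseteq> set vs) (a + n) (\<lambda>p \<phi>s. X p (take a \<phi>s) * Lambda G \<rho> g y (drop a \<phi>s))"
  using assms
proof induction
  case zero
  show ?case by (simp add: tensor_field_zero)
next
  case (add X c vs ws)
  have vs: "length vs = a" "ws = []" using add.hyps by auto
  let ?es = "map e [0..<n]"
  let ?w = "\<lambda>p \<phi>s. \<Sum>\<sigma> | \<sigma> permutes {..<a}. \<Sum>\<tau> | \<tau> permutes {..<n}.
      (of_int (sign \<sigma>) / fact a * (of_int (sign \<tau>) / fact n)) * (c p * tensor_eval \<phi>s (permute_list \<sigma> vs @ permute_list \<tau> ?es))"
  have "tensor_field (\<lambda>vs. e ` {..<n} \<subseteq> set vs) (a + n) ?w"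
  proof (intro tensor_field_sum tensor_field_cmult tensor_field_pure add.hyps(2))
    fix \<sigma> \<tau> assume "\<tau> \<in> perms"
    then show "e ` {..<n} \<subseteq> set (permute_list \<sigma> vs @ permute_list \<tau> ?es)"
      by (auto simp: set_permute_list[of \<tau> ?es])
  qed (simp add: vs)
  then have "tensor_field (\<lambda>vs. e ` {..<n} \<subseteq> set vs) (a + n)
      (\<lambda>p \<phi>s. X p (take a \<phi>s) * Lambda G \<rho> g y (drop a \<phi>s) + ?w p \<phi>s)"
    by (rule tensor_field_add[OF add.IH])
  then show ?case
  proof (rule tensor_field_cong)
    fix p and \<phi>s :: "'v cfun list" assume \<phi>s: "set \<phi>s \<subseteq> covectors" "length \<phi>s = a + n"
    have cov: "set (take a \<phi>s) \<subseteq> covectors" "set (drop a \<phi>s) \<subseteq> covectors"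
      using \<phi>s(1) set_take_subset[of a \<phi>s] set_drop_subset[of a \<phi>s] by auto
    have expand: "wedge_vecs vs (take a \<phi>s) =
        (\<Sum>\<sigma> | \<sigma> permutes {..<a}. of_int (sign \<sigma>) / fact a * tensor_eval (take a \<phi>s) (permute_list \<sigma> vs))"
      "Lambda G \<rho> g y (drop a \<phi>s) =
        (\<Sum>\<tau> | \<tau> permutes {..<n}. of_int (sign \<tau>) / fact n * tensor_eval (drop a \<phi>s) (permute_list \<tau> ?es))"
      using wedge_vecs_expand[OF cov(1), of vs] wedge_vecs_expand[OF cov(2), of ?es] \<phi>s vs
      by (simp_all add: Lambda_def)
    have "c p * (wedge_vecs vs (take a \<phi>s) * Lambda G \<rho> g y (drop a \<phi>s)) =
      (\<Sum>\<sigma> | \<sigma> permutes {..<a}. \<Sum>\<tau> | \<tau> permutes {..<n}.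
        c p * ((of_int (sign \<sigma>) / fact a * tensor_eval (take a \<phi>s) (permute_list \<sigma> vs)) *
        (of_int (sign \<tau>) / fact n * tensor_eval (drop a \<phi>s) (permute_list \<tau> ?es))))"
      unfolding expand by (simp only: sum_product, simp only: sum_distrib_left)
    also have "\<dots> = ?w p \<phi>s"
    proof (intro sum.cong refl)
      fix \<sigma> \<tau>
      have "tensor_eval (take a \<phi>s @ drop a \<phi>s) (permute_list \<sigma> vs @ permute_list \<tau> ?es) =
          tensor_eval (take a \<phi>s) (permute_list \<sigma> vs) * tensor_eval (drop a \<phi>s) (permute_list \<tau> ?es)"
        using \<phi>s vs by (intro tensor_eval_append) simp
      then show "c p * ((of_int (sign \<sigma>) / fact a * tensor_eval (take a \<phi>s) (permute_list \<sigma> vs)) *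
        (of_int (sign \<tau>) / fact n * tensor_eval (drop a \<phi>s) (permute_list \<tau> ?es))) =
        (of_int (sign \<sigma>) / fact a * (of_int (sign \<tau>) / fact n)) * (c p * tensor_eval \<phi>s (permute_list \<sigma> vs @ permute_list \<tau> ?es))"
        by simp
    qed
    finally show "(X p (take a \<phi>s) + c p * wedge_vecs (vs @ ws) (take a \<phi>s)) * Lambda G \<rho> g y (drop a \<phi>s) =
        X p (take a \<phi>s) * Lambda G \<rho> g y (drop a \<phi>s) + ?w p \<phi>s"
      by (simp add: vs(2) distrib_right mult.assoc)
  qed
qed

lemma tensor_field_T1_tensor:
  assumes "\<xi>g \<in> sections G \<rho> g n k"
  shows "tensor_field (\<lambda>vs. e ` {..<n} \<subseteq> set vs) k (T1_tensor G \<rho> g y k \<xi>g)"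
proof (cases "k < n")
  case True
  then have "T1_tensor G \<rho> g y k \<xi>g = (\<lambda>_ _. 0)"
    by (simp add: fun_eq_iff T1_tensor_def section_low_degree_zero(2)[OF assms])
  then show ?thesis by (simp add: tensor_field_zero)
next
  case False
  then show ?thesis
    using tangent_tensor_Lambda[OF tangent_part(1)[OF assms]] by (simp add: T1_tensor_def[abs_def])
qed

lemma clinear_image_N_in_span:
  assumes "clinear M" "w \<in> N" "M ` e ` {..<n} \<subseteq> S"
  shows "M w \<in> cx.span S"
proof -
  have M0: "M 0 = 0" using assms(1) cx.scale_zero_left unfolding clinear_def by metis
  have "M (\<Sum>i<n. cscale (y i w) (e i)) = (\<Sum>i<n. cscale (y i w) (M (e i)))"
    using sum_comp_morphism[of M "\<lambda>i. cscale (y i w) (e i)" "{..<n}"] assms(1) M0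
    by (simp add: clinear_def o_def)
  also have "\<dots> \<in> cx.span S"
    using assms(3) by (intro cx.span_sum cx.span_scale cx.span_base) auto
  finally show ?thesis using N_expand[OF assms(2)] by simp
qed

end

context finite_rep
begin

text \<open>
  The summand of \<open>h\<close> in the group average at \<open>\<alpha>\<close> comes from this component.
\<close>

definition conj_inv :: "'g \<Rightarrow> 'g \<Rightarrow> 'g" where
  "conj_inv h \<alpha> = inv\<^bsub>G\<^esub> h \<otimes>\<^bsub>G\<^esub> (\<alpha> \<otimes>\<^bsub>G\<^esub> h)"

lemma conj_inv_closed [simp]: "h \<in> carrier G \<Longrightarrow> \<alpha> \<in> carrier G \<Longrightarrow> conj_inv h \<alpha> \<in> carrier G"
  by (simp add: conj_inv_def)

lemma conj_inv_cancel: "h \<in> carrier G \<Longrightarrow> \<alpha> \<in> carrier G \<Longrightarrow> h \<otimes>\<^bsub>G\<^esub> conj_inv h \<alpha> \<otimes>\<^bsub>G\<^esub> inv\<^bsub>G\<^esub> h = \<alpha>"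
  by (simp add: conj_inv_def m_assoc) (simp add: m_assoc[symmetric])

lemma act_single: "act G \<rho> g (cp_single (\<lambda>_. 1) h h') q = (if h' = h then 1 else 0)"
  by (simp add: act_def cp_single_def)

lemma cp_mult_single_left:
  assumes h: "h \<in> carrier G" and \<gamma>: "\<gamma> \<in> carrier G"
  shows "cp_mult G \<rho> (cp_single (\<lambda>_. 1) h) c \<gamma> p = act G \<rho> h (c (inv\<^bsub>G\<^esub> h \<otimes>\<^bsub>G\<^esub> \<gamma>)) p"
proof -
  have "cp_mult G \<rho> (cp_single (\<lambda>_. 1) h) c \<gamma> p =
    (\<Sum>g\<in>carrier G. \<Sum>h'\<in>carrier G. if h' = inv\<^bsub>G\<^esub> h \<otimes>\<^bsub>G\<^esub> \<gamma> then (if g = h then act G \<rho> h (c h') p else 0) else 0)"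
    unfolding cp_mult_def
  proof (intro sum.cong refl)
    fix g h' assume gh: "g \<in> carrier G" "h' \<in> carrier G"
    have "\<gamma> = h \<otimes>\<^bsub>G\<^esub> h' \<longleftrightarrow> h' = inv\<^bsub>G\<^esub> h \<otimes>\<^bsub>G\<^esub> \<gamma>"
      using inv_solve_left[OF gh(2) h \<gamma>] by auto
    then show "cp_single (\<lambda>q. cp_single (\<lambda>_. 1) h g q * act G \<rho> g (c h') q) (g \<otimes>\<^bsub>G\<^esub> h') \<gamma> p =
      (if h' = inv\<^bsub>G\<^esub> h \<otimes>\<^bsub>G\<^esub> \<gamma> then (if g = h then act G \<rho> h (c h') p else 0) else 0)"
      by (auto simp: cp_single_def)
  qed
  also have "\<dots> = act G \<rho> h (c (inv\<^bsub>G\<^esub> h \<otimes>\<^bsub>G\<^esub> \<gamma>)) p"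
    using h \<gamma> finite_group by simp
  finally show ?thesis .
qed

lemma cp_mult_single_right:
  assumes h: "h \<in> carrier G" and \<gamma>: "\<gamma> \<in> carrier G"
  shows "cp_mult G \<rho> c (cp_single (\<lambda>_. 1) (inv\<^bsub>G\<^esub> h)) \<gamma> p = c (\<gamma> \<otimes>\<^bsub>G\<^esub> h) p"
proof -
  have "cp_mult G \<rho> c (cp_single (\<lambda>_. 1) (inv\<^bsub>G\<^esub> h)) \<gamma> p =
    (\<Sum>g\<in>carrier G. \<Sum>h'\<in>carrier G. if h' = inv\<^bsub>G\<^esub> h then (if g = \<gamma> \<otimes>\<^bsub>G\<^esub> h then c g p else 0) else 0)"
    unfolding cp_mult_def
  proof (intro sum.cong refl)
    fix g h' assume gh: "g \<in> carrier G" "h' \<in> carrier G"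
    have "\<gamma> = g \<otimes>\<^bsub>G\<^esub> inv\<^bsub>G\<^esub> h \<longleftrightarrow> g = \<gamma> \<otimes>\<^bsub>G\<^esub> h"
      using inv_solve_right[OF \<gamma> gh(1) h] by auto
    then show "cp_single (\<lambda>q. c g q * act G \<rho> g (cp_single (\<lambda>_. 1) (inv\<^bsub>G\<^esub> h) h') q) (g \<otimes>\<^bsub>G\<^esub> h') \<gamma> p =
      (if h' = inv\<^bsub>G\<^esub> h then (if g = \<gamma> \<otimes>\<^bsub>G\<^esub> h then c g p else 0) else 0)"
      unfolding act_single by (auto simp: cp_single_def)
  qed
  also have "\<dots> = c (\<gamma> \<otimes>\<^bsub>G\<^esub> h) p"
    using h \<gamma> finite_group by simp
  finally show ?thesis .
qed

lemma T1_eq_average: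
  assumes \<alpha>: "\<alpha> \<in> carrier G"
  shows "T1 G \<rho> y k \<xi> fs \<alpha> p = 1 / of_nat (card (carrier G)) * (\<Sum>h\<in>carrier G.
    T1_component G \<rho> (conj_inv h \<alpha>) (y (conj_inv h \<alpha>)) k (\<xi> (conj_inv h \<alpha>)) (map (act G \<rho> (inv\<^bsub>G\<^esub> h)) fs)
      (cxmap (\<rho> (inv\<^bsub>G\<^esub> h)) p))"
proof -
  have "(\<Sum>g\<in>carrier G. cp_single (T1_component G \<rho> g (y g) k (\<xi> g) fs') g \<delta> q) = T1_component G \<rho> \<delta> (y \<delta>) k (\<xi> \<delta>) fs' q"
    if "\<delta> \<in> carrier G" for \<delta> fs' q
    using that finite_group by (simp add: cp_single_def)
  then show ?thesis
    unfolding T1_def cochain_average_def cochain_act_def using \<alpha>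
    by (intro arg_cong2[where f = "(*)"] sum.cong refl)
      (simp add: cp_mult_single_left cp_mult_single_right conj_inv_def act_def)
qed

text \<open>
  The tensor that the average in the definition of \<open>T1\<close> produces from \<open>X \<otimes> \<Lambda>\<close>; its summands are
  transported from the conjugates of \<open>\<alpha>\<close>.
\<close>

definition averaged_tensor :: "('g \<Rightarrow> nat \<Rightarrow> 'v cfun) \<Rightarrow> nat \<Rightarrow> ('g \<Rightarrow> 'v mfield) \<Rightarrow> 'g \<Rightarrow> 'v mfield" where
  "averaged_tensor y k \<xi> \<alpha> p \<phi>s = 1 / of_nat (card (carrier G)) * (\<Sum>h\<in>carrier G.
     pushforward G \<rho> h (T1_tensor G \<rho> (conj_inv h \<alpha>) (y (conj_inv h \<alpha>)) k (\<xi> (conj_inv h \<alpha>))) p \<phi>s)"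

lemma differential_act_inv:
  assumes h: "h \<in> carrier G"
  shows "differential (act G \<rho> (inv\<^bsub>G\<^esub> h) f) (cxmap (\<rho> (inv\<^bsub>G\<^esub> h)) p) = differential f p \<circ> cxmap (\<rho> h)"
  using differential_comp[OF clinear_rho[OF h], of f "cxmap (\<rho> (inv\<^bsub>G\<^esub> h)) p"] h
  by (simp add: act_def cxmap_rho_inv)

lemma fixed_conj_inv:
  assumes "h \<in> carrier G" "\<alpha> \<in> carrier G" "p \<in> cxset (fixed_space \<rho> \<alpha>)"
  shows "cxmap (\<rho> (inv\<^bsub>G\<^esub> h)) p \<in> cxset (fixed_space \<rho> (conj_inv h \<alpha>))"
proof -
  have "\<rho> (conj_inv h \<alpha>) (\<rho> (inv\<^bsub>G\<^esub> h) v) = \<rho> (inv\<^bsub>G\<^esub> h) v" if "v \<in> fixed_space \<rho> \<alpha>" for v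
    using that assms by (simp add: conj_inv_def rho_mult rho_inv fixed_space_def)
  then show ?thesis using assms(3) by (auto simp: cxset_def cxmap_def fixed_space_def)
qed

text \<open>
  The displacement by \<open>\<alpha>\<^sup>-\<^sup>1\<close> is the image under \<open>h\<close> of a displacement by the inverse of the
  conjugate element.
\<close>

lemma inv_minus_id_conj_inv:
  assumes "h \<in> carrier G" "\<alpha> \<in> carrier G"
  shows "cxmap (\<rho> (inv\<^bsub>G\<^esub> \<alpha>)) v - v =
    cxmap (\<rho> h) (cxmap (\<rho> (inv\<^bsub>G\<^esub> (conj_inv h \<alpha>))) (cxmap (\<rho> (inv\<^bsub>G\<^esub> h)) v) - cxmap (\<rho> (inv\<^bsub>G\<^esub> h)) v)"
proof -
  have "inv\<^bsub>G\<^esub> (conj_inv h \<alpha>) = inv\<^bsub>G\<^esub> h \<otimes>\<^bsub>G\<^esub> (inv\<^bsub>G\<^esub> \<alpha> \<otimes>\<^bsub>G\<^esub> h)"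
    using assms by (simp add: conj_inv_def inv_mult_group m_assoc)
  then show ?thesis
    using assms clinear_rho[of h]
    by (simp add: cxmap_rho_mult cxmap_rho_inv cxmap_def linear_diff linear_rho prod_eq_iff rho_mult rho_inv)
qed

end

locale twisted_setting = finite_rep G \<rho> B
  for G :: "('g, 'm) monoid_scheme" and \<rho> :: "'g \<Rightarrow> 'v::real_vector \<Rightarrow> 'v" and B +
  fixes y :: "'g \<Rightarrow> nat \<Rightarrow> 'v cfun" and k :: nat and \<xi> :: "'g \<Rightarrow> 'v mfield" and \<alpha> :: 'g
  assumes y: "g \<in> carrier G \<Longrightarrow> eigen_coordinates G \<rho> g (y g)"
    and \<xi>: "\<xi> \<in> invariant_sections G \<rho> k"
    and \<alpha>: "\<alpha> \<in> carrier G"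
begin

lemma eigen_rep_conj_inv: "h \<in> carrier G \<Longrightarrow> eigen_rep G \<rho> B (conj_inv h \<alpha>) (y (conj_inv h \<alpha>))"
  using y \<alpha> by unfold_locales simp_all

lemma section_conj_inv: "h \<in> carrier G \<Longrightarrow> \<xi> (conj_inv h \<alpha>) \<in> sections G \<rho> (conj_inv h \<alpha>) (codimension G \<rho> (conj_inv h \<alpha>)) k"
  using \<xi> \<alpha> by (simp add: invariant_sections_def)

lemma pushforward_conj_inv: 
  assumes "h \<in> carrier G"
  shows "pushforward G \<rho> h (\<xi> (conj_inv h \<alpha>)) = \<xi> \<alpha>"
proof -
  have "\<xi> (h \<otimes>\<^bsub>G\<^esub> conj_inv h \<alpha> \<otimes>\<^bsub>G\<^esub> inv\<^bsub>G\<^esub> h) = pushforward G \<rho> h (\<xi> (conj_inv h \<alpha>))"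
    using \<xi> \<alpha> assms unfolding invariant_sections_def by simp
  then show ?thesis using conj_inv_cancel[OF assms \<alpha>] by simp
qed

text \<open>
  The action of \<open>h\<^sup>-\<^sup>1\<close> carries the fixed space of \<open>\<alpha>\<close> to that of \<open>h\<^sup>-\<^sup>1 \<alpha> h\<close>, so the formula for
  the cocycle on fixed spaces applies to every summand of the average.
\<close>

lemma T1_on_fixed_space:
  assumes fs: "length fs = k" "set fs \<subseteq> Poly" and p: "p \<in> cxset (fixed_space \<rho> \<alpha>)"
  shows "T1 G \<rho> y k \<xi> fs \<alpha> p = averaged_tensor y k \<xi> \<alpha> p (map (\<lambda>f. differential f p) fs)"
  unfolding T1_eq_average[OF \<alpha>] averaged_tensor_def
proof (intro arg_cong2[where f = "(*)"] sum.cong refl)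
  fix h assume h: "h \<in> carrier G"
  interpret eigen_rep G \<rho> B "conj_inv h \<alpha>" "y (conj_inv h \<alpha>)" by (rule eigen_rep_conj_inv[OF h])
  have "set (map (act G \<rho> (inv\<^bsub>G\<^esub> h)) fs) \<subseteq> Poly"
    using fs(2) Poly_comp[OF _ clinear_rho[OF h]] h by (auto simp: act_def)
  then show "T1_component G \<rho> (conj_inv h \<alpha>) (y (conj_inv h \<alpha>)) k (\<xi> (conj_inv h \<alpha>)) (map (act G \<rho> (inv\<^bsub>G\<^esub> h)) fs)
      (cxmap (\<rho> (inv\<^bsub>G\<^esub> h)) p) =
    pushforward G \<rho> h (T1_tensor G \<rho> (conj_inv h \<alpha>) (y (conj_inv h \<alpha>)) k (\<xi> (conj_inv h \<alpha>))) p (map (\<lambda>f. differential f p) fs)"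
    by (subst T1_component_on_fixed_space)
      (simp_all add: section_conj_inv h fs(1) fixed_conj_inv \<alpha> p pushforward_def o_def differential_act_inv[unfolded o_def])
qed

lemma T1_affine:
  assumes fs: "length fs = k" "\<And>f. f \<in> set fs \<Longrightarrow> \<exists>\<phi>\<in>covectors. \<exists>c. f = (\<lambda>q. \<phi> q - c)"
  shows "T1 G \<rho> y k \<xi> fs \<alpha> p = averaged_tensor y k \<xi> \<alpha> p (map (\<lambda>f. differential f p) fs)"
  unfolding T1_eq_average[OF \<alpha>] averaged_tensor_def
proof (intro arg_cong2[where f = "(*)"] sum.cong refl)
  fix h assume h: "h \<in> carrier G"
  interpret eigen_rep G \<rho> B "conj_inv h \<alpha>" "y (conj_inv h \<alpha>)" by (rule eigen_rep_conj_inv[OF h])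
  have "\<exists>\<phi>\<in>covectors. \<exists>c. f' = (\<lambda>q. \<phi> q - c)" if "f' \<in> set (map (act G \<rho> (inv\<^bsub>G\<^esub> h)) fs)" for f'
  proof -
    from that obtain f where f: "f \<in> set fs" "f' = act G \<rho> (inv\<^bsub>G\<^esub> h) f" by auto
    obtain \<phi> c where \<phi>: "\<phi> \<in> covectors" "f = (\<lambda>q. \<phi> q - c)" using fs(2)[OF f(1)] by blast
    show ?thesis
      using covector_comp[OF \<phi>(1) clinear_rho[OF h]] h f \<phi>(2)
      by (intro bexI[of _ "\<phi> \<circ> cxmap (\<rho> h)"] exI[of _ c]) (simp_all add: act_def)
  qed
  then show "T1_component G \<rho> (conj_inv h \<alpha>) (y (conj_inv h \<alpha>)) k (\<xi> (conj_inv h \<alpha>)) (map (act G \<rho> (inv\<^bsub>G\<^esub> h)) fs)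
      (cxmap (\<rho> (inv\<^bsub>G\<^esub> h)) p) =
    pushforward G \<rho> h (T1_tensor G \<rho> (conj_inv h \<alpha>) (y (conj_inv h \<alpha>)) k (\<xi> (conj_inv h \<alpha>))) p (map (\<lambda>f. differential f p) fs)"
    by (subst T1_component_affine)
      (simp_all add: section_conj_inv h fs(1) \<alpha> pushforward_def o_def differential_act_inv[unfolded o_def])
qed

text \<open>
  All summands of the average antisymmetrise to the same multivector \<open>\<xi> \<alpha>\<close>, by invariance of the
  family \<open>\<xi>\<close>.
\<close>

lemma Alt_averaged_tensor:
  assumes \<phi>s: "length \<phi>s = k"
  shows "Alt (averaged_tensor y k \<xi> \<alpha> p) \<phi>s = fact k * \<xi> \<alpha> p \<phi>s"
proof -
  have card: "of_nat (card (carrier G)) \<noteq> (0 :: complex)"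
    using finite_group one_closed by (auto simp: card_eq_0_iff)
  have "Alt (pushforward G \<rho> h (T1_tensor G \<rho> (conj_inv h \<alpha>) (y (conj_inv h \<alpha>)) k (\<xi> (conj_inv h \<alpha>))) p) \<phi>s =
      fact k * \<xi> \<alpha> p \<phi>s" if h: "h \<in> carrier G" for h
  proof -
    interpret eigen_rep G \<rho> B "conj_inv h \<alpha>" "y (conj_inv h \<alpha>)" by (rule eigen_rep_conj_inv[OF h])
    let ?T = "T1_tensor G \<rho> (conj_inv h \<alpha>) (y (conj_inv h \<alpha>)) k (\<xi> (conj_inv h \<alpha>)) (cxmap (\<rho> (inv\<^bsub>G\<^esub> h)) p)"
    let ?m = "map (\<lambda>\<phi>. \<phi> \<circ> cxmap (\<rho> h))"
    have "Alt (\<lambda>\<psi>s. ?T (?m \<psi>s)) \<phi>s = Alt ?T (?m \<phi>s)"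
      unfolding Alt_def by (intro sum.cong) (auto simp: permute_list_map)
    also have "\<dots> = fact k * pushforward G \<rho> h (\<xi> (conj_inv h \<alpha>)) p \<phi>s"
      by (subst Alt_T1_tensor) (simp_all add: section_conj_inv h \<phi>s pushforward_def)
    finally show ?thesis
      by (simp add: pushforward_def[of G \<rho> h "T1_tensor _ _ _ _ _ _"] pushforward_conj_inv[OF h])
  qed
  then show ?thesis
    unfolding averaged_tensor_def[abs_def] Alt_mult Alt_sum using card by simp
qed

text \<open>
  In the summand of \<open>h\<close> the vectors include the \<open>h\<close>-image of a basis of the normal space of the
  conjugate element, and these span \<open>N\<^sup>\<alpha>\<close>.
\<close>

lemma tensor_field_averaged:
  "tensor_field (\<lambda>vs. \<forall>v. cxmap (\<rho> (inv\<^bsub>G\<^esub> \<alpha>)) v - v \<in> cx.span (set vs)) k (averaged_tensor y k \<xi> \<alpha>)"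
  unfolding averaged_tensor_def[abs_def]
proof (intro tensor_field_cmult tensor_field_sum)
  fix h assume h: "h \<in> carrier G"
  interpret E: eigen_rep G \<rho> B "conj_inv h \<alpha>" "y (conj_inv h \<alpha>)" by (rule eigen_rep_conj_inv[OF h])
  show "tensor_field (\<lambda>vs. \<forall>v. cxmap (\<rho> (inv\<^bsub>G\<^esub> \<alpha>)) v - v \<in> cx.span (set vs)) k
    (pushforward G \<rho> h (T1_tensor G \<rho> (conj_inv h \<alpha>) (y (conj_inv h \<alpha>)) k (\<xi> (conj_inv h \<alpha>))))"
    unfolding pushforward_def
  proof (rule tensor_field_pullback[OF E.tensor_field_T1_tensor[OF section_conj_inv[OF h]]])
    show "clinear (cxmap (\<rho> (inv\<^bsub>G\<^esub> h)))" "clinear (cxmap (\<rho> h))" using h by (simp_all add: clinear_rho)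
    fix vs assume "E.e ` {..<E.n} \<subseteq> set vs"
    then have "cxmap (\<rho> h) ` E.e ` {..<E.n} \<subseteq> set (map (cxmap (\<rho> h)) vs)" by auto
    then show "\<forall>v. cxmap (\<rho> (inv\<^bsub>G\<^esub> \<alpha>)) v - v \<in> cx.span (set (map (cxmap (\<rho> h)) vs))"
      unfolding inv_minus_id_conj_inv[OF h \<alpha>]
      by (intro allI E.clinear_image_N_in_span clinear_rho h E.rho_inv_diff_in_N)
  qed
qed

end

section \<open>Comparison of the two products\<close>

text \<open>
  Reindexing by a permutation of \<open>bs\<close> multiplies the wedge product by its sign. So the field with
  coefficients \<open>c\<close> depends only on the antisymmetrisation of \<open>c\<close>; in particular the
  antisymmetrisation in \<open>L2\<close> and its absence in the standard pre-Lie product make no difference.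
\<close>

lemma sum_Alt_wedge_vecs:
  fixes c :: "'v::real_vector cfun list \<Rightarrow> complex"
  shows "(\<Sum>bs | set bs \<subseteq> B \<and> length bs = m. c (map (coord B) bs) * wedge_vecs (map coord_vec bs) \<phi>s) =
    (\<Sum>bs | set bs \<subseteq> B \<and> length bs = m. 1 / fact m * Alt c (map (coord B) bs) * wedge_vecs (map coord_vec bs) \<phi>s)"
    (is "?S = _")
proof -
  let ?I = "{bs. set bs \<subseteq> B \<and> length bs = m}" and ?P = "{\<sigma>. \<sigma> permutes {..<m}}"
  let ?f = "\<lambda>bs. c (map (coord B) bs) * wedge_vecs (map coord_vec bs) \<phi>s"
  have perm: "?S = (\<Sum>bs\<in>?I. of_int (sign \<sigma>) * c (permute_list \<sigma> (map (coord B) bs)) * wedge_vecs (map coord_vec bs) \<phi>s)"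
    if \<sigma>: "\<sigma> \<in> ?P" for \<sigma>
  proof -
    have \<sigma>': "\<sigma> permutes {..<m}" using \<sigma> by simp
    note inv = permutes_inv[OF \<sigma>']
    have "?S = (\<Sum>bs\<in>?I. ?f (permute_list \<sigma> bs))"
    proof (rule sum.reindex_bij_witness[of _ "permute_list \<sigma>" "permute_list (Hilbert_Choice.inv \<sigma>)"])
      fix bs assume bs: "bs \<in> ?I"
      then show *: "permute_list \<sigma> (permute_list (Hilbert_Choice.inv \<sigma>) bs) = bs"
        and "permute_list (Hilbert_Choice.inv \<sigma>) (permute_list \<sigma> bs) = bs"
        using \<sigma>' inv permute_list_compose[of \<sigma> bs "Hilbert_Choice.inv \<sigma>"]
          permute_list_compose[of "Hilbert_Choice.inv \<sigma>" bs \<sigma>]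
        by (simp_all add: permutes_inv_o[OF \<sigma>'])
      show "permute_list \<sigma> bs \<in> ?I" "permute_list (Hilbert_Choice.inv \<sigma>) bs \<in> ?I"
        using bs \<sigma>' inv by simp_all
      show "?f (permute_list \<sigma> (permute_list (Hilbert_Choice.inv \<sigma>) bs)) = ?f bs"
        by (simp only: *)
    qed
    also have "\<dots> = (\<Sum>bs\<in>?I. of_int (sign \<sigma>) * c (permute_list \<sigma> (map (coord B) bs)) * wedge_vecs (map coord_vec bs) \<phi>s)"
    proof (intro sum.cong refl)
      fix bs assume "bs \<in> ?I"
      then show "?f (permute_list \<sigma> bs) = of_int (sign \<sigma>) * c (permute_list \<sigma> (map (coord B) bs)) * wedge_vecs (map coord_vec bs) \<phi>s"
        using \<sigma>' wedge_vecs_permute[of \<sigma> "map coord_vec bs" \<phi>s] by (simp add: permute_list_map)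
    qed
    finally show ?thesis .
  qed
  have "fact m * ?S = (\<Sum>\<sigma>\<in>?P. ?S)"
    using card_permutations[of "{..<m}" m] by simp
  also have "\<dots> = (\<Sum>\<sigma>\<in>?P. \<Sum>bs\<in>?I. of_int (sign \<sigma>) * c (permute_list \<sigma> (map (coord B) bs)) * wedge_vecs (map coord_vec bs) \<phi>s)"
    by (rule sum.cong[OF refl perm])
  also have "\<dots> = (\<Sum>bs\<in>?I. \<Sum>\<sigma>\<in>?P. of_int (sign \<sigma>) * c (permute_list \<sigma> (map (coord B) bs)) * wedge_vecs (map coord_vec bs) \<phi>s)"
    by (rule sum.swap)
  also have "\<dots> = (\<Sum>bs\<in>?I. Alt c (map (coord B) bs) * wedge_vecs (map coord_vec bs) \<phi>s)"
    by (intro sum.cong refl) (simp add: Alt_def sum_distrib_right)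
  finally have S: "fact m * ?S = (\<Sum>bs\<in>?I. Alt c (map (coord B) bs) * wedge_vecs (map coord_vec bs) \<phi>s)" .
  have "?S = 1 / fact m * (fact m * ?S)" by simp
  also note S
  finally have "?S = 1 / fact m * (\<Sum>bs\<in>?I. Alt c (map (coord B) bs) * wedge_vecs (map coord_vec bs) \<phi>s)" .
  then show ?thesis by (simp add: sum_distrib_left mult.assoc)
qed

lemma coord_covector:
  assumes "finite_dimensional_vector_space ((*\<^sub>R) :: real \<Rightarrow> 'v::real_vector \<Rightarrow> 'v) B"
  shows "coord B b \<in> covectors"
proof -
  interpret fd: finite_dimensional_vector_space "(*\<^sub>R) :: real \<Rightarrow> 'v \<Rightarrow> 'v" B by (rule assms)
  have ind: "independent B" using fd.independent_Basis by (simp add: dependent_raw_def)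
  have sp: "v \<in> span B" for v using fd.span_Basis by (simp add: span_raw_def)
  have add: "representation B (v + w) b = representation B v b + representation B w b" for v w
    using representation_add[OF ind sp sp, of v w] by simp
  have scale: "representation B (c *\<^sub>R v) b = c * representation B v b" for c v
    using representation_scale[OF ind sp, of c v] by simp
  have diff: "representation B (v - w) b = representation B v b - representation B w b" for v w
    using representation_diff[OF ind sp sp, of v w] by simp
  show ?thesis
    by (simp add: covectors_iff coord_def cscale_def add diff scale complex_eq_iff)
qed

lemma int_sign_exponent:
  "(- 1 :: complex) powi ((int (Suc s) - 1) * (int l - 1)) = (- 1) ^ (s * (l + 1))"
proof -
  have parity: "even ((int (Suc s) - 1) * (int l - 1)) \<longleftrightarrow> even (s * (l + 1))"
    by auto
  then show ?thesis
    by (cases "even ((int (Suc s) - 1) * (int l - 1))")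
      (simp_all add: power_int_minus_left_even power_int_minus_left_odd del: even_mult_iff)
qed

lemma sum_from_1: "(\<Sum>s\<in>{1..k}. f s) = (\<Sum>s<k. f (Suc s))"
  by (rule sum.reindex_bij_witness[of _ Suc "\<lambda>s. s - 1"]) auto

lemma insert_block_length: "length xs + 1 = k + l \<Longrightarrow> s < k \<Longrightarrow> length (insert_block l D s xs) = k"
  by (simp add: insert_block_def)

text \<open>
  The inserted value may be computed from the antisymmetrised inner tensor, because the outer sum
  antisymmetrises the block of its arguments anyway.
\<close>

lemma Alt_insert_differential_Alt:
  assumes T: "tensor_field K k T" and H: "tensor_field K' l H"
    and Y: "\<And>q \<phi>s. length \<phi>s = l \<Longrightarrow> Alt (H q) \<phi>s = fact l * Y q \<phi>s"
    and len: "length xs + 1 = k + l" and cov: "set xs \<subseteq> covectors" and s: "s < k"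
  shows "Alt (\<lambda>ys. T p (insert_block l (\<lambda>blk. differential (\<lambda>q. Y q blk) p) s ys)) xs =
    Alt (\<lambda>ys. T p (insert_block l (\<lambda>blk. differential (\<lambda>q. H q blk) p) s ys)) xs"
proof -
  let ?D = "\<lambda>blk. differential (\<lambda>q. H q blk) p"
  let ?F = "\<lambda>ys. T p (insert_block l ?D s ys)"
  have "T p (insert_block l (\<lambda>blk. differential (\<lambda>q. Y q blk) p) s ys) =
      1 / fact l * Alt (\<lambda>zs. ?F (take s ys @ zs @ drop (s + l) ys)) (take l (drop s ys))"
    if ys: "length ys = length xs" "set ys = set xs" for ys
  proof -
    have "s + l + (k - Suc s) = length ys" using ys len s by simp
    then obtain us blk us' where dec: "ys = us @ blk @ us'" "length us = s" "length blk = l" "length us' = k - Suc s"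
      by (rule split_list_at)
    have c: "set us \<subseteq> covectors" "set blk \<subseteq> covectors" "set us' \<subseteq> covectors" using dec ys cov by auto
    have HP: "(\<lambda>q. H q (permute_list \<sigma> blk)) \<in> Poly" if "\<sigma> permutes {..<l}" for \<sigma>
      using that c(2) dec(3) by (intro tensor_field_Poly[OF H]) simp_all
    define c :: "(nat \<Rightarrow> nat) \<Rightarrow> complex" where "c \<sigma> = of_int (sign \<sigma>) / fact l" for \<sigma>
    have "Y q blk = (\<Sum>\<sigma> | \<sigma> permutes {..<l}. c \<sigma> * H q (permute_list \<sigma> blk))" for q
      using Y[OF dec(3), of q] dec(3) by (simp add: c_def Alt_def sum_divide_distrib[symmetric] field_simps)
    then have "differential (\<lambda>q. Y q blk) p =
        differential (\<lambda>q. \<Sum>\<sigma> | \<sigma> permutes {..<l}. c \<sigma> * H q (permute_list \<sigma> blk)) p"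
      by simp
    also have "\<dots> = (\<lambda>v. \<Sum>\<sigma> | \<sigma> permutes {..<l}. differential (\<lambda>q. c \<sigma> * H q (permute_list \<sigma> blk)) p v)"
      by (rule differential_sum) (auto intro: Poly_cmult HP)
    also have "\<dots> = (\<lambda>v. \<Sum>\<sigma> | \<sigma> permutes {..<l}. c \<sigma> * ?D (permute_list \<sigma> blk) v)"
      by (intro ext sum.cong refl) (simp add: differential_cmult[OF HP])
    finally have D: "differential (\<lambda>q. Y q blk) p = \<dots>" .
    have "T p (us @ [differential (\<lambda>q. Y q blk) p] @ us') =
        (\<Sum>\<sigma> | \<sigma> permutes {..<l}. c \<sigma> * T p (us @ [?D (permute_list \<sigma> blk)] @ us'))"
      unfolding D
      by (rule tensor_field_slot_linear[OF T]) (use c dec s HP in \<open>auto intro: differential_in_covectors\<close>)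
    also have "\<dots> = 1 / fact l * Alt (\<lambda>zs. T p (us @ [?D zs] @ us')) blk"
      by (simp add: c_def Alt_def dec(3) sum_divide_distrib)
    also have "Alt (\<lambda>zs. T p (us @ [?D zs] @ us')) blk = Alt (\<lambda>zs. ?F (us @ zs @ us')) blk"
      using dec by (intro Alt_cong) (simp add: insert_block_def)
    finally show ?thesis using dec by (simp add: insert_block_def)
  qed
  then have "Alt (\<lambda>ys. T p (insert_block l (\<lambda>blk. differential (\<lambda>q. Y q blk) p) s ys)) xs =
    Alt (\<lambda>ys. 1 / fact l * Alt (\<lambda>zs. ?F (take s ys @ zs @ drop (s + l) ys)) (take l (drop s ys))) xs"
    by (rule Alt_cong)
  also have "\<dots> = 1 / fact l * Alt (\<lambda>ys. Alt (\<lambda>zs. ?F (take s ys @ zs @ drop (s + l) ys)) (take l (drop s ys))) xs"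
    by (rule Alt_mult)
  also have "\<dots> = 1 / fact l * (fact l * Alt ?F xs)"
    by (intro arg_cong2[where f = "(*)"] refl Alt_block[of s l xs ?F]) (use len s in simp)
  finally show ?thesis by simp
qed

text \<open>
  The comparison in terms of tensors: remove the twist \<open>M\<close>, then replace the inner tensor and
  finally the outer tensor by their antisymmetrisations.
\<close>

lemma Alt_insertion_sum_twisted:
  fixes T H :: "'v::real_vector mfield" and xs :: "'v cfun list"
  assumes T: "tensor_field K k T" and H: "tensor_field K' l H" and M: "clinear M"
    and K': "\<And>ws v. K' ws \<Longrightarrow> M v - v \<in> cx.span (set ws)"
    and X: "\<And>\<phi>s. length \<phi>s = k \<Longrightarrow> Alt (T p) \<phi>s = fact k * X \<phi>s"
    and Y: "\<And>q \<phi>s. length \<phi>s = l \<Longrightarrow> Alt (H q) \<phi>s = fact l * Y q \<phi>s"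
    and len: "length xs + 1 = k + l" and cov: "set xs \<subseteq> covectors"
  shows "Alt (\<lambda>ys. \<Sum>s<k. (- 1) ^ (s * (l + 1)) *
      T p (take s ys @ [differential (\<lambda>q. H q (take l (drop s ys))) p] @ map (\<lambda>\<phi>. \<phi> \<circ> M) (drop (s + l) ys))) xs =
    Alt (insertion_sum k l (\<lambda>blk. differential (\<lambda>q. Y q blk) p) X) xs"
proof -
  let ?D = "\<lambda>blk. differential (\<lambda>q. Y q blk) p"
  have "Alt (\<lambda>ys. \<Sum>s<k. (- 1) ^ (s * (l + 1)) *
      T p (take s ys @ [differential (\<lambda>q. H q (take l (drop s ys))) p] @ map (\<lambda>\<phi>. \<phi> \<circ> M) (drop (s + l) ys))) xs =
    (\<Sum>s<k. (- 1) ^ (s * (l + 1)) * Alt (\<lambda>ys. T p (insert_block l ?D s ys)) xs)"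
    unfolding Alt_sum Alt_mult
    using Alt_untwist[OF T H M K' len cov] Alt_insert_differential_Alt[OF T H Y len cov]
    by (intro sum.cong arg_cong2[where f = "(*)"] refl) simp
  also have "\<dots> = Alt (insertion_sum k l ?D (T p)) xs"
    unfolding insertion_sum_def[abs_def] Alt_sum Alt_mult ..
  also have "\<dots> = 1 / fact k * Alt (insertion_sum k l ?D (Alt (T p))) xs"
    unfolding Alt_insertion_sum_Alt[OF len] by simp
  also have "Alt (insertion_sum k l ?D (Alt (T p))) xs = Alt (\<lambda>ys. fact k * insertion_sum k l ?D X ys) xs"
  proof (rule Alt_cong)
    fix ys :: "'v cfun list" assume "length ys = length xs"
    then have "length (insert_block l ?D s ys) = k" if "s < k" for s
      using that len by (intro insert_block_length) simp_all
    then show "insertion_sum k l ?D (Alt (T p)) ys = fact k * insertion_sum k l ?D X ys"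
      by (simp add: insertion_sum_def X sum_distrib_left mult_ac)
  qed
  also have "\<dots> = fact k * Alt (insertion_sum k l ?D X) xs" by (rule Alt_mult)
  finally have "Alt (\<lambda>ys. \<Sum>s<k. (- 1) ^ (s * (l + 1)) *
      T p (take s ys @ [differential (\<lambda>q. H q (take l (drop s ys))) p] @ map (\<lambda>\<phi>. \<phi> \<circ> M) (drop (s + l) ys))) xs =
    1 / fact k * (fact k * Alt (insertion_sum k l ?D X) xs)" .
  moreover have "1 / fact k * (fact k * c) = c" for c :: complex by simp
  ultimately show ?thesis by (simp only:)
qed

locale twisted_pair =
  A: twisted_setting G \<rho> B y k \<xi> \<alpha> + E: twisted_setting G \<rho> B y l \<eta> \<beta>
  for G :: "('g, 'm) monoid_scheme" and \<rho> :: "'g \<Rightarrow> 'v::real_vector \<Rightarrow> 'v" and B y k l \<xi> \<eta> \<alpha> \<beta>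
begin

text \<open>
  The inner cochain is evaluated on affine functions, at all points, and the outer one on
  polynomials at a point of \<open>V\<^sup>\<alpha>\<close>. The constants \<open>\<phi> p\<close> disappear in the differentials.
\<close>

lemma P_cochain_on_fixed_space:
  assumes p: "p \<in> cxset (fixed_space \<rho> \<alpha>)" and xs: "length xs + 1 = k + l" "set xs \<subseteq> covectors"
  shows "P_cochain G \<rho> y k l \<xi> \<eta> \<alpha> \<beta> (map (\<lambda>\<phi> q. \<phi> q - \<phi> p) xs) p =
    (\<Sum>s<k. (- 1) ^ (s * (l + 1)) * A.averaged_tensor y k \<xi> \<alpha> p
       (take s xs @ [differential (\<lambda>q. A.averaged_tensor y l \<eta> \<beta> q (take l (drop s xs))) p] @
        map (\<lambda>\<phi>. \<phi> \<circ> cxmap (\<rho> (inv\<^bsub>G\<^esub> \<beta>))) (drop (s + l) xs)))"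
proof -
  let ?M = "cxmap (\<rho> (inv\<^bsub>G\<^esub> \<beta>))" and ?sh = "\<lambda>\<phi> q. \<phi> q - \<phi> p :: complex"
  have M: "clinear ?M" using E.\<alpha> by (intro A.clinear_rho) simp
  have "T1 G \<rho> y k \<xi>
         (take s (map ?sh xs) @ [T1 G \<rho> y l \<eta> (take l (drop s (map ?sh xs))) \<beta>] @
          map (act G \<rho> \<beta>) (drop (s + l) (map ?sh xs))) \<alpha> p =
     A.averaged_tensor y k \<xi> \<alpha> p
       (take s xs @ [differential (\<lambda>q. A.averaged_tensor y l \<eta> \<beta> q (take l (drop s xs))) p] @
        map (\<lambda>\<phi>. \<phi> \<circ> ?M) (drop (s + l) xs))" if s: "s < k" for s
  proof -
    have "s + l + (k - Suc s) = length xs" using xs(1) s by simp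
    then obtain us blk us' where dec: "xs = us @ blk @ us'" "length us = s" "length blk = l" "length us' = k - Suc s"
      by (rule split_list_at)
    have c: "set us \<subseteq> covectors" "set blk \<subseteq> covectors" "set us' \<subseteq> covectors" using dec xs(2) by auto
    have d: "map (\<lambda>f. differential f q) (map ?sh ws) = ws" if "set ws \<subseteq> covectors" for ws q
      using that by (induction ws) (auto simp: differential_affine)
    have inner: "T1 G \<rho> y l \<eta> (map ?sh blk) \<beta> = (\<lambda>q. A.averaged_tensor y l \<eta> \<beta> q blk)"
    proof
      fix q
      have "T1 G \<rho> y l \<eta> (map ?sh blk) \<beta> q = A.averaged_tensor y l \<eta> \<beta> q (map (\<lambda>f. differential f q) (map ?sh blk))"
        by (rule E.T1_affine) (use dec c in auto)
      then show "T1 G \<rho> y l \<eta> (map ?sh blk) \<beta> q = A.averaged_tensor y l \<eta> \<beta> q blk"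
        by (simp only: d[OF c(2)])
    qed
    define h where "h = (\<lambda>q. A.averaged_tensor y l \<eta> \<beta> q blk)"
    have h: "h \<in> Poly"
      unfolding h_def by (rule tensor_field_Poly[OF E.tensor_field_averaged c(2) dec(3)])
    have act: "act G \<rho> \<beta> (?sh \<phi>) = (\<lambda>q. (\<phi> \<circ> ?M) q - \<phi> p)" for \<phi>
      by (simp add: act_def o_def)
    have d': "map (\<lambda>f. differential f p) (map (\<lambda>\<phi> q. (\<phi> \<circ> ?M) q - \<phi> p) us') = map (\<lambda>\<phi>. \<phi> \<circ> ?M) us'"
      using c(3) by (induction us') (simp_all add: differential_affine[OF covector_comp[OF _ M], unfolded o_def] o_def)
    have poly: "?sh \<phi> \<in> Poly" "(\<lambda>q. (\<phi> \<circ> ?M) q - \<phi> p) \<in> Poly" if "\<phi> \<in> covectors" for \<phi>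
      by (rule Poly_diff[OF Poly.covec[OF that] Poly.const],
          rule Poly_diff[OF Poly.covec[OF covector_comp[OF that M]] Poly.const])
    have "T1 G \<rho> y k \<xi> (map ?sh us @ [h] @ map (\<lambda>\<phi> q. (\<phi> \<circ> ?M) q - \<phi> p) us') \<alpha> p =
      A.averaged_tensor y k \<xi> \<alpha> p
        (map (\<lambda>f. differential f p) (map ?sh us @ [h] @ map (\<lambda>\<phi> q. (\<phi> \<circ> ?M) q - \<phi> p) us'))"
    proof (rule A.T1_on_fixed_space[OF _ _ p])
      show "length (map ?sh us @ [h] @ map (\<lambda>\<phi> q. (\<phi> \<circ> ?M) q - \<phi> p) us') = k" using dec s by simp
      show "set (map ?sh us @ [h] @ map (\<lambda>\<phi> q. (\<phi> \<circ> ?M) q - \<phi> p) us') \<subseteq> Poly"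
        using c poly h by (auto simp: subset_iff)
    qed
    also have "map (\<lambda>f. differential f p) (map ?sh us @ [h] @ map (\<lambda>\<phi> q. (\<phi> \<circ> ?M) q - \<phi> p) us') =
        us @ [differential h p] @ map (\<lambda>\<phi>. \<phi> \<circ> ?M) us'"
      by (simp only: map_append d[OF c(1)] d' list.map)
    finally show ?thesis
      using dec by (simp add: take_map drop_map inner h_def act o_def)
  qed
  note step = this
  show ?thesis
    unfolding P_cochain_def sum_from_1 int_sign_exponent diff_Suc_1
    by (intro sum.cong arg_cong2[where f = "(*)"] refl step) simp
qed

lemma prelie_coefficient:
  assumes xs: "length xs + 1 = k + l" "set xs \<subseteq> covectors"
  shows "(\<Sum>s\<in>{1..k}. (-1) powi ((int s - 1) * (int l - 1)) *
          mf_apply (\<xi> \<alpha>) (take (s - 1) xs @ [mf_apply (\<eta> \<beta>) (take l (drop (s - 1) xs))] @ drop (s - 1 + l) xs) p) =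
    insertion_sum k l (\<lambda>blk. differential (\<lambda>q. \<eta> \<beta> q blk) p) (\<xi> \<alpha> p) xs"
proof -
  have d: "map (\<lambda>f. differential f q) ws = ws" if "set ws \<subseteq> covectors" for ws q
    using that by (induction ws) (auto simp: differential_covector)
  have "mf_apply (\<xi> \<alpha>) (take s xs @ [mf_apply (\<eta> \<beta>) (take l (drop s xs))] @ drop (s + l) xs) p =
    \<xi> \<alpha> p (insert_block l (\<lambda>blk. differential (\<lambda>q. \<eta> \<beta> q blk) p) s xs)" for s
  proof -
    have "set (take s xs) \<subseteq> covectors" "set (take l (drop s xs)) \<subseteq> covectors" "set (drop (s + l) xs) \<subseteq> covectors"
      using xs(2) by (auto dest: in_set_takeD in_set_dropD)
    then show ?thesis by (simp add: mf_apply_def insert_block_def d)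
  qed
  then show ?thesis
    unfolding insertion_sum_def sum_from_1 int_sign_exponent diff_Suc_1
    by (intro sum.cong arg_cong2[where f = "(*)"] refl)
qed

text \<open>
  Both sides are sums over lists of basis vectors in which only the antisymmetrised coefficients
  matter, and these agree by \<open>Alt_insertion_sum_twisted\<close>.
\<close>

lemma L2_P_cochain_eq_prelie:
  assumes p: "p \<in> cxset (fixed_space \<rho> \<alpha>)"
  shows "L2 B (k + l - 1) (P_cochain G \<rho> y k l \<xi> \<eta> \<alpha> \<beta>) p = prelie B k l (\<xi> \<alpha>) (\<eta> \<beta>) p"
proof (cases "k = 0")
  case True
  then show ?thesis by (simp add: L2_def prelie_def P_cochain_def)
next
  case False
  define m where "m = k + l - 1"
  have m: "m + 1 = k + l" using False by (simp add: m_def)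
  let ?P = "\<lambda>ys. P_cochain G \<rho> y k l \<xi> \<eta> \<alpha> \<beta> (map (\<lambda>\<phi> q. \<phi> q - \<phi> p) ys) p"
  let ?C = "\<lambda>xs. (\<Sum>s\<in>{1..k}. (-1) powi ((int s - 1) * (int l - 1)) *
          mf_apply (\<xi> \<alpha>) (take (s - 1) xs @ [mf_apply (\<eta> \<beta>) (take l (drop (s - 1) xs))] @ drop (s - 1 + l) xs) p)"
  let ?T = "A.averaged_tensor y k \<xi> \<alpha>" and ?H = "A.averaged_tensor y l \<eta> \<beta>"
  have Alt_eq: "Alt ?P xs = Alt ?C xs" if xs: "length xs = m" "set xs \<subseteq> covectors" for xs
  proof -
    have len: "length xs + 1 = k + l" using xs m by simp
    have "Alt ?P xs = Alt (\<lambda>ys. \<Sum>s<k. (- 1) ^ (s * (l + 1)) *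
      ?T p (take s ys @ [differential (\<lambda>q. ?H q (take l (drop s ys))) p] @
        map (\<lambda>\<phi>. \<phi> \<circ> cxmap (\<rho> (inv\<^bsub>G\<^esub> \<beta>))) (drop (s + l) ys))) xs"
      by (intro Alt_cong P_cochain_on_fixed_space[OF p]) (use len xs in auto)
    also have "\<dots> = Alt (insertion_sum k l (\<lambda>blk. differential (\<lambda>q. \<eta> \<beta> q blk) p) (\<xi> \<alpha> p)) xs"
    proof (rule Alt_insertion_sum_twisted[OF A.tensor_field_averaged E.tensor_field_averaged])
      show "clinear (cxmap (\<rho> (inv\<^bsub>G\<^esub> \<beta>)))" using E.\<alpha> by (intro A.clinear_rho) simp
    qed (use len xs A.Alt_averaged_tensor E.Alt_averaged_tensor in auto)
    also have "\<dots> = Alt ?C xs"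
      by (intro Alt_cong prelie_coefficient[symmetric]) (use len xs in auto)
    finally show ?thesis .
  qed
  show ?thesis
  proof
    fix \<phi>s
    have cov: "set (map (coord B) bs) \<subseteq> covectors" for bs
      using coord_covector[OF A.basis] by auto
    have "L2 B m (P_cochain G \<rho> y k l \<xi> \<eta> \<alpha> \<beta>) p \<phi>s =
      (\<Sum>bs | set bs \<subseteq> B \<and> length bs = m. 1 / fact m * Alt ?P (map (coord B) bs) * wedge_vecs (map coord_vec bs) \<phi>s)"
      unfolding L2_def Alt_def
      by (intro sum.cong arg_cong2[where f = "(*)"] refl) (auto simp: permute_list_map o_def)
    also have "\<dots> = (\<Sum>bs | set bs \<subseteq> B \<and> length bs = m. 1 / fact m * Alt ?C (map (coord B) bs) * wedge_vecs (map coord_vec bs) \<phi>s)"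
      using cov by (intro sum.cong arg_cong2[where f = "(*)"] refl Alt_eq) auto
    also have "\<dots> = (\<Sum>bs | set bs \<subseteq> B \<and> length bs = m. ?C (map (coord B) bs) * wedge_vecs (map coord_vec bs) \<phi>s)"
      by (rule sum_Alt_wedge_vecs[symmetric])
    also have "\<dots> = prelie B k l (\<xi> \<alpha>) (\<eta> \<beta>) p \<phi>s"
      by (simp only: prelie_def m_def)
    finally show "L2 B (k + l - 1) (P_cochain G \<rho> y k l \<xi> \<eta> \<alpha> \<beta>) p \<phi>s = prelie B k l (\<xi> \<alpha>) (\<eta> \<beta>) p \<phi>s"
      by (simp only: m_def)
  qed
qed

end

theorem theorem4p4:
  fixes G :: "('g, 'm) monoid_scheme"
    and \<rho> :: "'g \<Rightarrow> 'v::real_vector \<Rightarrow> 'v"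
    and B :: "'v set"
    and y :: "'g \<Rightarrow> nat \<Rightarrow> 'v cfun"
    and \<xi> \<eta> :: "'g \<Rightarrow> 'v mfield"
    and k l :: nat
    and \<alpha> \<beta> :: 'g
  assumes "finite_dimensional_vector_space ((*\<^sub>R) :: real \<Rightarrow> 'v \<Rightarrow> 'v) B"
    and "faithful_action G UNIV \<rho>"
    and "finite (carrier G)"
    and "\<forall>g\<in>carrier G. linear (\<rho> g)"
    and "\<forall>g\<in>carrier G. eigen_coordinates G \<rho> g (y g)"
    and "\<xi> \<in> invariant_sections G \<rho> k"
    and "\<eta> \<in> invariant_sections G \<rho> l"
    and "\<alpha> \<in> carrier G"
    and "\<beta> \<in> carrier G"
    and "fixed_space \<rho> \<alpha> \<inter> fixed_space \<rho> \<beta> = fixed_space \<rho> (\<alpha> \<otimes>\<^bsub>G\<^esub> \<beta>)"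
  shows "contribution G \<rho> B y k l \<xi> \<eta> \<alpha> \<beta> =
    (\<lambda>p\<in>cxset (fixed_space \<rho> (\<alpha> \<otimes>\<^bsub>G\<^esub> \<beta>)). pr G \<rho> (\<alpha> \<otimes>\<^bsub>G\<^esub> \<beta>) (prelie B k l (\<xi> \<alpha>) (\<eta> \<beta>) p))"
proof -
  interpret R: finite_rep G \<rho> B
    using assms by (simp add: finite_rep_def faithful_action_def)
  interpret twisted_pair G \<rho> B y k l \<xi> \<eta> \<alpha> \<beta>
    using assms by unfold_locales auto
  have "p \<in> cxset (fixed_space \<rho> \<alpha>)" if "p \<in> cxset (fixed_space \<rho> (\<alpha> \<otimes>\<^bsub>G\<^esub> \<beta>))" for p
    using that assms(10) by (auto simp: cxset_def)
  then show ?thesis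
    unfolding contribution_def L3_def by (intro restrict_ext) (simp only: L2_P_cochain_eq_prelie)
qed

end
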